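(* Let $1\le m\le n-2$, and let $\Bbbk$, $R$, $I$, $n$, $d_i$, $S$, $g_i$, $\mathcal{K}_{m+1}$, $E=E_m$, $F$, $s$, $r$, $\sigma_1,\dots,\sigma_s$, $\mathcal{R}(E)\subset\mathcal{R}(F)=R[w_1,\dots,w_s]$ be as in the context. For $\underline{\alpha}\in\mathbb{N}^s$ write $\underline{w}^{\underline{\alpha}}=w_1^{\alpha_1}\cdots w_s^{\alpha_s}$ and $\underline{\alpha}\cdot\underline{\sigma}=\sum_{i=1}^s\alpha_i\sigma_i$. Then the set $$\{g_{m+1}\underline{w}^{\underline{\alpha}}\mid \underline{\alpha}\in\mathbb{N}^s,\ \alpha_{r+1}=\cdots=\alpha_s=0,\ \underline{\alpha}\cdot\underline{\sigma}\le d_{m+1}-d_m\}$$ is equal to the $x$-degree $\ge d_m$ part of a minimal generating set for $\mathcal{K}_{m+1}\mathcal{R}(E)$ as an $\mathcal{R}(E)$-module.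
   Context: Let $\Bbbk$ be a field, $R=\Bbbk[x_0,x_1]$ with the standard grading, $\mathfrak{m}=(x_0,x_1)$, $\mathbb{N}=\{0,1,2,\dots\}$. For a finitely generated $R$-module $E$, the Rees algebra $\mathcal{R}(E)$ is the symmetric algebra of $E$ modulo its $R$-torsion. Let $I\subset R$ be a height two ideal minimally generated by $n$ forms $f_1,\dots,f_n$ of degree $d$, with graded free (Hilbert-Burch) resolution $0\to\bigoplus_{i=1}^{n-1}R(-d_i)\xrightarrow{\varphi}R^n\to I(d)\to0$, $1\le d_1\le\cdots\le d_{n-1}$. Let $S=R[T_1,\dots,T_n]$, bigraded by $\deg x_i=(1,0)$, $\deg T_i=(0,1)$; the first degree is called $x$-degree, the second $T$-degree. Let $[g_1\ \cdots\ g_{n-1}]=[T_1\ \cdots\ T_n]\varphi$, so $g_i\in S$ has bidegree $(d_i,1)$. For $1\le m\le n-1$ let $\varphi_m$ be the matrix of the first $m$ columns of $\varphi$, $E_m=\operatorname{coker}\varphi_m$ (so $E_{n-1}=I(d)$), and let $\mathcal{K}_m$ be the kernel of the surjection $S\to\mathcal{R}(E_m)$ induced by $R^n\to E_m$; $\mathcal{K}=\mathcal{K}_{n-1}$. Fix $m$; set $s=n-m$, $E=E_m$ (a torsionfree module of rank $s$ generated in degree 0), $F=E^{**}$ where $-^*=\operatorname{Hom}_R(-,R)$. $F$ is graded free; fix $F\cong\bigoplus_{i=1}^sR(\sigma_i)$ with $\sigma_1\ge\cdots\ge\sigma_s\ge0$. Let $r$ be the integer with $1\le r\le s$ and $\sigma_1\ge\cdots\ge\sigma_r>0=\sigma_{r+1}=\cdots=\sigma_s$.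 Let $\xi:R^n\twoheadrightarrow E\hookrightarrow F$ be the composite map, viewed as an $s\times n$ matrix. Then $\mathcal{R}(F)=R[w_1,\dots,w_s]$ is a polynomial ring, $w_i$ corresponding to the $i$th basis element of $F$, bigraded by $\deg x_i=(1,0)$, $\deg w_i=(-\sigma_i,1)$, and $E\subset F$ induces an inclusion of bigraded rings $\mathcal{R}(E)=S/\mathcal{K}_m\subset\mathcal{R}(F)$ under which $[T_1\ \cdots\ T_n]=[w_1\ \cdots\ w_s]\xi$. $\mathcal{K}_{m+1}\mathcal{R}(E)$ denotes the image of $\mathcal{K}_{m+1}$ in $\mathcal{R}(E)$, and $g_{m+1}$ also denotes its image in $\mathcal{R}(E)\subset\mathcal{R}(F)$. *)

theory Defs
  imports
    "HOL-Library.Poly_Mapping"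
    "HOL-Library.Numeral_Type"
    "HOL-Library.Extended_Nat"
    "HOL-Algebra.QuotRing"
    "Jordan_Normal_Form.VS_Connect"
begin

section \<open>Polynomial rings\<close>

type_synonym ('v, 'a) mpoly = "('v \<Rightarrow>\<^sub>0 nat) \<Rightarrow>\<^sub>0 'a"

text \<open>The ring \<open>R = k[x\<^sub>0, x\<^sub>1]\<close>; the index type \<open>2\<close> has the two elements \<open>0\<close> and \<open>1\<close>.\<close>

type_synonym 'k plane_ring = "(2, 'k) mpoly"

definition MConst :: "'a \<Rightarrow> ('v, 'a::comm_ring_1) mpoly" where
  "MConst a = Poly_Mapping.single 0 a"

definition MVar :: "'v \<Rightarrow> ('v, 'a::comm_ring_1) mpoly" where
  "MVar v = Poly_Mapping.single (Poly_Mapping.single v 1) 1"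

definition mpoly_on :: "'v set \<Rightarrow> ('v, 'a::comm_ring_1) mpoly ring" where
  "mpoly_on V = \<lparr>carrier = {p. \<forall>\<alpha>\<in>Poly_Mapping.keys p. Poly_Mapping.keys \<alpha> \<subseteq> V},
     mult = (*), one = 1, zero = 0, add = (+)\<rparr>"

text \<open>The homomorphism of algebras over the coefficient ring that sends the variable \<open>v\<close> to \<open>h v\<close>.\<close>

definition alg_eval :: "('v \<Rightarrow> ('w, 'a) mpoly) \<Rightarrow> ('v, 'a::comm_ring_1) mpoly \<Rightarrow> ('w, 'a) mpoly" where
  "alg_eval h p = (\<Sum>\<alpha>\<in>Poly_Mapping.keys p. MConst (Poly_Mapping.lookup p \<alpha>) *
     (\<Prod>v\<in>Poly_Mapping.keys \<alpha>. h v ^ Poly_Mapping.lookup \<alpha> v))"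

definition mdeg :: "('v \<Rightarrow>\<^sub>0 nat) \<Rightarrow> nat" where
  "mdeg \<alpha> = (\<Sum>v\<in>Poly_Mapping.keys \<alpha>. Poly_Mapping.lookup \<alpha> v)"

text \<open>The component of degree \<open>j\<close> of \<open>R\<close>, zero included; it is \<open>{0}\<close> for \<open>j < 0\<close>.\<close>

definition forms :: "int \<Rightarrow> 'k::field plane_ring set" where
  "forms j = {p. \<forall>\<alpha>\<in>Poly_Mapping.keys p. int (mdeg \<alpha>) = j}"

section \<open>Ideals\<close>

definition prime_height :: "('a, 'b) ring_scheme \<Rightarrow> 'a set \<Rightarrow> enat" where
  "prime_height A P = Sup {enat k | k. \<exists>Q :: nat \<Rightarrow> 'a set.
     Q k = P \<and> (\<forall>i\<le>k. primeideal (Q i) A) \<and> (\<forall>i<k. Q i \<subset> Q (Suc i))}"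

definition ideal_height :: "('a, 'b) ring_scheme \<Rightarrow> 'a set \<Rightarrow> enat" where
  "ideal_height A I = Inf (prime_height A ` {P. primeideal P A \<and> I \<subseteq> P})"

text \<open>For an ideal \<open>N\<close> of \<open>A\<close>, regarded as an \<open>A\<close>-module, the submodule generated by a subset
  of \<open>N\<close> is the ideal it generates.\<close>

definition minimal_generating_set :: "('a, 'b) ring_scheme \<Rightarrow> 'a set \<Rightarrow> 'a set \<Rightarrow> bool" where
  "minimal_generating_set A G N \<longleftrightarrow>
     G \<subseteq> N \<and> Idl\<^bsub>A\<^esub> G = N \<and> (\<forall>H. H \<subset> G \<longrightarrow> Idl\<^bsub>A\<^esub> H \<noteq> N)"

section \<open>Quotients, cokernels and duals of modules\<close>

text \<open>As for \<^const>\<open>module_vec\<close>, the fields \<open>mult\<close> and \<open>one\<close> of a module record carry no meaning.\<close>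

definition quotient_module :: "('a, 'b) module \<Rightarrow> 'b set \<Rightarrow> ('a, 'b set) module" where
  "quotient_module M N = \<lparr>carrier = a_rcosets\<^bsub>M\<^esub> N, mult = undefined, one = undefined,
     zero = N, add = set_add M, smult = (\<lambda>a X. \<Union>x\<in>X. N +>\<^bsub>M\<^esub> (a \<odot>\<^bsub>M\<^esub> x))\<rparr>"

definition regular_module :: "('a::comm_ring_1, 'a) module" where
  "regular_module = \<lparr>carrier = UNIV, mult = (*), one = 1, zero = 0, add = (+), smult = (*)\<rparr>"

definition dual_module :: "('a::comm_ring_1, 'b) module \<Rightarrow> ('a, 'b \<Rightarrow> 'a) module" where
  "dual_module M = \<lparr>carrier = module_hom class_ring M regular_module \<inter> extensional (carrier M),
     mult = undefined, one = undefined,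
     zero = (\<lambda>x\<in>carrier M. 0),
     add = (\<lambda>f g. \<lambda>x\<in>carrier M. f x + g x),
     smult = (\<lambda>a f. \<lambda>x\<in>carrier M. a * f x)\<rparr>"

definition to_bidual :: "('a::comm_ring_1, 'b) module \<Rightarrow> 'b \<Rightarrow> ('b \<Rightarrow> 'a) \<Rightarrow> 'a" where
  "to_bidual M x = (\<lambda>f\<in>carrier (dual_module M). f x)"

definition col_space :: "'a::comm_ring_1 mat \<Rightarrow> 'a vec set" where
  "col_space A = (\<lambda>c. A *\<^sub>v c) ` carrier_vec (dim_col A)"

definition coker :: "'a::comm_ring_1 mat \<Rightarrow> ('a, 'a vec set) module" where
  "coker A = quotient_module (module_vec TYPE('a) (dim_row A)) (col_space A)"

definition coker_class :: "'a::comm_ring_1 mat \<Rightarrow> 'a vec \<Rightarrow> 'a vec set" where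
  "coker_class A v = col_space A +>\<^bsub>module_vec TYPE('a) (dim_row A)\<^esub> v"

definition first_cols :: "nat \<Rightarrow> 'a mat \<Rightarrow> 'a mat" where
  "first_cols m A = mat (dim_row A) m (\<lambda>(i, j). A $$ (i, j))"

section \<open>Gradings\<close>

text \<open>A grading of a module is given by its homogeneous components, indexed by the integers.
  The grading of a cokernel is induced by the standard grading of the free module, whose basis
  sits in degree 0.\<close>

definition coker_grading :: "'k::field plane_ring mat \<Rightarrow> int \<Rightarrow> 'k plane_ring vec set set" where
  "coker_grading A j =
     coker_class A ` {v \<in> carrier_vec (dim_row A). \<forall>i<dim_row A. v $ i \<in> forms j}"

definition dual_grading ::
  "('k::field plane_ring, 'b) module \<Rightarrow> (int \<Rightarrow> 'b set) \<Rightarrow> int \<Rightarrow> ('b \<Rightarrow> 'k plane_ring) set" where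
  "dual_grading M gr j = {f \<in> carrier (dual_module M). \<forall>i. \<forall>x\<in>gr i. f x \<in> forms (i + j)}"

text \<open>The component of degree \<open>j\<close> of the direct sum of the \<open>R(\<sigma> i)\<close>, \<open>i < s\<close>.\<close>

definition twisted_free :: "nat \<Rightarrow> (nat \<Rightarrow> nat) \<Rightarrow> int \<Rightarrow> 'k::field plane_ring vec set" where
  "twisted_free s \<sigma> j = {v \<in> carrier_vec s. \<forall>i<s. v $ i \<in> forms (j + int (\<sigma> i))}"

definition graded_iso_to_free ::
  "('k::field plane_ring, 'b) module \<Rightarrow> (int \<Rightarrow> 'b set) \<Rightarrow> nat \<Rightarrow> (nat \<Rightarrow> nat) \<Rightarrow>
     ('b \<Rightarrow> 'k plane_ring vec) \<Rightarrow> bool" where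
  "graded_iso_to_free F gr s \<sigma> \<Theta> \<longleftrightarrow>
     \<Theta> \<in> module_hom class_ring F (module_vec TYPE('k plane_ring) s) \<and>
     bij_betw \<Theta> (carrier F) (carrier_vec s) \<and>
     (\<forall>j. \<Theta> ` gr j = twisted_free s \<sigma> j)"

definition bidual :: "'k::field plane_ring mat \<Rightarrow>
    ('k plane_ring, ('k plane_ring vec set \<Rightarrow> 'k plane_ring) \<Rightarrow> 'k plane_ring) module" where
  "bidual A = dual_module (dual_module (coker A))"

definition bidual_grading :: "'k::field plane_ring mat \<Rightarrow> int \<Rightarrow>
    (('k plane_ring vec set \<Rightarrow> 'k plane_ring) \<Rightarrow> 'k plane_ring) set" where
  "bidual_grading A = dual_grading (dual_module (coker A)) (dual_grading (coker A) (coker_grading A))"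

text \<open>The matrix of \<open>R\<^sup>n \<longrightarrow> coker A \<longrightarrow> (coker A)\<^sup>*\<^sup>* \<longrightarrow> R\<^sup>s\<close>, the last map being \<open>\<Theta>\<close>.\<close>

definition xi_matrix :: "'k::field plane_ring mat \<Rightarrow> nat \<Rightarrow>
    ((('k plane_ring vec set \<Rightarrow> 'k plane_ring) \<Rightarrow> 'k plane_ring) \<Rightarrow> 'k plane_ring vec) \<Rightarrow>
    'k plane_ring mat" where
  "xi_matrix A s \<Theta> = mat s (dim_row A)
     (\<lambda>(i, j). \<Theta> (to_bidual (coker A) (coker_class A (unit_vec (dim_row A) j))) $ i)"

section \<open>Symmetric and Rees algebras\<close>

text \<open>The symmetric algebra of \<open>M\<close> is the polynomial ring with one variable for each element of
  \<open>M\<close>, modulo the relations that make \<open>M \<longrightarrow> Sym(M)\<close> linear.\<close>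

definition sym_relations :: "('a::comm_ring_1, 'b) module \<Rightarrow> ('b, 'a) mpoly set" where
  "sym_relations M = Idl\<^bsub>mpoly_on (carrier M)\<^esub>
     ({MVar (x \<oplus>\<^bsub>M\<^esub> y) - MVar x - MVar y | x y. x \<in> carrier M \<and> y \<in> carrier M} \<union>
      {MVar (a \<odot>\<^bsub>M\<^esub> x) - MConst a * MVar x | a x. x \<in> carrier M})"

definition sym_algebra :: "('a::comm_ring_1, 'b) module \<Rightarrow> ('b, 'a) mpoly set ring" where
  "sym_algebra M = mpoly_on (carrier M) Quot sym_relations M"

definition sym_class :: "('a::comm_ring_1, 'b) module \<Rightarrow> ('b, 'a) mpoly \<Rightarrow> ('b, 'a) mpoly set" where
  "sym_class M p = sym_relations M +>\<^bsub>mpoly_on (carrier M)\<^esub> p"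

definition sym_torsion :: "('a::idom, 'b) module \<Rightarrow> ('b, 'a) mpoly set set" where
  "sym_torsion M = {z \<in> carrier (sym_algebra M).
     \<exists>a. a \<noteq> 0 \<and> sym_class M (MConst a) \<otimes>\<^bsub>sym_algebra M\<^esub> z = \<zero>\<^bsub>sym_algebra M\<^esub>}"

definition rees_algebra :: "('a::idom, 'b) module \<Rightarrow> ('b, 'a) mpoly set set ring" where
  "rees_algebra M = sym_algebra M Quot sym_torsion M"

definition rees_class :: "('a::idom, 'b) module \<Rightarrow> ('b, 'a) mpoly \<Rightarrow> ('b, 'a) mpoly set set" where
  "rees_class M p = sym_torsion M +>\<^bsub>sym_algebra M\<^esub> sym_class M p"

text \<open>The kernel of \<open>R[T\<^sub>0, \<dots>, T\<^sub>n\<^sub>-\<^sub>1] \<longrightarrow> Rees(coker A)\<close>, where \<open>n\<close> is the number of rows of \<open>A\<close>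
  and \<open>T\<^sub>i\<close> goes to the class of the \<open>i\<close>-th unit vector.\<close>

definition rees_kernel :: "'a::idom mat \<Rightarrow> (nat, 'a) mpoly set" where
  "rees_kernel A = a_kernel (mpoly_on {..<dim_row A}) (rees_algebra (coker A))
     (\<lambda>p. rees_class (coker A)
        (alg_eval (\<lambda>i. MVar (coker_class A (unit_vec (dim_row A) i))) p))"

text \<open>The entry with index \<open>j\<close> of the row \<open>[T\<^sub>0 \<cdots> T\<^sub>n\<^sub>-\<^sub>1] A\<close>.\<close>

definition row_form :: "'a::comm_ring_1 mat \<Rightarrow> nat \<Rightarrow> (nat, 'a) mpoly" where
  "row_form A j = (\<Sum>i<dim_row A. MVar i * MConst (A $$ (i, j)))"

text \<open>The map \<open>R[T\<^sub>0, \<dots>, T\<^sub>n\<^sub>-\<^sub>1] \<longrightarrow> R[w\<^sub>0, \<dots>, w\<^sub>s\<^sub>-\<^sub>1]\<close> with \<open>[T\<^sub>0 \<cdots> T\<^sub>n\<^sub>-\<^sub>1] = [w\<^sub>0 \<cdots> w\<^sub>s\<^sub>-\<^sub>1] \<xi>\<close>, and its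
  image. When \<open>\<xi>\<close> is the matrix of \<open>R\<^sup>n \<longrightarrow> E \<longrightarrow> E\<^sup>*\<^sup>*\<close>, the target is the Rees algebra of
  \<open>E\<^sup>*\<^sup>*\<close> and the image is the subring \<open>Rees(E)\<close>.\<close>

definition to_w :: "'a::comm_ring_1 mat \<Rightarrow> (nat, 'a) mpoly \<Rightarrow> (nat, 'a) mpoly" where
  "to_w \<xi> = alg_eval (row_form \<xi>)"

definition rees_subring :: "'a::comm_ring_1 mat \<Rightarrow> (nat, 'a) mpoly ring" where
  "rees_subring \<xi> = (mpoly_on {..<dim_row \<xi>})
     \<lparr>carrier := to_w \<xi> ` carrier (mpoly_on {..<dim_col \<xi>})\<rparr>"

text \<open>The component of \<open>R[w]\<close> of \<open>x\<close>-degree \<open>a\<close> and \<open>T\<close>-degree \<open>b\<close>, where \<open>w\<^sub>i\<close> has bidegree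
  \<open>(- \<sigma> i, 1)\<close>: a term \<open>c w\<^sup>\<alpha>\<close> has \<open>x\<close>-degree \<open>deg c - \<alpha> \<cdot> \<sigma>\<close>.\<close>

definition bigraded_part :: "(nat \<Rightarrow> nat) \<Rightarrow> int \<Rightarrow> nat \<Rightarrow> (nat, 'k::field plane_ring) mpoly set" where
  "bigraded_part \<sigma> a b = {p. \<forall>\<alpha>\<in>Poly_Mapping.keys p. mdeg \<alpha> = b \<and>
     Poly_Mapping.lookup p \<alpha> \<in>
       forms (a + int (\<Sum>i\<in>Poly_Mapping.keys \<alpha>. Poly_Mapping.lookup \<alpha> i * \<sigma> i))}"

end

theory Submission
  imports Defs "HOL-Computational_Algebra.Polynomial_Factorial"
begin

text \<open>Write \<open>R = k[x\<^sub>0, x\<^sub>1]\<close>, \<open>S = R[T]\<close>, and let \<open>g\<close> be the image of the \<open>m\<close>-th column form in \<open>R[w]\<close>, the Rees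
algebra of \<open>F = E\<^sup>*\<^sup>*\<close>; the Rees algebra of \<open>E\<close> is the image of \<open>S\<close> in \<open>R[w]\<close>. Columns are counted
from 0, so the degree bound of the theorem is \<open>d (m - 1)\<close> and \<open>g\<close> has degree \<open>d m\<close>.

Everything rests on one fact: once \<open>x\<^sub>0\<close> or \<open>x\<^sub>1\<close> is inverted, the module \<open>E\<close> and its quotient by the
class of the next column are free. Indeed an ideal of height two that is generated by forms contains powers of
both variables (\<open>variable_power_in_height_two_ideal\<close>), and exactness of the resolution turns
\<open>x\<^sub>i\<^sup>N \<in> I\<close> into a matrix \<open>\<psi>\<close> with \<open>\<psi> \<phi> = x\<^sub>i\<^sup>N\<close> (\<open>hilbert_burch_left_inverse\<close>). From \<open>\<psi>\<close> one reads off
that \<open>ker \<xi>\<close> is the column space of \<open>\<phi>\<^sub>m\<close>, that \<open>\<xi>\<close> has a right inverse up to \<open>x\<^sub>i\<^sup>N\<close>, and that the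
coefficient vector of \<open>g\<close> is unimodular up to a power of \<open>x\<^sub>i\<close>. Statements are proved after
multiplication by a power of \<open>x\<^sub>0\<close> and by a power of \<open>x\<^sub>1\<close>, and the powers are then cancelled, because
\<open>x\<^sub>0\<^sup>M u = x\<^sub>1\<^sup>M v\<close> forces \<open>x\<^sub>1\<^sup>M\<close> to divide \<open>u\<close>. This replaces local cohomology and gives two facts.

\<^item> The ideal in question is \<open>K = Rees(E) \<inter> g R[w]\<close> (\<open>K_eq_image\<close>, \<open>rees_kernel_eq\<close>).
\<^item> \<open>Rees(E)\<close> and \<open>R[w]\<close> agree in \<open>x\<close>-degree at least \<open>d (m - 1) - 1\<close> (\<open>high_degree_in_RE\<close>). The bound
  appears because a form of degree at least \<open>2N - 1\<close> in two variables lies in \<open>(x\<^sub>0\<^sup>N, x\<^sub>1\<^sup>N)\<close>.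

Now let \<open>\<nn>\<close> be the ideal of \<open>Rees(E)\<close> generated by the \<open>x\<^sub>i\<close> and \<open>T\<^sub>j\<close>, and take \<open>g h \<in> K\<close> of \<open>x\<close>-degree at
least \<open>d (m - 1)\<close>. If a term \<open>c w\<^sup>\<mu>\<close> of \<open>h\<close> has \<open>deg c > 0\<close>, write \<open>c = x\<^sub>0 c\<^sub>0 + x\<^sub>1 c\<^sub>1\<close>; the elements
\<open>g c\<^sub>i w\<^sup>\<mu>\<close> have \<open>x\<close>-degree at least \<open>d (m - 1) - 1\<close>, so they lie in \<open>K\<close>, and \<open>g c w\<^sup>\<mu>\<close> lies in \<open>\<nn> K\<close>. The
degree bound \<open>d (m - 1)\<close> is there to leave room for this one step. A variable \<open>w\<^sub>l\<close> with
\<open>\<sigma> l = 0\<close> is an element of \<open>\<nn>\<close> plus a combination of the other variables with coefficients of positive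
degree, so it disappears as well. What is left modulo \<open>\<nn> K\<close> is spanned by the elements
\<open>g w\<^sup>\<alpha>\<close> of the theorem (\<open>high_degree_in_span\<close>). They are independent modulo \<open>\<nn> K\<close>, because
setting \<open>x\<^sub>0, x\<^sub>1\<close> and the \<open>w\<^sub>l\<close> with \<open>\<sigma> l = 0\<close> to zero kills \<open>\<nn>\<close> and leaves the monomials in the other
variables alone (\<open>A0_independent\<close>). Extending them by elements of smaller \<open>x\<close>-degree to a basis of
\<open>K/\<nn> K\<close> and applying the graded Nakayama lemma gives the minimal generating set
(\<open>exists_minimal_generators\<close>).\<close>

section \<open>Substitutions in polynomial rings\<close>

abbreviation "lookup \<equiv> Poly_Mapping.lookup"
abbreviation "keys \<equiv> Poly_Mapping.keys"
abbreviation "single \<equiv> Poly_Mapping.single"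

lemma sum_of_singles: "p = (\<Sum>\<alpha>\<in>keys p. single \<alpha> (lookup p \<alpha>))"
proof (rule poly_mapping_eqI)
  fix \<beta>
  show "lookup p \<beta> = lookup (\<Sum>\<alpha>\<in>keys p. single \<alpha> (lookup p \<alpha>)) \<beta>"
    by (cases "\<beta> \<in> keys p")
       (auto simp: lookup_sum lookup_single when_def sum.delta in_keys_iff)
qed

definition power_prod :: "('v \<Rightarrow> 'b::comm_ring_1) \<Rightarrow> ('v \<Rightarrow>\<^sub>0 nat) \<Rightarrow> 'b" where
  "power_prod h \<alpha> = (\<Prod>v\<in>keys \<alpha>. h v ^ lookup \<alpha> v)"

lemma power_prod_superset:
  assumes "finite V" "keys \<alpha> \<subseteq> V"
  shows "power_prod h \<alpha> = (\<Prod>v\<in>V. h v ^ lookup \<alpha> v)"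
  unfolding power_prod_def
  by (rule prod.mono_neutral_left) (use assms in \<open>auto simp: in_keys_iff\<close>)

lemma power_prod_add: "power_prod h (\<alpha> + \<beta>) = power_prod h \<alpha> * power_prod h \<beta>"
proof -
  let ?V = "keys \<alpha> \<union> keys \<beta>"
  have "keys (\<alpha> + \<beta>) \<subseteq> ?V" by (rule Poly_Mapping.keys_add)
  then have "power_prod h (\<alpha> + \<beta>) = (\<Prod>v\<in>?V. h v ^ lookup (\<alpha> + \<beta>) v)"
    by (intro power_prod_superset) auto
  also have "\<dots> = (\<Prod>v\<in>?V. h v ^ lookup \<alpha> v) * (\<Prod>v\<in>?V. h v ^ lookup \<beta> v)"
    by (simp add: lookup_add power_add prod.distrib)
  also have "\<dots> = power_prod h \<alpha> * power_prod h \<beta>"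
    by (simp add: power_prod_superset[of ?V])
  finally show ?thesis .
qed

lemma power_prod_zero [simp]: "power_prod h 0 = 1"
  by (simp add: power_prod_def)

lemma power_prod_single [simp]: "power_prod h (single v k) = h v ^ k"
  by (cases "k = 0") (auto simp: power_prod_def)

text \<open>The value of a polynomial under a map \<open>f\<close> of coefficients and an assignment \<open>h\<close> of the variables.
Besides \<^const>\<open>alg_eval\<close> it covers reduction modulo \<open>x\<^sub>0, x\<^sub>1\<close> and the affine charts of the plane.\<close>

definition subst :: "('a \<Rightarrow> 'b) \<Rightarrow> ('v \<Rightarrow> 'b) \<Rightarrow> ('v, 'a::comm_ring_1) mpoly \<Rightarrow> 'b::comm_ring_1" where
  "subst f h p = (\<Sum>\<alpha>\<in>keys p. f (lookup p \<alpha>) * power_prod h \<alpha>)"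

lemma comm_ring_hom_subst:
  fixes f :: "'a::comm_ring_1 \<Rightarrow> 'b::comm_ring_1" and h :: "'v \<Rightarrow> 'b"
  assumes "comm_ring_hom f"
  shows "comm_ring_hom (subst f h)"
proof -
  interpret comm_ring_hom f by (fact assms)
  have single: "subst f h (single \<alpha> c) = f c * power_prod h \<alpha>" for \<alpha> c
    by (cases "c = 0") (auto simp: subst_def)
  have add: "subst f h (p + q) = subst f h p + subst f h q" for p q
    unfolding subst_def
    by (rule setsum_keys_plus_distrib) (auto simp: hom_distribs distrib_right)
  have zero: "subst f h 0 = 0" by (simp add: subst_def)
  have sum: "subst f h (sum q A) = (\<Sum>a\<in>A. subst f h (q a))" for q :: "'c \<Rightarrow> _" and A
    by (induction A rule: infinite_finite_induct) (auto simp: add zero)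
  have sum': "subst f h (sum q A) = (\<Sum>a\<in>A. subst f h (q a))" for q :: "('v \<Rightarrow>\<^sub>0 nat) \<Rightarrow> _" and A
    by (induction A rule: infinite_finite_induct) (auto simp: add zero)
  have "subst f h (p * q) = subst f h p * subst f h q" for p q
  proof -
    have "p * q = (\<Sum>\<alpha>\<in>keys p. single \<alpha> (lookup p \<alpha>)) * (\<Sum>\<beta>\<in>keys q. single \<beta> (lookup q \<beta>))"
      using sum_of_singles[of p] sum_of_singles[of q] by simp
    also have "\<dots> = (\<Sum>\<alpha>\<in>keys p. \<Sum>\<beta>\<in>keys q. single (\<alpha> + \<beta>) (lookup p \<alpha> * lookup q \<beta>))"
      by (simp add: sum_product mult_single)
    finally have "subst f h (p * q) =
      (\<Sum>\<alpha>\<in>keys p. \<Sum>\<beta>\<in>keys q. f (lookup p \<alpha> * lookup q \<beta>) * power_prod h (\<alpha> + \<beta>))"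
      by (simp add: sum' single)
    also have "\<dots> = subst f h p * subst f h q"
      unfolding subst_def sum_product
      by (simp add: power_prod_add hom_distribs mult_ac)
    finally show ?thesis .
  qed
  moreover have "subst f h 1 = 1"
    using single[of 0 1] by (simp)
  ultimately show ?thesis
    by unfold_locales (auto simp: add zero)
qed

lemma subst_single:
  assumes "comm_ring_hom f"
  shows "subst f h (single \<alpha> c) = f c * power_prod h \<alpha>"
proof -
  interpret comm_ring_hom f by (fact assms)
  show ?thesis by (cases "c = 0") (auto simp: subst_def)
qed

lemma comm_ring_hom_MConst: "comm_ring_hom (MConst :: 'a::comm_ring_1 \<Rightarrow> ('v,'a) mpoly)"
  by unfold_locales (auto simp: MConst_def single_add mult_single)

interpretation MConst: comm_ring_hom MConst
  by (rule comm_ring_hom_MConst)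

lemma alg_eval_eq_subst: "alg_eval = subst MConst"
  by (intro ext) (simp add: alg_eval_def subst_def power_prod_def)

lemma comm_ring_hom_alg_eval: "comm_ring_hom (alg_eval h)"
  by (simp add: alg_eval_eq_subst comm_ring_hom_subst comm_ring_hom_MConst)

interpretation alg_eval: comm_ring_hom "alg_eval h"
  by (rule comm_ring_hom_alg_eval)

lemma alg_eval_single: "alg_eval h (single \<alpha> c) = MConst c * power_prod h \<alpha>"
  by (simp add: alg_eval_eq_subst subst_single comm_ring_hom_MConst)

lemma alg_eval_MConst [simp]: "alg_eval h (MConst c) = MConst c"
  using alg_eval_single[of h 0 c] by (simp add: MConst_def)

lemma alg_eval_MVar [simp]: "alg_eval h (MVar v) = h v"
  unfolding MVar_def by (simp add: alg_eval_single)

lemma single_eq_MConst_power_prod: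
  "single \<alpha> c = MConst c * power_prod MVar \<alpha>"
proof -
  have "power_prod MVar \<alpha> = single \<alpha> (1::'b::comm_ring_1)" for \<alpha> :: "'a \<Rightarrow>\<^sub>0 nat"
  proof -
    have "(\<Prod>v\<in>V. MVar v ^ lookup \<alpha> v) = single (\<Sum>v\<in>V. single v (lookup \<alpha> v)) (1::'b)" if "finite V" for V
      using that
    proof induction
      case (insert v V)
      have "MVar v ^ k = single (single v k) (1::'b)" for k
        by (induction k) (auto simp: MVar_def mult_single single_add[symmetric])
      with insert show ?case by (simp add: mult_single)
    qed simp
    from this[of "keys \<alpha>"] show ?thesis
      using sum_of_singles[of \<alpha>] by (simp add: power_prod_def)
  qed
  then show ?thesis by (simp add: MConst_def mult_single)
qed

lemma comm_ring_hom_comp_on_power_prod: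
  assumes "comm_ring_hom F"
  shows "F (power_prod h \<alpha>) = power_prod (\<lambda>v. F (h v)) \<alpha>"
proof -
  interpret comm_ring_hom F by (fact assms)
  show ?thesis by (simp add: power_prod_def hom_prod hom_power)
qed

lemma mpoly_hom_eqI:
  assumes "comm_ring_hom F" "comm_ring_hom G"
    and "\<And>c. F (MConst c) = G (MConst c)"
    and "\<And>\<alpha> v. \<alpha> \<in> keys p \<Longrightarrow> v \<in> keys \<alpha> \<Longrightarrow> F (MVar v) = G (MVar v)"
  shows "F p = G p"
proof -
  interpret F: comm_ring_hom F by (fact assms)
  interpret G: comm_ring_hom G by (fact assms)
  have "F (single \<alpha> (lookup p \<alpha>)) = G (single \<alpha> (lookup p \<alpha>))" if "\<alpha> \<in> keys p" for \<alpha>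
  proof -
    have "F (power_prod MVar \<alpha>) = G (power_prod MVar \<alpha>)"
      unfolding comm_ring_hom_comp_on_power_prod[OF assms(1)] comm_ring_hom_comp_on_power_prod[OF assms(2)]
      unfolding power_prod_def using assms(4)[OF that] by (intro prod.cong) auto
    then show ?thesis
      by (simp add: single_eq_MConst_power_prod F.hom_mult G.hom_mult assms(3))
  qed
  then have "(\<Sum>\<alpha>\<in>keys p. F (single \<alpha> (lookup p \<alpha>))) = (\<Sum>\<alpha>\<in>keys p. G (single \<alpha> (lookup p \<alpha>)))"
    by simp
  then show ?thesis
    using sum_of_singles[of p] by (metis F.hom_sum G.hom_sum)
qed

lemma alg_eval_MVar_id [simp]: "alg_eval MVar p = p"
  by (rule mpoly_hom_eqI[of "alg_eval MVar" "\<lambda>x. x", OF comm_ring_hom_alg_eval])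
     (auto, unfold_locales, auto)

lemma comm_ring_hom_compose:
  "comm_ring_hom F \<Longrightarrow> comm_ring_hom G \<Longrightarrow> comm_ring_hom (\<lambda>x. F (G x))"
proof -
  assume "comm_ring_hom F" "comm_ring_hom G"
  then interpret F: comm_ring_hom F + G: comm_ring_hom G by simp_all
  show ?thesis by unfold_locales (auto simp: F.hom_mult G.hom_mult F.hom_add G.hom_add)
qed

lemma alg_eval_alg_eval: "alg_eval h (alg_eval k p) = alg_eval (\<lambda>v. alg_eval h (k v)) p"
  by (rule mpoly_hom_eqI[of "\<lambda>p. alg_eval h (alg_eval k p)"])
     (auto intro: comm_ring_hom_compose comm_ring_hom_alg_eval)

lemma alg_eval_cong:
  "(\<And>\<alpha> v. \<alpha> \<in> keys p \<Longrightarrow> v \<in> keys \<alpha> \<Longrightarrow> h v = k v) \<Longrightarrow> alg_eval h p = alg_eval k p"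
  by (rule mpoly_hom_eqI) (auto simp: comm_ring_hom_alg_eval)

lemma lookup_MConst_mult [simp]: "lookup (MConst c * p) \<alpha> = c * lookup p \<alpha>"
proof -
  have "MConst c * p = Poly_Mapping.map ((*) c) p"
    by (simp add: MConst_def mult_map_scale_conv_mult)
  then show ?thesis by (simp add: map.rep_eq when_def)
qed

lemma MConst_eq_iff [simp]: "MConst a = MConst b \<longleftrightarrow> a = b"
  unfolding MConst_def by (metis lookup_single_eq)

subsection \<open>Polynomials in a given set of variables\<close>

definition mpolys :: "'v set \<Rightarrow> ('v, 'a::comm_ring_1) mpoly set" where
  "mpolys V = {p. \<forall>\<alpha>\<in>keys p. keys \<alpha> \<subseteq> V}"

lemma carrier_mpoly_on [simp]: "carrier (mpoly_on V) = mpolys V"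
  by (simp add: mpoly_on_def mpolys_def)

lemma mpolys_add [intro]: "p \<in> mpolys V \<Longrightarrow> q \<in> mpolys V \<Longrightarrow> p + q \<in> mpolys V"
  using Poly_Mapping.keys_add[of p q] unfolding mpolys_def by blast

lemma mpolys_uminus [intro]: "p \<in> mpolys V \<Longrightarrow> - p \<in> mpolys V"
  unfolding mpolys_def by (auto simp: in_keys_iff)

lemma mpolys_diff [intro]: "p \<in> mpolys V \<Longrightarrow> q \<in> mpolys V \<Longrightarrow> p - q \<in> mpolys V"
  using mpolys_add[of p V "- q"] mpolys_uminus by auto

lemma mpolys_mult [intro]: "p \<in> mpolys V \<Longrightarrow> q \<in> mpolys V \<Longrightarrow> p * q \<in> mpolys V"
proof -
  assume pq: "p \<in> mpolys V" "q \<in> mpolys V"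
  have "keys (\<alpha> + \<beta>) \<subseteq> V" if "\<alpha> \<in> keys p" "\<beta> \<in> keys q" for \<alpha> \<beta>
    using pq that Poly_Mapping.keys_add[of \<alpha> \<beta>] unfolding mpolys_def by blast
  then show ?thesis using Poly_Mapping.keys_mult[of p q] unfolding mpolys_def by blast
qed

lemma mpolys_zero [simp, intro]: "0 \<in> mpolys V" by (simp add: mpolys_def)

lemma mpolys_MConst [simp, intro]: "MConst c \<in> mpolys V"
  by (auto simp: mpolys_def MConst_def split: if_splits)

lemma mpolys_one [simp, intro]: "1 \<in> mpolys V"
  using mpolys_MConst[of 1 V] by simp

lemma mpolys_MVar [intro]: "v \<in> V \<Longrightarrow> MVar v \<in> mpolys V"
  by (auto simp: mpolys_def MVar_def split: if_splits)

lemma mpolys_sum [intro]: "(\<And>i. i \<in> A \<Longrightarrow> p i \<in> mpolys V) \<Longrightarrow> sum p A \<in> mpolys V"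
  by (induction A rule: infinite_finite_induct) auto

lemma mpolys_prod [intro]: "(\<And>i. i \<in> A \<Longrightarrow> p i \<in> mpolys V) \<Longrightarrow> prod p A \<in> mpolys V"
  by (induction A rule: infinite_finite_induct) auto

lemma mpolys_power [intro]: "p \<in> mpolys V \<Longrightarrow> p ^ k \<in> mpolys V"
  by (induction k) auto

lemma mpolys_UNIV [simp]: "mpolys UNIV = UNIV" by (auto simp: mpolys_def)

lemma mpolys_alg_eval [intro]:
  assumes "p \<in> mpolys V" "\<And>v. v \<in> V \<Longrightarrow> h v \<in> mpolys W"
  shows "alg_eval h p \<in> mpolys W"
  unfolding alg_eval_eq_subst subst_def power_prod_def
  using assms unfolding mpolys_def[of V] by (intro mpolys_sum mpolys_mult mpolys_prod mpolys_power mpolys_MConst) blast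

text \<open>Setting the variables outside \<open>V\<close> to zero fixes \<open>g\<close> and \<open>g h\<close>, and \<open>g\<close> can be cancelled. Quotients
found by division are placed in the right polynomial ring with this lemma.\<close>

lemma mpolys_sub_cancel:
  fixes g :: "('v::linorder, 'a::idom) mpoly"
  assumes "g \<in> mpolys V" "g * h \<in> mpolys V" "g \<noteq> 0"
  shows "h \<in> mpolys V"
proof -
  define \<pi> where "\<pi> = alg_eval (\<lambda>v. if v \<in> V then MVar v else (0 :: ('v, 'a) mpoly))"
  have id: "\<pi> p = p" if "p \<in> mpolys V" for p
  proof -
    have "\<pi> p = alg_eval MVar p" unfolding \<pi>_def
      by (rule alg_eval_cong) (use that in \<open>auto simp: mpolys_def\<close>)
    then show ?thesis by simp
  qed
  have mem: "\<pi> p \<in> mpolys V" for p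
    unfolding \<pi>_def by (rule mpolys_alg_eval[of _ UNIV]) auto
  have "\<pi> (g * h) = \<pi> g * \<pi> h" by (simp add: \<pi>_def alg_eval.hom_mult)
  then have "g * h = g * \<pi> h"
    using id[OF assms(2)] id[OF assms(1)] by metis
  with assms(3) have "h = \<pi> h" by (metis mult_left_cancel)
  with mem[of h] show ?thesis by metis
qed

section \<open>Gradings\<close>

definition wt :: "('v \<Rightarrow> nat) \<Rightarrow> ('v \<Rightarrow>\<^sub>0 nat) \<Rightarrow> nat" where
  "wt \<sigma> \<alpha> = (\<Sum>v\<in>keys \<alpha>. lookup \<alpha> v * \<sigma> v)"

lemma wt_superset:
  assumes "finite V" "keys \<alpha> \<subseteq> V"
  shows "wt \<sigma> \<alpha> = (\<Sum>v\<in>V. lookup \<alpha> v * \<sigma> v)"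
  unfolding wt_def by (rule sum.mono_neutral_left) (use assms in \<open>auto simp: in_keys_iff\<close>)

lemma wt_zero [simp]: "wt \<sigma> 0 = 0" by (simp add: wt_def)

lemma wt_single [simp]: "wt \<sigma> (single v k) = k * \<sigma> v"
  by (cases "k = 0") (auto simp: wt_def)

lemma wt_add: "wt \<sigma> (\<alpha> + \<beta>) = wt \<sigma> \<alpha> + wt \<sigma> \<beta>"
proof -
  let ?V = "keys \<alpha> \<union> keys \<beta>"
  have "keys (\<alpha> + \<beta>) \<subseteq> ?V" by (rule Poly_Mapping.keys_add)
  then have "wt \<sigma> (\<alpha> + \<beta>) = (\<Sum>v\<in>?V. lookup (\<alpha> + \<beta>) v * \<sigma> v)"
    by (intro wt_superset) auto
  also have "\<dots> = (\<Sum>v\<in>?V. lookup \<alpha> v * \<sigma> v) + (\<Sum>v\<in>?V. lookup \<beta> v * \<sigma> v)"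
    by (simp add: lookup_add distrib_right sum.distrib)
  also have "\<dots> = wt \<sigma> \<alpha> + wt \<sigma> \<beta>"
    by (simp add: wt_superset[of ?V])
  finally show ?thesis .
qed

lemma mdeg_eq_wt: "mdeg \<alpha> = wt (\<lambda>_. 1) \<alpha>"
  by (simp add: mdeg_def wt_def)

lemma mdeg_add: "mdeg (\<alpha> + \<beta>) = mdeg \<alpha> + mdeg \<beta>" by (simp add: mdeg_eq_wt wt_add)
lemma mdeg_zero [simp]: "mdeg 0 = 0" by (simp add: mdeg_eq_wt)
lemma mdeg_single [simp]: "mdeg (single v k) = k" by (simp add: mdeg_eq_wt)

lemma mdeg_eq_0_iff [simp]: "mdeg \<alpha> = 0 \<longleftrightarrow> \<alpha> = 0"
proof
  assume "mdeg \<alpha> = 0"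
  then have "\<forall>v\<in>keys \<alpha>. lookup \<alpha> v = 0" by (simp add: mdeg_def)
  then show "\<alpha> = 0" by (intro poly_mapping_eqI) (metis in_keys_iff lookup_zero)
qed simp

lemma wt_const_zero [simp]: "wt (\<lambda>_. 0) \<alpha> = 0" by (simp add: wt_def)

subsection \<open>Forms\<close>

lemma formsD: "p \<in> forms j \<Longrightarrow> \<mu> \<in> keys p \<Longrightarrow> int (mdeg \<mu>) = j"
  by (simp add: forms_def)

lemma forms_zero [simp, intro]: "0 \<in> forms j" by (simp add: forms_def)

lemma forms_add [intro]: "p \<in> forms j \<Longrightarrow> q \<in> forms j \<Longrightarrow> p + q \<in> forms j"
  using Poly_Mapping.keys_add[of p q] unfolding forms_def by blast

lemma forms_uminus [intro]: "p \<in> forms j \<Longrightarrow> - p \<in> forms j"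
  unfolding forms_def by (auto simp: in_keys_iff)

lemma forms_sum [intro]: "(\<And>i. i \<in> A \<Longrightarrow> p i \<in> forms j) \<Longrightarrow> sum p A \<in> forms j"
  by (induction A rule: infinite_finite_induct) auto

lemma forms_mult: "p \<in> forms i \<Longrightarrow> q \<in> forms j \<Longrightarrow> p * q \<in> forms (i + j)"
  using Poly_Mapping.keys_mult[of p q] unfolding forms_def by (fastforce simp: mdeg_add)

lemma forms_single: "int (mdeg \<mu>) = j \<Longrightarrow> single \<mu> c \<in> forms j"
  by (auto simp: forms_def split: if_splits)

lemma forms_MConst [simp, intro]: "MConst c \<in> forms 0"
  unfolding MConst_def by (rule forms_single) simp

lemma forms_MVar [simp, intro]: "MVar i \<in> forms 1"
  unfolding MVar_def by (rule forms_single) simp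

lemma forms_power: "p \<in> forms j \<Longrightarrow> p ^ k \<in> forms (int k * j)"
proof (induction k)
  case 0
  then show ?case using forms_MConst[of 1] by simp
next
  case (Suc k)
  then have "p * p ^ k \<in> forms (j + int k * j)" by (intro forms_mult) auto
  then show ?case by (simp add: algebra_simps)
qed

lemma forms_neg: "p \<in> forms j \<Longrightarrow> j < 0 \<Longrightarrow> p = 0"
  using formsD[of p j] by (metis keys_eq_empty ex_in_conv of_nat_0_le_iff not_less)

lemma forms_0_const: "p \<in> forms 0 \<Longrightarrow> p = MConst (lookup p 0)"
proof (rule poly_mapping_eqI)
  fix \<mu> assume p: "p \<in> forms 0"
  show "lookup p \<mu> = lookup (MConst (lookup p 0)) \<mu>"
  proof (cases "\<mu> = 0")
    case False
    then have "\<mu> \<notin> keys p" using formsD[OF p, of \<mu>] by auto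
    with False show ?thesis by (simp add: MConst_def lookup_single in_keys_iff)
  qed (simp add: MConst_def)
qed

lemma forms_pos_lookup_0: "p \<in> forms j \<Longrightarrow> j \<noteq> 0 \<Longrightarrow> lookup p 0 = 0"
  using formsD[of p j 0] by (auto simp: in_keys_iff)

lemma forms_unique: "p \<in> forms i \<Longrightarrow> p \<in> forms j \<Longrightarrow> p \<noteq> 0 \<Longrightarrow> i = j"
  using formsD[of p] by (metis keys_eq_empty ex_in_conv)

definition hcomp :: "int \<Rightarrow> 'k::field plane_ring \<Rightarrow> 'k plane_ring" where
  "hcomp j p = Poly_Mapping.mapp (\<lambda>\<mu> c. if int (mdeg \<mu>) = j then c else 0) p"

lemma lookup_hcomp: "lookup (hcomp j p) \<mu> = (if int (mdeg \<mu>) = j then lookup p \<mu> else 0)"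
  by (auto simp: hcomp_def lookup_mapp when_def in_keys_iff)

lemma hcomp_forms [intro]: "hcomp j p \<in> forms j"
  by (auto simp: forms_def in_keys_iff lookup_hcomp split: if_splits)

lemma hcomp_add: "hcomp j (p + q) = hcomp j p + hcomp j q"
  by (rule poly_mapping_eqI) (simp add: lookup_hcomp lookup_add)

lemma hcomp_zero [simp]: "hcomp j 0 = 0"
  by (rule poly_mapping_eqI) (simp add: lookup_hcomp)

lemma hcomp_of_form: "p \<in> forms i \<Longrightarrow> hcomp j p = (if i = j then p else 0)"
  by (rule poly_mapping_eqI) (auto simp: lookup_hcomp in_keys_iff dest: formsD)

subsection \<open>Bigraded parts of a polynomial ring\<close>

lemma bigraded_part_wt:
  "bigraded_part \<sigma> a b = {p. \<forall>\<alpha>\<in>keys p. mdeg \<alpha> = b \<and> lookup p \<alpha> \<in> forms (a + int (wt \<sigma> \<alpha>))}"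
  by (simp add: bigraded_part_def wt_def)

lemma bigraded_partI:
  assumes "\<And>\<alpha>. \<alpha> \<in> keys p \<Longrightarrow> mdeg \<alpha> = b"
    and "\<And>\<alpha>. \<alpha> \<in> keys p \<Longrightarrow> lookup p \<alpha> \<in> forms (a + int (wt \<sigma> \<alpha>))"
  shows "p \<in> bigraded_part \<sigma> a b"
  using assms by (simp add: bigraded_part_wt)

lemma bigraded_part_lookup: "p \<in> bigraded_part \<sigma> a b \<Longrightarrow> lookup p \<alpha> \<in> forms (a + int (wt \<sigma> \<alpha>))"
  by (cases "\<alpha> \<in> keys p") (auto simp: bigraded_part_wt in_keys_iff)

lemma bigraded_part_mdeg: "p \<in> bigraded_part \<sigma> a b \<Longrightarrow> \<alpha> \<in> keys p \<Longrightarrow> mdeg \<alpha> = b"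
  by (auto simp: bigraded_part_wt)

lemma bigraded_part_zero [simp, intro]: "0 \<in> bigraded_part \<sigma> a b"
  by (simp add: bigraded_part_wt)

lemma bigraded_part_add [intro]:
  assumes "p \<in> bigraded_part \<sigma> a b" "q \<in> bigraded_part \<sigma> a b"
  shows "p + q \<in> bigraded_part \<sigma> a b"
proof (rule bigraded_partI)
  fix \<alpha> assume "\<alpha> \<in> keys (p + q)"
  then have "\<alpha> \<in> keys p \<union> keys q" using Poly_Mapping.keys_add[of p q] by blast
  then show "mdeg \<alpha> = b" using assms by (auto dest: bigraded_part_mdeg)
  show "lookup (p + q) \<alpha> \<in> forms (a + int (wt \<sigma> \<alpha>))"
    using assms by (auto simp: lookup_add bigraded_part_lookup)
qed

lemma bigraded_part_uminus [intro]: "p \<in> bigraded_part \<sigma> a b \<Longrightarrow> - p \<in> bigraded_part \<sigma> a b"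
  by (auto simp: bigraded_part_wt in_keys_iff)

lemma bigraded_part_diff [intro]:
  "p \<in> bigraded_part \<sigma> a b \<Longrightarrow> q \<in> bigraded_part \<sigma> a b \<Longrightarrow> p - q \<in> bigraded_part \<sigma> a b"
  using bigraded_part_add[of p \<sigma> a b "- q"] by auto

lemma bigraded_part_sum [intro]:
  "(\<And>i. i \<in> A \<Longrightarrow> p i \<in> bigraded_part \<sigma> a b) \<Longrightarrow> sum p A \<in> bigraded_part \<sigma> a b"
  by (induction A rule: infinite_finite_induct) auto

lemma bigraded_part_single:
  "mdeg \<alpha> = b \<Longrightarrow> c \<in> forms (a + int (wt \<sigma> \<alpha>)) \<Longrightarrow> single \<alpha> c \<in> bigraded_part \<sigma> a b"
  by (auto intro!: bigraded_partI split: if_splits)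

lemma bigraded_part_MConst [intro]: "c \<in> forms a \<Longrightarrow> MConst c \<in> bigraded_part \<sigma> a 0"
  unfolding MConst_def by (rule bigraded_part_single) auto

lemma bigraded_part_MVar: "a = - int (\<sigma> v) \<Longrightarrow> MVar v \<in> bigraded_part \<sigma> a 1"
  unfolding MVar_def using forms_MConst[of 1] by (intro bigraded_part_single) auto

lemma bigraded_part_mult:
  assumes "p \<in> bigraded_part \<sigma> a b" "q \<in> bigraded_part \<sigma> a' b'"
  shows "p * q \<in> bigraded_part \<sigma> (a + a') (b + b')"
proof -
  have "p * q = (\<Sum>\<alpha>\<in>keys p. single \<alpha> (lookup p \<alpha>)) * (\<Sum>\<beta>\<in>keys q. single \<beta> (lookup q \<beta>))"
    using sum_of_singles[of p] sum_of_singles[of q] by simp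
  also have "\<dots> = (\<Sum>\<alpha>\<in>keys p. \<Sum>\<beta>\<in>keys q. single (\<alpha> + \<beta>) (lookup p \<alpha> * lookup q \<beta>))"
    by (simp add: sum_product mult_single)
  also have "\<dots> \<in> bigraded_part \<sigma> (a + a') (b + b')"
  proof (intro bigraded_part_sum bigraded_part_single)
    fix \<alpha> \<beta> assume "\<alpha> \<in> keys p" "\<beta> \<in> keys q"
    with assms show "mdeg (\<alpha> + \<beta>) = b + b'" by (simp add: mdeg_add bigraded_part_mdeg)
    have "lookup p \<alpha> * lookup q \<beta> \<in> forms ((a + int (wt \<sigma> \<alpha>)) + (a' + int (wt \<sigma> \<beta>)))"
      using assms by (intro forms_mult bigraded_part_lookup)
    then show "lookup p \<alpha> * lookup q \<beta> \<in> forms (a + a' + int (wt \<sigma> (\<alpha> + \<beta>)))"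
      by (simp add: wt_add add_ac)
  qed
  finally show ?thesis .
qed

lemma bigraded_part_power:
  "p \<in> bigraded_part \<sigma> a b \<Longrightarrow> p ^ k \<in> bigraded_part \<sigma> (int k * a) (k * b)"
proof (induction k)
  case 0
  then show ?case using bigraded_part_MConst[OF forms_MConst[of 1]] by simp
next
  case (Suc k)
  then have "p * p ^ k \<in> bigraded_part \<sigma> (a + int k * a) (b + k * b)"
    by (intro bigraded_part_mult) auto
  then show ?case by (simp add: algebra_simps)
qed

lemma bigraded_part_prod:
  "(\<And>i. i \<in> A \<Longrightarrow> p i \<in> bigraded_part \<sigma> (a i) (b i)) \<Longrightarrow>
   prod p A \<in> bigraded_part \<sigma> (sum a A) (sum b A)"
proof (induction A rule: infinite_finite_induct)
  case (insert x F)
  then show ?case by (auto intro: bigraded_part_mult)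
qed (use bigraded_part_MConst[OF forms_MConst[of 1], of \<sigma>] in auto)

lemma bigraded_part_unique:
  assumes "p \<in> bigraded_part \<sigma> a b" "p \<in> bigraded_part \<sigma> a' b'" "p \<noteq> 0"
  shows "a = a'" "b = b'"
proof -
  from assms(3) obtain \<alpha> where \<alpha>: "\<alpha> \<in> keys p" by (metis keys_eq_empty ex_in_conv)
  then show "b = b'" using assms bigraded_part_mdeg by metis
  have "lookup p \<alpha> \<noteq> 0" using \<alpha> by (simp add: in_keys_iff)
  then have "a + int (wt \<sigma> \<alpha>) = a' + int (wt \<sigma> \<alpha>)"
    using forms_unique[OF bigraded_part_lookup[OF assms(1)] bigraded_part_lookup[OF assms(2)]] by blast
  then show "a = a'" by simp
qed

definition bicomp :: "(nat \<Rightarrow> nat) \<Rightarrow> int \<Rightarrow> nat \<Rightarrow> (nat, 'k::field plane_ring) mpoly \<Rightarrow> (nat, 'k plane_ring) mpoly" where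
  "bicomp \<sigma> a b p = Poly_Mapping.mapp (\<lambda>\<alpha> c. if mdeg \<alpha> = b then hcomp (a + int (wt \<sigma> \<alpha>)) c else 0) p"

lemma lookup_bicomp:
  "lookup (bicomp \<sigma> a b p) \<alpha> = (if mdeg \<alpha> = b then hcomp (a + int (wt \<sigma> \<alpha>)) (lookup p \<alpha>) else 0)"
  by (auto simp: bicomp_def lookup_mapp when_def in_keys_iff)

lemma bicomp_in [intro]: "bicomp \<sigma> a b p \<in> bigraded_part \<sigma> a b"
  by (rule bigraded_partI) (auto simp: in_keys_iff lookup_bicomp split: if_splits)

lemma bicomp_add: "bicomp \<sigma> a b (p + q) = bicomp \<sigma> a b p + bicomp \<sigma> a b q"
  by (rule poly_mapping_eqI) (simp add: lookup_bicomp lookup_add hcomp_add)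

lemma bicomp_zero [simp]: "bicomp \<sigma> a b 0 = 0"
  by (rule poly_mapping_eqI) (simp add: lookup_bicomp)

lemma bicomp_sum: "bicomp \<sigma> a b (sum p A) = (\<Sum>i\<in>A. bicomp \<sigma> a b (p i))"
  by (induction A rule: infinite_finite_induct) (auto simp: bicomp_add)

lemma bicomp_homogeneous:
  assumes "p \<in> bigraded_part \<sigma> a b"
  shows "bicomp \<sigma> a' b' p = (if a = a' \<and> b = b' then p else 0)"
proof (rule poly_mapping_eqI)
  fix \<alpha>
  show "lookup (bicomp \<sigma> a' b' p) \<alpha> = lookup (if a = a' \<and> b = b' then p else 0) \<alpha>"
    using bigraded_part_lookup[OF assms, of \<alpha>] bigraded_part_mdeg[OF assms, of \<alpha>]
    by (cases "\<alpha> \<in> keys p") (auto simp: lookup_bicomp hcomp_of_form in_keys_iff)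
qed

lemma bicomp_mpolys [intro]: "p \<in> mpolys V \<Longrightarrow> bicomp \<sigma> a b p \<in> mpolys V"
  by (auto simp: mpolys_def in_keys_iff lookup_bicomp split: if_splits)

text \<open>The index set may be enlarged at will, so that sums for two polynomials, or a sum and one
prescribed bidegree, can be taken over the same set.\<close>

lemma sum_of_bicomps:
  fixes p :: "(nat, 'k::field plane_ring) mpoly"
  obtains D where "finite D" "\<And>D'. finite D' \<Longrightarrow> D \<subseteq> D' \<Longrightarrow> p = (\<Sum>(a,b)\<in>D'. bicomp \<sigma> a b p)"
proof
  define D where "D = (\<lambda>(\<alpha>, \<mu>). (int (mdeg \<mu>) - int (wt \<sigma> \<alpha>), mdeg \<alpha>)) `
    (SIGMA \<alpha>:keys p. keys (lookup p \<alpha>))"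
  show "finite D" by (simp add: D_def)
  fix D' assume D': "finite D'" "D \<subseteq> D'"
  show "p = (\<Sum>(a,b)\<in>D'. bicomp \<sigma> a b p)"
  proof (intro poly_mapping_eqI)
    fix \<alpha> \<mu>
    let ?c = "lookup (lookup p \<alpha>) \<mu>"
    let ?d = "(int (mdeg \<mu>) - int (wt \<sigma> \<alpha>), mdeg \<alpha>)"
    have "lookup (lookup (\<Sum>(a,b)\<in>D'. bicomp \<sigma> a b p) \<alpha>) \<mu> = (\<Sum>d\<in>D'. if ?d = d then ?c else 0)"
      unfolding lookup_sum
      by (intro sum.cong) (auto simp: lookup_bicomp lookup_hcomp split: if_splits)
    also have "\<dots> = (if ?d \<in> D' then ?c else 0)" using D'(1) by simp
    also have "\<dots> = ?c"
    proof (cases "?c = 0")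
      case False
      then have "\<alpha> \<in> keys p" "\<mu> \<in> keys (lookup p \<alpha>)" by (auto simp: in_keys_iff)
      then have "?d \<in> D" unfolding D_def by force
      with D' show ?thesis by auto
    qed simp
    finally show "lookup (lookup p \<alpha>) \<mu> = lookup (lookup (\<Sum>(a,b)\<in>D'. bicomp \<sigma> a b p) \<alpha>) \<mu>" ..
  qed
qed

text \<open>Write \<open>p\<close> as the sum of its components. Each summand is moved to a single bidegree, so only one of
them contributes to a given component of the value. Multiplication by a bihomogeneous element and
substitution of bihomogeneous elements are the two instances.\<close>

lemma bicomp_additive_map:
  fixes F :: "(nat, 'k::field plane_ring) mpoly \<Rightarrow> (nat, 'k plane_ring) mpoly"
  assumes zero: "F 0 = 0" and add: "\<And>p q. F (p + q) = F p + F q"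
    and hom: "\<And>a b. F (bicomp \<sigma> a b p) \<in> bigraded_part \<tau> (a + a0) (b + b0)"
  shows "bicomp \<tau> a b (F p) = (if b0 \<le> b then F (bicomp \<sigma> (a - a0) (b - b0) p) else 0)"
proof -
  have sum: "F (sum q A) = (\<Sum>i\<in>A. F (q i))" for q :: "int \<times> nat \<Rightarrow> (nat, 'k plane_ring) mpoly" and A
    by (induction A rule: infinite_finite_induct) (auto simp: zero add)
  obtain D where D: "finite D" "\<And>D'. finite D' \<Longrightarrow> D \<subseteq> D' \<Longrightarrow> p = (\<Sum>(a,b)\<in>D'. bicomp \<sigma> a b p)"
    using sum_of_bicomps[where p = p and \<sigma> = \<sigma>] by metis
  let ?e = "(a - a0, b - b0)"
  let ?D = "insert ?e D"
  have "bicomp \<tau> a b (F p) = bicomp \<tau> a b (F (\<Sum>(a,b)\<in>?D. bicomp \<sigma> a b p))"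
    using D(2)[of ?D] D(1) by (metis finite_insert subset_insertI)
  also have "\<dots> = (\<Sum>d\<in>?D. bicomp \<tau> a b (F (bicomp \<sigma> (fst d) (snd d) p)))"
    by (simp add: sum bicomp_sum case_prod_beta)
  also have "\<dots> = (\<Sum>d\<in>?D. if d = ?e then (if b0 \<le> b then F (bicomp \<sigma> (fst d) (snd d) p) else 0) else 0)"
    by (intro sum.cong refl) (auto simp: bicomp_homogeneous[OF hom] prod_eq_iff)
  also have "\<dots> = (if b0 \<le> b then F (bicomp \<sigma> (a - a0) (b - b0) p) else 0)"
    using D(1) by (subst sum.delta) auto
  finally show ?thesis .
qed

lemma bicomp_mult:
  assumes "g \<in> bigraded_part \<sigma> a0 b0"
  shows "bicomp \<sigma> a b (g * p) = (if b0 \<le> b then g * bicomp \<sigma> (a - a0) (b - b0) p else 0)"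
proof (rule bicomp_additive_map)
  fix a b
  have "g * bicomp \<sigma> a b p \<in> bigraded_part \<sigma> (a0 + a) (b0 + b)"
    using assms by (intro bigraded_part_mult bicomp_in)
  then show "g * bicomp \<sigma> a b p \<in> bigraded_part \<sigma> (a + a0) (b + b0)" by (simp add: add.commute)
qed (auto simp: distrib_left)

lemma bigraded_part_alg_eval:
  assumes p: "p \<in> bigraded_part (\<lambda>_. 0) a b" and V: "p \<in> mpolys V"
    and h: "\<And>v. v \<in> V \<Longrightarrow> h v \<in> bigraded_part \<tau> 0 1"
  shows "alg_eval h p \<in> bigraded_part \<tau> a b"
  unfolding alg_eval_def
proof (rule bigraded_part_sum)
  fix \<alpha> assume \<alpha>: "\<alpha> \<in> keys p"
  have "(\<Prod>v\<in>keys \<alpha>. h v ^ lookup \<alpha> v) \<in> bigraded_part \<tau> (\<Sum>v\<in>keys \<alpha>. int (lookup \<alpha> v) * 0) (\<Sum>v\<in>keys \<alpha>. lookup \<alpha> v * 1)"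
    using \<alpha> V h by (intro bigraded_part_prod bigraded_part_power) (auto simp: mpolys_def)
  then have "(\<Prod>v\<in>keys \<alpha>. h v ^ lookup \<alpha> v) \<in> bigraded_part \<tau> 0 b"
    using bigraded_part_mdeg[OF p \<alpha>] by (simp add: mdeg_def)
  moreover have "MConst (lookup p \<alpha>) \<in> bigraded_part \<tau> a 0"
    using bigraded_part_lookup[OF p, of \<alpha>] by (intro bigraded_part_MConst) simp
  ultimately show "MConst (lookup p \<alpha>) * (\<Prod>v\<in>keys \<alpha>. h v ^ lookup \<alpha> v) \<in> bigraded_part \<tau> a b"
    using bigraded_part_mult by fastforce
qed

lemma bicomp_alg_eval:
  assumes V: "p \<in> mpolys V" and h: "\<And>v. v \<in> V \<Longrightarrow> h v \<in> bigraded_part \<tau> 0 1"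
  shows "bicomp \<tau> a b (alg_eval h p) = alg_eval h (bicomp (\<lambda>_. 0) a b p)"
proof -
  have "bicomp \<tau> a b (alg_eval h p) =
    (if 0 \<le> b then alg_eval h (bicomp (\<lambda>_. 0) (a - 0) (b - 0) p) else 0)"
    by (rule bicomp_additive_map)
       (use assms in \<open>auto simp: alg_eval.hom_add intro: bigraded_part_alg_eval\<close>)
  then show ?thesis by simp
qed

subsection \<open>Two variables\<close>

lemma two_cases: "(i::2) = 0 \<or> i = 1"
proof (cases i)
  case (of_int z)
  then have "z = 0 \<or> z = 1" by auto
  with of_int show ?thesis by auto
qed

lemma mdeg_two: "mdeg (\<mu> :: 2 \<Rightarrow>\<^sub>0 nat) = lookup \<mu> 0 + lookup \<mu> 1"
  unfolding mdeg_eq_wt by (subst wt_superset[of "{0, 1}"]) (use two_cases in auto)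

lemma lookup_single_mult: "lookup (single \<alpha> c * p) (\<alpha> + \<beta>) = c * lookup p (\<beta> :: _ \<Rightarrow>\<^sub>0 nat)"
proof -
  have "single \<alpha> c * p = (\<Sum>\<gamma>\<in>keys p. single (\<alpha> + \<gamma>) (c * lookup p \<gamma>))"
    by (subst sum_of_singles[of p]) (simp add: sum_distrib_left mult_single)
  then have "lookup (single \<alpha> c * p) (\<alpha> + \<beta>) = (\<Sum>\<gamma>\<in>keys p. if \<gamma> = \<beta> then c * lookup p \<gamma> else 0)"
    by (auto simp: lookup_sum lookup_single when_def intro!: sum.cong)
  then show ?thesis by (simp add: in_keys_iff)
qed

lemma MVar_power: "MVar v ^ k = (single (single v k) 1 :: ('v, 'a::comm_ring_1) mpoly)"
  by (induction k) (auto simp: MVar_def mult_single single_add[symmetric])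

lemma MVar_nonzero [simp]: "MVar v \<noteq> (0 :: ('v, 'a::comm_ring_1) mpoly)"
  unfolding MVar_def by (metis lookup_single_eq lookup_zero one_neq_zero)

lemma split_off_variable:
  assumes "k \<le> lookup \<mu> v"
  shows "single \<mu> c = MVar v ^ k * single (\<mu> - single v k) c"
proof -
  have "single v k + (\<mu> - single v k) = \<mu>"
    using assms by (intro poly_mapping_eqI) (auto simp: lookup_add lookup_minus lookup_single when_def)
  then show ?thesis by (simp add: MVar_power mult_single)
qed

text \<open>Monomials of the left side that survive in \<open>p\<close> must be divisible by the power of the other
variable. This elementary form of depth two allows results that hold up to powers of each
variable to be combined.\<close>

lemma variable_powers_coprime:
  fixes p q :: "('v, 'a::comm_ring_1) mpoly"
  assumes eq: "MVar i ^ M * p = MVar j ^ N * q" and ij: "i \<noteq> j"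
  obtains u where "p = MVar j ^ N * u"
proof -
  have "N \<le> lookup \<mu> j" if "\<mu> \<in> keys p" for \<mu>
  proof -
    have "lookup (MVar j ^ N * q) (single i M + \<mu>) \<noteq> 0"
      using that by (metis MVar_power eq in_keys_iff lookup_single_mult mult_1)
    then have "single i M + \<mu> \<in> keys (single (single j N) 1 * q)"
      by (simp add: MVar_power in_keys_iff)
    then obtain \<alpha> \<nu> where "\<alpha> \<in> keys (single (single j N) (1::'a))" "single i M + \<mu> = \<alpha> + \<nu>"
      using Poly_Mapping.keys_mult[of "single (single j N) 1" q] by blast
    then have "lookup (single i M + \<mu>) j = N + lookup \<nu> j"
      by (auto simp: lookup_add split: if_splits)
    then show ?thesis using ij by (simp add: lookup_add lookup_single)
  qed
  then have "(\<Sum>\<mu>\<in>keys p. single \<mu> (lookup p \<mu>)) = (\<Sum>\<mu>\<in>keys p. MVar j ^ N * single (\<mu> - single j N) (lookup p \<mu>))"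
    by (intro sum.cong refl split_off_variable)
  then have "p = MVar j ^ N * (\<Sum>\<mu>\<in>keys p. single (\<mu> - single j N) (lookup p \<mu>))"
    using sum_of_singles[of p] by (simp add: sum_distrib_left)
  then show ?thesis by (rule that)
qed

lemma mdeg_minus_single:
  assumes "k \<le> lookup \<mu> v" shows "mdeg (\<mu> - single v k) + k = mdeg \<mu>"
proof -
  have "(\<mu> - single v k) + single v k = \<mu>"
    using assms by (intro poly_mapping_eqI) (auto simp: lookup_add lookup_minus lookup_single when_def)
  then show ?thesis using mdeg_add[of "\<mu> - single v k" "single v k"] by simp
qed

text \<open>A monomial of degree at least \<open>2N - 1\<close> has exponent at least \<open>N\<close> in one of the two variables. The
bound is sharp, and it is the source of the degree bound for the Rees algebra; the case
\<open>N = 1\<close> splits off a variable from a form of positive degree.\<close>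

lemma form_split:
  assumes c: "c \<in> forms D" and D: "2 * int N \<le> D + 1"
  obtains c0 c1 where "c = MVar 0 ^ N * c0 + MVar 1 ^ N * c1"
    "c0 \<in> forms (D - int N)" "c1 \<in> forms (D - int N)"
proof -
  define A where "A = {\<mu> \<in> keys c. N \<le> lookup \<mu> 0}"
  define B where "B = {\<mu> \<in> keys c. \<not> N \<le> lookup \<mu> 0}"
  define c0 where "c0 = (\<Sum>\<mu>\<in>A. single (\<mu> - single 0 N) (lookup c \<mu>))"
  define c1 where "c1 = (\<Sum>\<mu>\<in>B. single (\<mu> - single 1 N) (lookup c \<mu>))"
  have B: "N \<le> lookup \<mu> 1" if "\<mu> \<in> B" for \<mu>
  proof -
    have "int (mdeg \<mu>) = D" using that c unfolding B_def by (auto dest: formsD)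
    then have "2 * int N \<le> int (lookup \<mu> 0) + int (lookup \<mu> 1) + 1" using D by (simp add: mdeg_two)
    then show ?thesis using that by (simp add: B_def)
  qed
  have "c = (\<Sum>\<mu>\<in>A. single \<mu> (lookup c \<mu>)) + (\<Sum>\<mu>\<in>B. single \<mu> (lookup c \<mu>))"
    using sum_of_singles[of c]
    by (subst sum.union_disjoint[symmetric]) (auto simp: A_def B_def intro!: arg_cong[of _ _ "sum _"] elim!: trans)
  also have "(\<Sum>\<mu>\<in>A. single \<mu> (lookup c \<mu>)) = MVar 0 ^ N * c0"
    unfolding c0_def sum_distrib_left by (intro sum.cong refl split_off_variable) (auto simp: A_def)
  also have "(\<Sum>\<mu>\<in>B. single \<mu> (lookup c \<mu>)) = MVar 1 ^ N * c1"
    unfolding c1_def sum_distrib_left by (intro sum.cong refl split_off_variable B)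
  finally have eq: "c = MVar 0 ^ N * c0 + MVar 1 ^ N * c1" .
  have "c0 \<in> forms (D - int N)" unfolding c0_def
  proof (intro forms_sum forms_single)
    fix \<mu> assume "\<mu> \<in> A"
    then show "int (mdeg (\<mu> - single 0 N)) = D - int N"
      using mdeg_minus_single[of N \<mu> 0] formsD[OF c, of \<mu>] by (auto simp: A_def)
  qed
  moreover have "c1 \<in> forms (D - int N)" unfolding c1_def
  proof (intro forms_sum forms_single)
    fix \<mu> assume "\<mu> \<in> B"
    then show "int (mdeg (\<mu> - single 1 N)) = D - int N"
      using mdeg_minus_single[of N \<mu> 1] formsD[OF c, of \<mu>] B[of \<mu>] by (auto simp: B_def)
  qed
  ultimately show ?thesis using eq that by blast
qed

lemma bigraded_split:
  assumes p: "p \<in> bigraded_part \<sigma> a b" "p \<in> mpolys V"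
    and big: "\<And>\<alpha>. \<alpha> \<in> keys p \<Longrightarrow> 2 * int N \<le> a + int (wt \<sigma> \<alpha>) + 1"
  obtains p0 p1 where "p = MConst (MVar 0 ^ N) * p0 + MConst (MVar 1 ^ N) * p1"
    "p0 \<in> bigraded_part \<sigma> (a - int N) b" "p1 \<in> bigraded_part \<sigma> (a - int N) b"
    "p0 \<in> mpolys V" "p1 \<in> mpolys V"
proof -
  have "\<forall>\<alpha>\<in>keys p. \<exists>c. lookup p \<alpha> = MVar 0 ^ N * fst c + MVar 1 ^ N * snd c \<and>
    fst c \<in> forms (a + int (wt \<sigma> \<alpha>) - int N) \<and> snd c \<in> forms (a + int (wt \<sigma> \<alpha>) - int N)"
  proof
    fix \<alpha> assume "\<alpha> \<in> keys p"
    from form_split[OF bigraded_part_lookup[OF p(1), of \<alpha>] big[OF this]]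
    show "\<exists>c. lookup p \<alpha> = MVar 0 ^ N * fst c + MVar 1 ^ N * snd c \<and>
      fst c \<in> forms (a + int (wt \<sigma> \<alpha>) - int N) \<and> snd c \<in> forms (a + int (wt \<sigma> \<alpha>) - int N)"
      by (metis fst_conv snd_conv)
  qed
  then obtain c where c: "\<And>\<alpha>. \<alpha> \<in> keys p \<Longrightarrow> lookup p \<alpha> = MVar 0 ^ N * fst (c \<alpha>) + MVar 1 ^ N * snd (c \<alpha>)"
    and c': "\<And>\<alpha>. \<alpha> \<in> keys p \<Longrightarrow> fst (c \<alpha>) \<in> forms (a + int (wt \<sigma> \<alpha>) - int N)"
      "\<And>\<alpha>. \<alpha> \<in> keys p \<Longrightarrow> snd (c \<alpha>) \<in> forms (a + int (wt \<sigma> \<alpha>) - int N)"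
    by metis
  let ?p0 = "\<Sum>\<alpha>\<in>keys p. single \<alpha> (fst (c \<alpha>))" and ?p1 = "\<Sum>\<alpha>\<in>keys p. single \<alpha> (snd (c \<alpha>))"
  have "p = (\<Sum>\<alpha>\<in>keys p. single \<alpha> (MVar 0 ^ N * fst (c \<alpha>) + MVar 1 ^ N * snd (c \<alpha>)))"
    by (subst sum_of_singles) (auto simp: c intro!: sum.cong)
  also have "\<dots> = MConst (MVar 0 ^ N) * ?p0 + MConst (MVar 1 ^ N) * ?p1"
    by (simp add: MConst_def sum_distrib_left mult_single single_add sum.distrib)
  finally have eq: "p = MConst (MVar 0 ^ N) * ?p0 + MConst (MVar 1 ^ N) * ?p1" .
  have memV: "(\<Sum>\<alpha>\<in>keys p. single \<alpha> (f \<alpha>)) \<in> mpolys V" for f :: "_ \<Rightarrow> 'a plane_ring"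
    by (rule mpolys_sum) (use p(2) in \<open>auto simp: mpolys_def split: if_splits\<close>)
  show ?thesis
  proof (rule that[OF eq])
    show "?p0 \<in> bigraded_part \<sigma> (a - int N) b" "?p1 \<in> bigraded_part \<sigma> (a - int N) b"
      using c' p(1) by (auto intro!: bigraded_part_sum bigraded_part_single simp: bigraded_part_mdeg algebra_simps)
  qed (rule memV)+
qed

lemma MConst_variable_powers_coprime:
  fixes p q :: "(nat, 'k::field plane_ring) mpoly"
  assumes eq: "MConst (MVar i ^ M) * p = MConst (MVar j ^ N) * q" and ij: "i \<noteq> j"
  obtains u where "p = MConst (MVar j ^ N) * u"
proof -
  have "\<exists>c. lookup p \<alpha> = MVar j ^ N * c" for \<alpha>
  proof -
    have "MVar i ^ M * lookup p \<alpha> = MVar j ^ N * lookup q \<alpha>"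
      using arg_cong[OF eq, of "\<lambda>p. lookup p \<alpha>"] by simp
    from variable_powers_coprime[OF this ij] show ?thesis by metis
  qed
  then obtain c where c: "\<And>\<alpha>. lookup p \<alpha> = MVar j ^ N * c \<alpha>" by metis
  have "p = (\<Sum>\<alpha>\<in>keys p. single \<alpha> (MVar j ^ N * c \<alpha>))"
    using sum_of_singles[of p] c by simp
  also have "\<dots> = MConst (MVar j ^ N) * (\<Sum>\<alpha>\<in>keys p. single \<alpha> (c \<alpha>))"
    by (simp add: MConst_def sum_distrib_left mult_single)
  finally show ?thesis by (rule that)
qed

section \<open>Linear substitutions\<close>

text \<open>The homogeneous polynomials for the total degree alone. Some substitutions below have coefficients
that are not homogeneous in \<open>x\<^sub>0, x\<^sub>1\<close>; they preserve this grading but not the bigrading.\<close>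

definition tpart :: "nat \<Rightarrow> ('v, 'a::comm_ring_1) mpoly set" where
  "tpart b = {p. \<forall>\<alpha>\<in>keys p. mdeg \<alpha> = b}"

lemma tpart_zero [simp, intro]: "0 \<in> tpart b" by (simp add: tpart_def)

lemma tpart_add [intro]: "p \<in> tpart b \<Longrightarrow> q \<in> tpart b \<Longrightarrow> p + q \<in> tpart b"
  using Poly_Mapping.keys_add[of p q] unfolding tpart_def by blast

lemma tpart_uminus [intro]: "p \<in> tpart b \<Longrightarrow> - p \<in> tpart b"
  unfolding tpart_def by (auto simp: in_keys_iff)

lemma tpart_diff [intro]: "p \<in> tpart b \<Longrightarrow> q \<in> tpart b \<Longrightarrow> p - q \<in> tpart b"
  using tpart_add[of p b "- q"] by auto

lemma tpart_sum [intro]: "(\<And>i. i \<in> A \<Longrightarrow> p i \<in> tpart b) \<Longrightarrow> sum p A \<in> tpart b"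
  by (induction A rule: infinite_finite_induct) auto

lemma tpart_mult: "p \<in> tpart b \<Longrightarrow> q \<in> tpart c \<Longrightarrow> p * q \<in> tpart (b + c)"
  using Poly_Mapping.keys_mult[of p q] unfolding tpart_def by (fastforce simp: mdeg_add)

lemma tpart_MConst [simp, intro]: "MConst c \<in> tpart 0"
  by (auto simp: tpart_def MConst_def split: if_splits)

lemma tpart_MConst_mult [intro]: "p \<in> tpart b \<Longrightarrow> MConst c * p \<in> tpart b"
  using tpart_mult[of "MConst c" 0 p b] by simp

lemma tpart_MVar [simp, intro]: "MVar v \<in> tpart 1"
  by (auto simp: tpart_def MVar_def split: if_splits)

lemma tpart_power: "p \<in> tpart b \<Longrightarrow> p ^ k \<in> tpart (k * b)"
proof (induction k)
  case 0
  then show ?case using tpart_MConst[of 1] by simp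
next
  case (Suc k)
  then have "p * p ^ k \<in> tpart (b + k * b)" by (intro tpart_mult) auto
  then show ?case by simp
qed

lemma tpart_prod: "(\<And>i. i \<in> A \<Longrightarrow> p i \<in> tpart (b i)) \<Longrightarrow> prod p A \<in> tpart (sum b A)"
proof (induction A rule: infinite_finite_induct)
  case (insert x F)
  then show ?case by (auto intro: tpart_mult)
qed (use tpart_MConst[of 1] in auto)

lemma tpart_alg_eval:
  assumes p: "p \<in> tpart b" and h: "\<And>v. h v \<in> tpart 1"
  shows "alg_eval h p \<in> tpart b"
  unfolding alg_eval_def
proof (rule tpart_sum)
  fix \<alpha> assume \<alpha>: "\<alpha> \<in> keys p"
  have "(\<Prod>v\<in>keys \<alpha>. h v ^ lookup \<alpha> v) \<in> tpart (\<Sum>v\<in>keys \<alpha>. lookup \<alpha> v * 1)"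
    by (intro tpart_prod tpart_power h)
  then have "(\<Prod>v\<in>keys \<alpha>. h v ^ lookup \<alpha> v) \<in> tpart b"
    using p \<alpha> by (auto simp: tpart_def mdeg_def)
  then show "MConst (lookup p \<alpha>) * (\<Prod>v\<in>keys \<alpha>. h v ^ lookup \<alpha> v) \<in> tpart b" ..
qed

lemma bigraded_part_tpart: "p \<in> bigraded_part \<sigma> a b \<Longrightarrow> p \<in> tpart b"
  by (auto simp: tpart_def dest: bigraded_part_mdeg)

definition tcomp :: "nat \<Rightarrow> ('v, 'a::comm_ring_1) mpoly \<Rightarrow> ('v, 'a) mpoly" where
  "tcomp b p = Poly_Mapping.mapp (\<lambda>\<alpha> c. if mdeg \<alpha> = b then c else 0) p"

lemma lookup_tcomp: "lookup (tcomp b p) \<alpha> = (if mdeg \<alpha> = b then lookup p \<alpha> else 0)"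
  by (auto simp: tcomp_def lookup_mapp when_def in_keys_iff)

lemma tcomp_tpart [simp, intro]: "tcomp b p \<in> tpart b"
  by (auto simp: tpart_def in_keys_iff lookup_tcomp split: if_splits)

lemma tcomp_add: "tcomp b (p + q) = tcomp b p + tcomp b q"
  by (rule poly_mapping_eqI) (simp add: lookup_tcomp lookup_add)

lemma tcomp_zero [simp]: "tcomp b 0 = 0"
  by (rule poly_mapping_eqI) (simp add: lookup_tcomp)

lemma tcomp_sum: "tcomp b (sum p A) = (\<Sum>i\<in>A. tcomp b (p i))"
  by (induction A rule: infinite_finite_induct) (auto simp: tcomp_add)

lemma tcomp_of_tpart: "p \<in> tpart b \<Longrightarrow> tcomp c p = (if b = c then p else 0)"
  by (rule poly_mapping_eqI) (auto simp: lookup_tcomp tpart_def in_keys_iff)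

lemma tcomp_mpolys [intro]: "p \<in> mpolys V \<Longrightarrow> tcomp b p \<in> mpolys V"
  by (auto simp: mpolys_def in_keys_iff lookup_tcomp split: if_splits)

lemma sum_of_tcomps:
  obtains D where "\<And>D'. D \<le> D' \<Longrightarrow> p = (\<Sum>b\<le>D'. tcomp b p)"
proof
  fix D' assume D': "Max (insert 0 (mdeg ` keys p)) \<le> D'"
  show "p = (\<Sum>b\<le>D'. tcomp b p)"
  proof (rule poly_mapping_eqI)
    fix \<alpha>
    have "lookup (\<Sum>b\<le>D'. tcomp b p) \<alpha> = (if mdeg \<alpha> \<le> D' then lookup p \<alpha> else 0)"
      by (simp add: lookup_sum lookup_tcomp)
    also have "\<dots> = lookup p \<alpha>"
    proof (cases "\<alpha> \<in> keys p")
      case True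
      then have "mdeg \<alpha> \<le> D'" using D' by auto
      then show ?thesis by simp
    qed (simp add: in_keys_iff)
    finally show "lookup p \<alpha> = lookup (\<Sum>b\<le>D'. tcomp b p) \<alpha>" ..
  qed
qed

lemma tcomp_alg_eval:
  assumes "\<And>v. h v \<in> tpart 1"
  shows "tcomp b (alg_eval h p) = alg_eval h (tcomp b p)"
proof -
  obtain D where D: "\<And>D'. D \<le> D' \<Longrightarrow> p = (\<Sum>b\<le>D'. tcomp b p)"
    using sum_of_tcomps[of p] by blast
  have "p = (\<Sum>c\<le>max b D. tcomp c p)" by (rule D) simp
  then have "tcomp b (alg_eval h p) = tcomp b (alg_eval h (\<Sum>c\<le>max b D. tcomp c p))" by simp
  also have "\<dots> = (\<Sum>c\<le>max b D. tcomp b (alg_eval h (tcomp c p)))"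
    by (simp add: alg_eval.hom_sum tcomp_sum)
  also have "\<dots> = (\<Sum>c\<le>max b D. if c = b then alg_eval h (tcomp c p) else 0)"
    by (intro sum.cong refl tcomp_of_tpart tpart_alg_eval tcomp_tpart assms)
  also have "\<dots> = alg_eval h (tcomp b p)" by simp
  finally show ?thesis .
qed

subsection \<open>Linear forms and matrices\<close>

definition lin_form :: "'a::comm_ring_1 vec \<Rightarrow> (nat, 'a) mpoly" where
  "lin_form v = (\<Sum>i<dim_vec v. MVar i * MConst (v $ i))"

lemma row_form_eq: "row_form A j = lin_form (col A j)"
  by (simp add: row_form_def lin_form_def col_def)

lemma lin_form_tpart [simp, intro]: "lin_form v \<in> tpart 1"
  unfolding lin_form_def
proof (rule tpart_sum)
  fix i show "MVar i * MConst (v $ i) \<in> tpart 1"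
    using tpart_mult[OF tpart_MVar[of i] tpart_MConst[of "v $ i"]] by simp
qed

lemma lin_form_mpolys: "v \<in> carrier_vec n \<Longrightarrow> lin_form v \<in> mpolys {..<n}"
  unfolding lin_form_def by (auto intro!: mpolys_sum mpolys_mult mpolys_MVar)

lemma lin_form_add: "v \<in> carrier_vec n \<Longrightarrow> u \<in> carrier_vec n \<Longrightarrow> lin_form (v + u) = lin_form v + lin_form u"
  by (simp add: lin_form_def MConst.hom_add distrib_left sum.distrib)

lemma lin_form_diff: "v \<in> carrier_vec n \<Longrightarrow> u \<in> carrier_vec n \<Longrightarrow> lin_form (v - u) = lin_form v - lin_form u"
  by (simp add: lin_form_def comm_ring_hom_MConst MConst.hom_add[symmetric] right_diff_distrib
      sum_subtractf[symmetric] MConst_def single_diff)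

lemma lin_form_smult: "lin_form (c \<cdot>\<^sub>v v) = MConst c * lin_form v"
  by (simp add: lin_form_def MConst.hom_mult sum_distrib_left mult_ac)

lemma lin_form_unit: "i < n \<Longrightarrow> lin_form (unit_vec n i) = MVar i"
proof -
  assume "i < n"
  have "lin_form (unit_vec n i) = (\<Sum>j<n. if j = i then MVar j else 0 :: (nat, 'a) mpoly)"
    unfolding lin_form_def by (intro sum.cong) (auto simp: unit_vec_def)
  then show ?thesis using \<open>i < n\<close> by simp
qed

lemma lin_form_zero [simp]: "lin_form (0\<^sub>v n) = 0"
  by (simp add: lin_form_def)

lemma lin_form_mult_mat_vec:
  assumes "A \<in> carrier_mat k n" "v \<in> carrier_vec n"
  shows "lin_form (A *\<^sub>v v) = (\<Sum>j<n. MConst (v $ j) * row_form A j)"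
proof -
  have "lin_form (A *\<^sub>v v) = (\<Sum>i<k. MVar i * MConst (\<Sum>j<n. A $$ (i, j) * v $ j))"
    using assms by (auto simp: lin_form_def scalar_prod_def lessThan_atLeast0 intro!: sum.cong)
  also have "\<dots> = (\<Sum>i<k. \<Sum>j<n. MConst (v $ j) * (MVar i * MConst (A $$ (i, j))))"
    by (simp add: MConst.hom_sum MConst.hom_mult sum_distrib_left mult_ac)
  also have "\<dots> = (\<Sum>j<n. \<Sum>i<k. MConst (v $ j) * (MVar i * MConst (A $$ (i, j))))"
    by (rule sum.swap)
  finally show ?thesis using assms by (simp add: row_form_def sum_distrib_left)
qed

interpretation to_w: comm_ring_hom "to_w \<xi>"
  unfolding to_w_def by (rule comm_ring_hom_alg_eval)

lemma to_w_MConst [simp]: "to_w \<xi> (MConst c) = MConst c" by (simp add: to_w_def)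

lemma to_w_mpolys [intro]: "p \<in> mpolys V \<Longrightarrow> dim_row \<xi> = k \<Longrightarrow> to_w \<xi> p \<in> mpolys {..<k}"
  unfolding to_w_def row_form_eq by (auto intro!: mpolys_alg_eval lin_form_mpolys)

lemma to_w_tcomp: "to_w \<xi> (tcomp b p) = tcomp b (to_w \<xi> p)"
  unfolding to_w_def by (rule tcomp_alg_eval[symmetric]) (metis row_form_eq lin_form_tpart)

lemma to_w_lin_form:
  assumes "\<xi> \<in> carrier_mat k n" "v \<in> carrier_vec n"
  shows "to_w \<xi> (lin_form v) = lin_form (\<xi> *\<^sub>v v)"
proof -
  have "to_w \<xi> (lin_form v) = (\<Sum>j<n. row_form \<xi> j * MConst (v $ j))"
    using assms(2) unfolding lin_form_def to_w_def by (simp add: alg_eval.hom_sum alg_eval.hom_mult)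
  then show ?thesis using lin_form_mult_mat_vec[OF assms] by (simp add: mult.commute)
qed

lemma to_w_to_w:
  assumes "\<xi> \<in> carrier_mat k n" "\<eta> \<in> carrier_mat n l" "p \<in> mpolys {..<l}"
  shows "to_w \<xi> (to_w \<eta> p) = to_w (\<xi> * \<eta>) p"
proof -
  have "to_w \<xi> (to_w \<eta> p) = alg_eval (\<lambda>i. to_w \<xi> (row_form \<eta> i)) p"
    by (simp add: to_w_def alg_eval_alg_eval)
  also have "\<dots> = alg_eval (row_form (\<xi> * \<eta>)) p"
  proof (rule alg_eval_cong)
    fix \<alpha> i assume "\<alpha> \<in> keys p" "i \<in> keys \<alpha>"
    then have "i < l" using assms(3) by (auto simp: mpolys_def)
    then have "to_w \<xi> (row_form \<eta> i) = lin_form (\<xi> *\<^sub>v col \<eta> i)"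
      unfolding row_form_eq using assms by (intro to_w_lin_form) auto
    also have "\<xi> *\<^sub>v col \<eta> i = col (\<xi> * \<eta>) i"
      using assms \<open>i < l\<close> by (metis col_mult2)
    finally show "to_w \<xi> (row_form \<eta> i) = row_form (\<xi> * \<eta>) i" by (simp add: row_form_eq)
  qed
  finally show ?thesis by (simp add: to_w_def)
qed

text \<open>Substituting \<open>c w\<^sub>i\<close> for \<open>w\<^sub>i\<close> is multiplication by \<open>c\<^sup>b\<close> on total degree \<open>b\<close>. This is how a factorization
of \<open>c\<close> times the identity matrix acts on polynomials.\<close>

lemma to_w_scalar:
  assumes "p \<in> mpolys {..<n}" "p \<in> tpart b"
  shows "to_w (c \<cdot>\<^sub>m 1\<^sub>m n) p = MConst (c ^ b) * p"
proof -
  have "to_w (c \<cdot>\<^sub>m 1\<^sub>m n) p = alg_eval (\<lambda>i. MConst c * MVar i) p"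
    unfolding to_w_def
  proof (rule alg_eval_cong)
    fix \<alpha> i assume "\<alpha> \<in> keys p" "i \<in> keys \<alpha>"
    then have i: "i < n" using assms(1) by (auto simp: mpolys_def)
    then have "col (c \<cdot>\<^sub>m 1\<^sub>m n) i = c \<cdot>\<^sub>v unit_vec n i" by (auto simp: unit_vec_def)
    then show "row_form (c \<cdot>\<^sub>m 1\<^sub>m n) i = MConst c * MVar i"
      using i by (simp add: row_form_eq lin_form_smult lin_form_unit)
  qed
  also have "\<dots> = (\<Sum>\<alpha>\<in>keys p. MConst (c ^ b) * single \<alpha> (lookup p \<alpha>))"
    unfolding alg_eval_def
  proof (rule sum.cong[OF refl])
    fix \<alpha> assume "\<alpha> \<in> keys p"
    then have "(\<Sum>v\<in>keys \<alpha>. lookup \<alpha> v) = b" using assms(2) by (simp add: tpart_def mdeg_def)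
    then have "(\<Prod>v\<in>keys \<alpha>. (MConst c * MVar v) ^ lookup \<alpha> v) = MConst (c ^ b) * power_prod MVar \<alpha>"
      by (simp add: power_mult_distrib prod.distrib power_prod_def power_sum[symmetric] MConst.hom_power)
    then show "MConst (lookup p \<alpha>) * (\<Prod>v\<in>keys \<alpha>. (MConst c * MVar v) ^ lookup \<alpha> v) =
      MConst (c ^ b) * single \<alpha> (lookup p \<alpha>)"
      by (simp add: single_eq_MConst_power_prod mult_ac)
  qed
  also have "\<dots> = MConst (c ^ b) * p"
    by (simp only: sum_distrib_left[symmetric] sum_of_singles[symmetric])
  finally show ?thesis .
qed

subsection \<open>Congruence of substitutions\<close>

text \<open>An ideal of the polynomial ring in the variables \<open>V\<close>, as a closure property of a plain set.\<close>

definition is_ideal :: "'v set \<Rightarrow> ('v, 'a::comm_ring_1) mpoly set \<Rightarrow> bool" where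
  "is_ideal V J \<longleftrightarrow> 0 \<in> J \<and> (\<forall>p\<in>J. \<forall>q\<in>J. p + q \<in> J) \<and> (\<forall>a\<in>mpolys V. \<forall>p\<in>J. a * p \<in> J)"

lemma is_idealD:
  assumes "is_ideal V J"
  shows "0 \<in> J" "p \<in> J \<Longrightarrow> q \<in> J \<Longrightarrow> p + q \<in> J" "a \<in> mpolys V \<Longrightarrow> p \<in> J \<Longrightarrow> a * p \<in> J"
  using assms by (auto simp: is_ideal_def)

lemma is_ideal_diff:
  assumes "is_ideal V J" "p \<in> J" "q \<in> J" shows "p - q \<in> J"
  using is_idealD(2)[OF assms(1,2) is_idealD(3)[OF assms(1) _ assms(3), of "-1"]] by auto

lemma is_ideal_sum:
  assumes "is_ideal V J" "\<And>i. i \<in> A \<Longrightarrow> p i \<in> J" shows "sum p A \<in> J"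
  using assms(2) by (induction A rule: infinite_finite_induct) (auto intro: is_idealD[OF assms(1)])

lemma congruent_mult:
  assumes J: "is_ideal V J" and "p - p' \<in> J" "q - q' \<in> J" "p \<in> mpolys V" "q' \<in> mpolys V"
  shows "p * q - p' * q' \<in> J"
proof -
  have "p * q - p' * q' = p * (q - q') + q' * (p - p')" by (simp add: algebra_simps)
  then show ?thesis using assms by (auto intro: is_idealD[OF J])
qed

lemma congruent_power:
  assumes J: "is_ideal V J" and "p - p' \<in> J" "p \<in> mpolys V" "p' \<in> mpolys V"
  shows "p ^ k - p' ^ k \<in> J"
  by (induction k) (use assms in \<open>auto intro!: congruent_mult[OF J] is_idealD(1)[OF J]\<close>)

lemma congruent_prod:
  assumes J: "is_ideal V J"
    and "\<And>i. i \<in> A \<Longrightarrow> p i - p' i \<in> J" "\<And>i. i \<in> A \<Longrightarrow> p i \<in> mpolys V" "\<And>i. i \<in> A \<Longrightarrow> p' i \<in> mpolys V"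
  shows "prod p A - prod p' A \<in> J"
  using assms(2-)
  by (induction A rule: infinite_finite_induct)
     (auto intro!: congruent_mult[OF J] is_idealD(1)[OF J])

lemma alg_eval_congruent:
  assumes J: "is_ideal V J" and p: "p \<in> mpolys W"
    and hk: "\<And>v. v \<in> W \<Longrightarrow> h v - k v \<in> J" "\<And>v. v \<in> W \<Longrightarrow> h v \<in> mpolys V" "\<And>v. v \<in> W \<Longrightarrow> k v \<in> mpolys V"
  shows "alg_eval h p - alg_eval k p \<in> J"
  unfolding alg_eval_def sum_subtractf[symmetric] right_diff_distrib[symmetric]
proof (intro is_ideal_sum[OF J] is_idealD(3)[OF J] mpolys_MConst congruent_prod[OF J] congruent_power[OF J] mpolys_power)
  fix \<alpha> v assume "\<alpha> \<in> keys p" "v \<in> keys \<alpha>"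
  then have "v \<in> W" using p by (auto simp: mpolys_def)
  then show "h v - k v \<in> J" "h v \<in> mpolys V" "k v \<in> mpolys V"
    "h v \<in> mpolys V" "k v \<in> mpolys V" by (auto intro: hk)
qed

definition lin_ideal :: "'v set \<Rightarrow> (nat \<Rightarrow> ('v, 'a::comm_ring_1) mpoly) \<Rightarrow> nat \<Rightarrow> ('v, 'a) mpoly set" where
  "lin_ideal V g m = {\<Sum>j<m. h j * g j | h. \<forall>j. h j \<in> mpolys V}"

lemma is_ideal_lin_ideal: "is_ideal V (lin_ideal V g m)"
  unfolding is_ideal_def
proof (intro conjI ballI)
  show "0 \<in> lin_ideal V g m" unfolding lin_ideal_def by (auto intro!: exI[of _ "\<lambda>_. 0"])
  fix p q assume "p \<in> lin_ideal V g m" "q \<in> lin_ideal V g m"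
  then obtain h k where "p = (\<Sum>j<m. h j * g j)" "q = (\<Sum>j<m. k j * g j)" "\<forall>j. h j \<in> mpolys V" "\<forall>j. k j \<in> mpolys V"
    unfolding lin_ideal_def by blast
  then show "p + q \<in> lin_ideal V g m"
    unfolding lin_ideal_def by (auto intro!: exI[of _ "\<lambda>j. h j + k j"] simp: distrib_right sum.distrib)
next
  fix a p :: "('a, 'b) mpoly" assume "a \<in> mpolys V" "p \<in> lin_ideal V g m"
  then obtain h where "p = (\<Sum>j<m. h j * g j)" "\<forall>j. h j \<in> mpolys V" "a \<in> mpolys V"
    unfolding lin_ideal_def by blast
  then show "a * p \<in> lin_ideal V g m"
    unfolding lin_ideal_def by (auto intro!: exI[of _ "\<lambda>j. a * h j"] simp: sum_distrib_left mult_ac)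
qed

lemma lin_ideal_gen:
  assumes "j < m" shows "g j \<in> lin_ideal V g m"
proof -
  have "g j = (\<Sum>i<m. (if i = j then 1 else 0) * g i)"
    using assms by (subst sum.cong[OF refl, of _ _ "\<lambda>i. if i = j then g i else 0"]) auto
  then show ?thesis unfolding lin_ideal_def by (auto intro!: exI[of _ "\<lambda>i. if i = j then 1 else 0"])
qed

lemma lin_ideal_mono: "m \<le> m' \<Longrightarrow> p \<in> lin_ideal V g m \<Longrightarrow> p \<in> lin_ideal V g m'"
proof -
  assume "m \<le> m'" "p \<in> lin_ideal V g m"
  then obtain h where h: "p = (\<Sum>j<m. h j * g j)" "\<forall>j. h j \<in> mpolys V" unfolding lin_ideal_def by blast
  have "p = (\<Sum>j<m'. (if j < m then h j else 0) * g j)"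
    unfolding h(1) using \<open>m \<le> m'\<close> by (intro sum.mono_neutral_cong_left) auto
  then show ?thesis
    unfolding lin_ideal_def using h(2) by (auto intro!: exI[of _ "\<lambda>j. if j < m then h j else 0"])
qed

lemma to_w_congruent:
  assumes J: "is_ideal {..<k} J" and B: "B \<in> carrier_mat k n" and C: "C \<in> carrier_mat k n"
    and p: "p \<in> mpolys {..<n}"
    and BC: "\<And>i. i < n \<Longrightarrow> lin_form (col B i - col C i) \<in> J"
  shows "to_w B p - to_w C p \<in> J"
  unfolding to_w_def
proof (rule alg_eval_congruent[OF J p])
  fix i assume i: "i \<in> {..<n}"
  have "lin_form (col B i - col C i) = row_form B i - row_form C i"
    unfolding row_form_eq using B C i by (intro lin_form_diff[of _ k]) auto
  then show "row_form B i - row_form C i \<in> J" using BC[of i] i by simp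
qed (use B C in \<open>auto simp: row_form_eq intro!: lin_form_mpolys\<close>)

section \<open>The kernel ideal inside the Rees algebra\<close>

lemma mult_mat_smult_vec:
  assumes "A \<in> carrier_mat k n" "v \<in> carrier_vec n"
  shows "A *\<^sub>v (c \<cdot>\<^sub>v v) = (c :: 'a::comm_ring_1) \<cdot>\<^sub>v (A *\<^sub>v v)"
  using assms by (intro eq_vecI) (auto simp: scalar_prod_def sum_distrib_left mult_ac intro!: sum.cong)

lemma lookup_lin_form:
  assumes "l < dim_vec v" shows "lookup (lin_form v) (single l 1) = v $ l"
proof -
  have "lookup (lin_form v) (single l 1) = (\<Sum>i<dim_vec v. if i = l then v $ i else 0)"
    unfolding lin_form_def lookup_sum
  proof (rule sum.cong[OF refl])
    fix i
    have "MVar i * MConst (v $ i) = single (single i 1) (v $ i)" by (simp add: MVar_def MConst_def mult_single)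
    moreover have "single i (1::nat) = single l 1 \<longleftrightarrow> i = l"
      by (metis lookup_single_eq lookup_single_not_eq zero_neq_one)
    ultimately show "lookup (MVar i * MConst (v $ i)) (single l 1) = (if i = l then v $ i else 0)"
      by (simp add: lookup_single when_def)
  qed
  then show ?thesis using assms by simp
qed

lemma syzygy_rearrange:
  fixes x y :: "'a::comm_ring_1"
  assumes "y * p - x * q = x * u + y * v"
  shows "y * (p - v) = x * (q + u)"
  using assms by (simp add: algebra_simps)

text \<open>What the resolution and the bidual contribute to the argument, in terms of matrices: \<open>\<xi>\<close> is the map
from \<open>R\<^sup>n\<close> to the free bidual, \<open>\<phi>\<close> holds the columns \<open>0, \<dots>, m\<close>, the first \<open>m\<close> of them generate the kernel of
\<open>\<xi>\<close>, and \<open>\<eta> i\<close> and \<open>\<beta> i\<close> are one-sided inverses, up to \<open>x\<^sub>i\<^sup>N\<close>, of \<open>\<xi>\<close> and of the coefficient vector of \<open>g\<close>.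
In the names below, \<open>RE\<close> is the Rees algebra of the cokernel, as a subring of \<open>R[w]\<close>.\<close>

locale rees_extension =
  fixes n m s r N :: nat and \<sigma> d :: "nat \<Rightarrow> nat"
    and \<xi> \<phi> :: "'k::field plane_ring mat"
    and \<eta> :: "2 \<Rightarrow> 'k plane_ring mat" and \<beta> :: "2 \<Rightarrow> 'k plane_ring vec"
  assumes xi_carrier: "\<xi> \<in> carrier_mat s n"
    and phi_carrier: "\<phi> \<in> carrier_mat n (Suc m)"
    and eta_carrier: "\<eta> i \<in> carrier_mat n s"
    and xi_forms: "l < s \<Longrightarrow> j < n \<Longrightarrow> \<xi> $$ (l, j) \<in> forms (int (\<sigma> l))"
    and phi_forms: "k < n \<Longrightarrow> j \<le> m \<Longrightarrow> \<phi> $$ (k, j) \<in> forms (int (d j))"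
    and d_mono: "j < m \<Longrightarrow> d j \<le> d (m - 1)" "d (m - 1) \<le> d m"
    and xi_eta: "\<xi> * \<eta> i = MVar i ^ N \<cdot>\<^sub>m 1\<^sub>m s"
    and xi_phi: "j < m \<Longrightarrow> \<xi> *\<^sub>v col \<phi> j = 0\<^sub>v s"
    and ker_xi: "v \<in> carrier_vec n \<Longrightarrow> \<xi> *\<^sub>v v = 0\<^sub>v s \<Longrightarrow> lin_form v \<in> lin_ideal {..<n} (row_form \<phi>) m"
    and beta_phi: "\<beta> i \<bullet> (\<xi> *\<^sub>v col \<phi> m) = MVar i ^ N"
    and sigma_pos: "l < r \<Longrightarrow> 0 < \<sigma> l"
    and sigma_zero: "r \<le> l \<Longrightarrow> l < s \<Longrightarrow> \<sigma> l = 0"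
    and r_le: "r \<le> s"
begin

definition J :: "(nat, 'k plane_ring) mpoly set" where "J = lin_ideal {..<n} (row_form \<phi>) m"
definition RE :: "(nat, 'k plane_ring) mpoly set" where "RE = to_w \<xi> ` mpolys {..<n}"
definition g :: "(nat, 'k plane_ring) mpoly" where "g = to_w \<xi> (row_form \<phi> m)"
definition K :: "(nat, 'k plane_ring) mpoly set" where "K = {q \<in> RE. \<exists>h\<in>mpolys {..<s}. q = g * h}"

abbreviation X :: "2 \<Rightarrow> nat \<Rightarrow> (nat, 'k plane_ring) mpoly" where "X i k \<equiv> MConst (MVar i ^ k)"

lemma is_ideal_J: "is_ideal {..<n} J"
  unfolding J_def by (rule is_ideal_lin_ideal)

lemma X_nonzero [simp]: "X i k \<noteq> 0"
proof -
  have "MVar i ^ k \<noteq> (0 :: 'k plane_ring)"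
    unfolding MVar_power by (metis lookup_single_eq lookup_zero one_neq_zero)
  then show ?thesis by (metis MConst.hom_zero MConst_eq_iff)
qed

lemma X_add: "X i j * X i k = X i (j + k)"
  by (simp add: power_add MConst.hom_mult)

lemma row_form_phi_mpolys: "row_form \<phi> j \<in> mpolys {..<n}"
  unfolding row_form_eq using phi_carrier by (intro lin_form_mpolys carrier_vecI) simp

lemma row_form_phi_bigraded: "j \<le> m \<Longrightarrow> row_form \<phi> j \<in> bigraded_part (\<lambda>_. 0) (int (d j)) 1"
proof -
  assume j: "j \<le> m"
  have "MVar i * MConst (\<phi> $$ (i, j)) \<in> bigraded_part (\<lambda>_. 0) (0 + int (d j)) (1 + 0)" if "i < n" for i
    using that j phi_forms[of i j] by (intro bigraded_part_mult bigraded_part_MVar bigraded_part_MConst) auto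
  then show ?thesis unfolding row_form_def using phi_carrier by (auto intro!: bigraded_part_sum)
qed

lemma row_form_xi_bigraded: "j < n \<Longrightarrow> row_form \<xi> j \<in> bigraded_part \<sigma> 0 1"
proof -
  assume j: "j < n"
  have "MVar l * MConst (\<xi> $$ (l, j)) \<in> bigraded_part \<sigma> (- int (\<sigma> l) + int (\<sigma> l)) (1 + 0)" if "l < s" for l
    using that j xi_forms[of l j] by (intro bigraded_part_mult bigraded_part_MVar bigraded_part_MConst) auto
  then show ?thesis unfolding row_form_def using xi_carrier by (auto intro!: bigraded_part_sum)
qed

lemma to_w_xi_bigraded: "p \<in> mpolys {..<n} \<Longrightarrow> p \<in> bigraded_part (\<lambda>_. 0) a b \<Longrightarrow> to_w \<xi> p \<in> bigraded_part \<sigma> a b"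
  unfolding to_w_def
proof (rule bigraded_part_alg_eval)
  fix v assume "v \<in> {..<n}"
  then have "v < n" by simp
  then show "row_form \<xi> v \<in> bigraded_part \<sigma> 0 1" by (rule row_form_xi_bigraded)
qed

lemma bicomp_to_w_xi: "p \<in> mpolys {..<n} \<Longrightarrow> bicomp \<sigma> a b (to_w \<xi> p) = to_w \<xi> (bicomp (\<lambda>_. 0) a b p)"
  unfolding to_w_def
proof (rule bicomp_alg_eval)
  fix v assume "v \<in> {..<n}"
  then have "v < n" by simp
  then show "row_form \<xi> v \<in> bigraded_part \<sigma> 0 1" by (rule row_form_xi_bigraded)
qed

lemma to_w_xi_mpolys: "to_w \<xi> p \<in> mpolys {..<s}"
  using to_w_mpolys[of p UNIV \<xi> s] xi_carrier by auto

lemma RE_mpolys: "q \<in> RE \<Longrightarrow> q \<in> mpolys {..<s}"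
  by (auto simp: RE_def to_w_xi_mpolys)

lemma to_w_row_form_phi: "to_w \<xi> (row_form \<phi> j) = lin_form (\<xi> *\<^sub>v col \<phi> j)"
  unfolding row_form_eq using xi_carrier phi_carrier by (intro to_w_lin_form) auto

lemma to_w_J: "p \<in> J \<Longrightarrow> to_w \<xi> p = 0"
  unfolding J_def lin_ideal_def
  by (auto simp: to_w.hom_sum to_w.hom_mult to_w_row_form_phi xi_phi intro!: sum.neutral)

definition gv :: "'k plane_ring vec" where "gv = \<xi> *\<^sub>v col \<phi> m"

lemma gv_carrier: "gv \<in> carrier_vec s"
  unfolding gv_def using xi_carrier phi_carrier by (intro mult_mat_vec_carrier[of _ s n] carrier_vecI) simp_all

lemma beta_gv: "\<beta> i \<bullet> gv = MVar i ^ N"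
  unfolding gv_def by (rule beta_phi)

lemma g_eq: "g = lin_form gv"
  by (simp add: g_def gv_def to_w_row_form_phi)

lemma g_mpolys: "g \<in> mpolys {..<s}" by (simp add: g_def to_w_xi_mpolys)

lemma g_bigraded: "g \<in> bigraded_part \<sigma> (int (d m)) 1"
  unfolding g_def by (intro to_w_xi_bigraded row_form_phi_mpolys row_form_phi_bigraded) simp

lemma g_nonzero: "g \<noteq> 0"
proof
  let ?a = "gv"
  assume g0: "g = 0"
  note a = gv_carrier
  have lf: "lin_form ?a = 0" using g0 unfolding g_eq .
  have "?a $ l = 0" if "l < s" for l
    using lookup_lin_form[of l ?a] that carrier_vecD[OF a] unfolding lf by simp
  then have "\<beta> 0 \<bullet> ?a = 0" using a by (auto simp: scalar_prod_def)
  with beta_gv[of 0] show False by simp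
qed

text \<open>The columns of \<open>x\<^sub>i\<^sup>N - \<eta> \<xi>\<close> are in the kernel of \<open>\<xi>\<close>, so modulo \<open>J\<close> scaling the variables by \<open>x\<^sub>i\<^sup>N\<close> is
the same as substituting along \<open>\<eta> \<xi>\<close>, which factors through \<open>\<xi>\<close> and kills \<open>p\<close>.\<close>

lemma kernel_to_w_tpart:
  assumes p: "p \<in> mpolys {..<n}" "p \<in> tpart b" and zero: "to_w \<xi> p = 0"
  shows "X i (N * b) * p \<in> J"
proof -
  have carr: "MVar i ^ N \<cdot>\<^sub>m 1\<^sub>m n \<in> carrier_mat n n" "\<eta> i * \<xi> \<in> carrier_mat n n"
    using eta_carrier[of i] xi_carrier by auto
  have "to_w (MVar i ^ N \<cdot>\<^sub>m 1\<^sub>m n) p - to_w (\<eta> i * \<xi>) p \<in> J"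
  proof (rule to_w_congruent[OF is_ideal_J carr p(1)])
    fix j assume j: "j < n"
    let ?v = "col (MVar i ^ N \<cdot>\<^sub>m 1\<^sub>m n) j - col (\<eta> i * \<xi>) j"
    have c: "col (MVar i ^ N \<cdot>\<^sub>m 1\<^sub>m n) j = MVar i ^ N \<cdot>\<^sub>v unit_vec n j" using j by auto
    have "\<xi> *\<^sub>v (MVar i ^ N \<cdot>\<^sub>v unit_vec n j) = MVar i ^ N \<cdot>\<^sub>v col \<xi> j"
    proof -
      have "\<xi> *\<^sub>v unit_vec n j = col \<xi> j"
        using xi_carrier j by (intro eq_vecI) auto
      then show ?thesis using mult_mat_smult_vec[OF xi_carrier, of "unit_vec n j"] by simp
    qed
    moreover have "\<xi> *\<^sub>v col (\<eta> i * \<xi>) j = MVar i ^ N \<cdot>\<^sub>v col \<xi> j"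
    proof -
      have "\<xi> *\<^sub>v col (\<eta> i * \<xi>) j = col (\<xi> * (\<eta> i * \<xi>)) j"
        using carr xi_carrier j by (metis col_mult2)
      also have "\<xi> * (\<eta> i * \<xi>) = (\<xi> * \<eta> i) * \<xi>"
        using xi_carrier eta_carrier[of i] by (metis assoc_mult_mat)
      also have "\<dots> = MVar i ^ N \<cdot>\<^sub>m \<xi>" using xi_carrier by (auto simp: xi_eta)
      finally show ?thesis using xi_carrier j by simp
    qed
    moreover have "\<xi> *\<^sub>v ?v = \<xi> *\<^sub>v (MVar i ^ N \<cdot>\<^sub>v unit_vec n j) - \<xi> *\<^sub>v col (\<eta> i * \<xi>) j"
      unfolding c using carr eta_carrier[of i] by (intro mult_minus_distrib_mat_vec[OF xi_carrier] carrier_vecI) simp_all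
    ultimately have "\<xi> *\<^sub>v ?v = MVar i ^ N \<cdot>\<^sub>v col \<xi> j - MVar i ^ N \<cdot>\<^sub>v col \<xi> j"
      by (simp only:)
    also have "\<dots> = 0\<^sub>v s" using xi_carrier by (intro eq_vecI) simp_all
    finally have "\<xi> *\<^sub>v ?v = 0\<^sub>v s" .
    then show "lin_form ?v \<in> J"
      unfolding J_def using eta_carrier[of i] by (intro ker_xi carrier_vecI) simp_all
  qed
  moreover have "to_w (\<eta> i * \<xi>) p = 0"
    using to_w_to_w[OF eta_carrier[of i] xi_carrier p(1)] zero by simp
  moreover have "to_w (MVar i ^ N \<cdot>\<^sub>m 1\<^sub>m n) p = X i (N * b) * p"
    by (simp add: to_w_scalar[OF p] power_mult)
  ultimately show ?thesis by simp
qed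

text \<open>A polynomial that is not homogeneous has its components in the kernel; the largest power of \<open>x\<^sub>i\<close>
serves all of them.\<close>

lemma kernel_to_w:
  assumes p: "p \<in> mpolys {..<n}" and zero: "to_w \<xi> p = 0"
  obtains M where "X i M * p \<in> J"
proof -
  obtain D where D: "p = (\<Sum>b\<le>D. tcomp b p)" using sum_of_tcomps[of p] by blast
  have "X i (N * D) * tcomp b p \<in> J" if "b \<le> D" for b
  proof -
    have "X i (N * b) * tcomp b p \<in> J"
      by (rule kernel_to_w_tpart) (use p zero in \<open>auto simp: to_w_tcomp\<close>)
    then have "X i (N * (D - b)) * (X i (N * b) * tcomp b p) \<in> J"
      by (rule is_idealD(3)[OF is_ideal_J mpolys_MConst])
    also have "X i (N * (D - b)) * (X i (N * b) * tcomp b p) = X i (N * D) * tcomp b p"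
      using that by (simp only: mult.assoc[symmetric] X_add add_mult_distrib2[symmetric]) simp
    finally show ?thesis .
  qed
  then have "(\<Sum>b\<le>D. X i (N * D) * tcomp b p) \<in> J" by (intro is_ideal_sum[OF is_ideal_J]) auto
  then have "X i (N * D) * p \<in> J" using D by (metis sum_distrib_left)
  then show ?thesis by (rule that)
qed

lemma to_w_xi_eta:
  assumes "u \<in> mpolys {..<s}" "u \<in> tpart b"
  shows "to_w \<xi> (to_w (\<eta> i) u) = X i (N * b) * u"
  using to_w_to_w[OF xi_carrier eta_carrier assms(1), of i] to_w_scalar[OF assms, of "MVar i ^ N"]
  by (simp add: xi_eta power_mult)

lemma to_w_eta_mpolys: "to_w (\<eta> i) p \<in> mpolys {..<n}"
  using to_w_mpolys[of p UNIV "\<eta> i" n] eta_carrier[of i] by auto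

text \<open>Substituting along \<open>\<eta>\<close> gives preimages up to powers of \<open>x\<^sub>i\<close> that grow with the total degree; the
components are first brought to the same power.\<close>

lemma multiple_in_RE:
  assumes u: "u \<in> mpolys {..<s}"
  obtains M p where "p \<in> mpolys {..<n}" "to_w \<xi> p = X i M * u"
proof -
  obtain D where D: "u = (\<Sum>b\<le>D. tcomp b u)" using sum_of_tcomps[of u] by blast
  let ?p = "\<Sum>b\<le>D. X i (N * (D - b)) * to_w (\<eta> i) (tcomp b u)"
  have "to_w \<xi> ?p = (\<Sum>b\<le>D. X i (N * D) * tcomp b u)"
    unfolding to_w.hom_sum
  proof (rule sum.cong[OF refl])
    fix b assume b: "b \<in> {..D}"
    have "to_w \<xi> (X i (N * (D - b)) * to_w (\<eta> i) (tcomp b u)) = X i (N * (D - b)) * (X i (N * b) * tcomp b u)"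
      using u by (simp add: to_w.hom_mult to_w_xi_eta tcomp_mpolys)
    also have "\<dots> = X i (N * D) * tcomp b u"
      using b by (simp only: mult.assoc[symmetric] X_add add_mult_distrib2[symmetric]) simp
    finally show "to_w \<xi> (X i (N * (D - b)) * to_w (\<eta> i) (tcomp b u)) = X i (N * D) * tcomp b u" .
  qed
  also have "\<dots> = X i (N * D) * u" using D by (metis sum_distrib_left)
  finally show ?thesis by (rule that[rotated]) (auto intro!: to_w_eta_mpolys)
qed

text \<open>Up to \<open>x\<^sub>0\<^sup>M\<close> and up to \<open>x\<^sub>1\<^sup>M\<close> the element \<open>u\<close> has preimages \<open>P 0\<close> and \<open>P 1\<close> in \<open>S\<close>. The syzygy
\<open>x\<^sub>1\<^sup>M P 0 - x\<^sub>0\<^sup>M P 1\<close> is in the kernel, hence, after further multiplication, a combination of the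
relations \<open>g\<^sub>j\<close>. In these degrees its coefficients are in \<open>(x\<^sub>0\<^sup>2\<^sup>M, x\<^sub>1\<^sup>2\<^sup>M)\<close>, so the relations can be
absorbed into \<open>P 0\<close> and \<open>P 1\<close>. Then \<open>x\<^sub>0\<^sup>2\<^sup>M\<close> divides the corrected \<open>P 0\<close>, and the quotient maps to \<open>u\<close>.\<close>

lemma high_degree_in_RE:
  assumes u: "u \<in> mpolys {..<s}" "u \<in> bigraded_part \<sigma> a b" and a: "int (d (m - 1)) - 1 \<le> a"
  shows "u \<in> RE"
proof -
  define M where "M = N * b"
  define P where "P i = bicomp (\<lambda>_. 0) (a + int M) b (to_w (\<eta> i) u)" for i
  have P: "P i \<in> mpolys {..<n}" "P i \<in> tpart b" "P i \<in> bigraded_part (\<lambda>_. 0) (a + int M) b" for i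
    by (auto simp: P_def intro!: to_w_eta_mpolys bigraded_part_tpart)
  have toP: "to_w \<xi> (P i) = X i M * u" for i
  proof -
    have "X i M \<in> bigraded_part \<sigma> (int M) 0"
      using forms_power[OF forms_MVar[of i], of M] by (intro bigraded_part_MConst) simp
    from bigraded_part_mult[OF this u(2)] have h: "X i M * u \<in> bigraded_part \<sigma> (a + int M) b"
      by (simp add: add.commute)
    have "to_w \<xi> (P i) = bicomp \<sigma> (a + int M) b (to_w \<xi> (to_w (\<eta> i) u))"
      unfolding P_def by (simp add: bicomp_to_w_xi to_w_eta_mpolys)
    also have "\<dots> = bicomp \<sigma> (a + int M) b (X i M * u)"
      using to_w_xi_eta[OF u(1) bigraded_part_tpart[OF u(2)]] by (simp add: M_def)
    finally show ?thesis using h by (simp add: bicomp_homogeneous)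
  qed
  let ?z = "X 1 M * P 0 - X 0 M * P 1"
  have z: "?z \<in> mpolys {..<n}" "?z \<in> tpart b" by (auto intro!: P mpolys_diff mpolys_mult)
  have "to_w \<xi> ?z = 0" by (simp add: to_w.hom_minus to_w.hom_mult toP mult_ac)
  then have "X 0 M * ?z \<in> J" by (metis M_def kernel_to_w_tpart z)
  then have "X 1 M * (X 0 M * ?z) \<in> J" by (rule is_idealD(3)[OF is_ideal_J mpolys_MConst])
  then obtain h where h: "X 1 M * (X 0 M * ?z) = (\<Sum>j<m. h j * row_form \<phi> j)" "\<forall>j. h j \<in> mpolys {..<n}"
    unfolding J_def lin_ideal_def by blast
  \<comment> \<open>multiplied further, so that both variables occur with the same exponent \<open>2M\<close>\<close>
  have X2: "X i (2 * M) = X i M * X i M" for i by (simp add: X_add mult_2)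
  let ?Z = "X 1 (2 * M) * (X 0 M * P 0) - X 0 (2 * M) * (X 1 M * P 1)"
  have Zeq: "X 1 M * (X 0 M * ?z) = ?Z"
    unfolding X2 by (simp add: algebra_simps)
  have X: "X i k \<in> bigraded_part (\<lambda>_. 0) (int k) 0" for i k
    using forms_power[OF forms_MVar[of i], of k] by (intro bigraded_part_MConst) simp
  have Zdeg: "?Z \<in> bigraded_part (\<lambda>_. 0) (a + 4 * int M) b"
  proof -
    have 1: "X i (2 * M) * (X j M * P j) \<in> bigraded_part (\<lambda>_. 0) (a + 4 * int M) b" for i j
      using bigraded_part_mult[OF X[of i "2 * M"] bigraded_part_mult[OF X[of j M] P(3)[of j]]]
      by (simp add: algebra_simps)
    then show ?thesis by (intro bigraded_part_diff)
  qed
  \<comment> \<open>the coefficients may be taken bihomogeneous; in total degree 0 the sum is zero\<close>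
  define k where "k j = (if 1 \<le> b then bicomp (\<lambda>_. 0) (a + 4 * int M - int (d j)) (b - 1) (h j) else 0)" for j
  have k: "k j \<in> mpolys {..<n}" "k j \<in> bigraded_part (\<lambda>_. 0) (a + 4 * int M - int (d j)) (b - 1)" for j
    using h(2) by (auto simp: k_def)
  have hZ: "?Z = (\<Sum>j<m. row_form \<phi> j * h j)"
    using h(1) unfolding Zeq by (simp only: mult.commute)
  have "?Z = bicomp (\<lambda>_. 0) (a + 4 * int M) b ?Z"
    using bicomp_homogeneous[OF Zdeg, of "a + 4 * int M" b] by (simp only: simp_thms if_True)
  also have "\<dots> = bicomp (\<lambda>_. 0) (a + 4 * int M) b (\<Sum>j<m. row_form \<phi> j * h j)"
    by (simp only: hZ)
  also have "\<dots> = (\<Sum>j<m. k j * row_form \<phi> j)"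
    unfolding bicomp_sum
  proof (rule sum.cong[OF refl])
    fix j assume "j \<in> {..<m}"
    then have "row_form \<phi> j \<in> bigraded_part (\<lambda>_. 0) (int (d j)) 1" by (simp add: row_form_phi_bigraded del: One_nat_def)
    from bicomp_mult[OF this] show "bicomp (\<lambda>_. 0) (a + 4 * int M) b (row_form \<phi> j * h j) = k j * row_form \<phi> j"
      unfolding k_def by (cases "1 \<le> b") (simp_all only: if_True if_False mult_zero_left mult.commute)
  qed
  finally have Zk: "?Z = (\<Sum>j<m. k j * row_form \<phi> j)" .
  have "\<exists>q. k j = X 0 (2 * M) * fst q + X 1 (2 * M) * snd q \<and> fst q \<in> mpolys {..<n} \<and> snd q \<in> mpolys {..<n}" if "j < m" for j
  proof -
    have "2 * int (2 * M) \<le> (a + 4 * int M - int (d j)) + int (wt (\<lambda>_. 0) \<alpha>) + 1" for \<alpha> :: "nat \<Rightarrow>\<^sub>0 nat"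
      using a d_mono(1)[OF that] by simp
    from bigraded_split[OF k(2,1) this] obtain p0 p1 where "k j = X 0 (2 * M) * p0 + X 1 (2 * M) * p1"
      "p0 \<in> mpolys {..<n}" "p1 \<in> mpolys {..<n}" by blast
    then show ?thesis by (intro exI[of _ "(p0, p1)"]) (simp only: fst_conv snd_conv simp_thms)
  qed
  then obtain q where q: "\<And>j. j < m \<Longrightarrow> k j = X 0 (2 * M) * fst (q j) + X 1 (2 * M) * snd (q j)"
    "\<And>j. j < m \<Longrightarrow> fst (q j) \<in> mpolys {..<n}" "\<And>j. j < m \<Longrightarrow> snd (q j) \<in> mpolys {..<n}" by metis
  let ?A = "X 0 M * P 0 - (\<Sum>j<m. snd (q j) * row_form \<phi> j)"
  let ?B = "X 1 M * P 1 + (\<Sum>j<m. fst (q j) * row_form \<phi> j)"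
  have "?Z = X 0 (2 * M) * (\<Sum>j<m. fst (q j) * row_form \<phi> j) + X 1 (2 * M) * (\<Sum>j<m. snd (q j) * row_form \<phi> j)"
    unfolding Zk sum_distrib_left sum.distrib[symmetric]
    by (intro sum.cong refl) (auto simp: q(1) algebra_simps)
  then have "X 1 (2 * M) * ?A = X 0 (2 * M) * ?B" by (rule syzygy_rearrange)
  then obtain U where U: "?A = X 0 (2 * M) * U"
    by (rule MConst_variable_powers_coprime) auto
  have "?A \<in> mpolys {..<n}" by (auto intro!: P row_form_phi_mpolys q(2,3) mpolys_diff mpolys_sum mpolys_mult)
  then have Un: "U \<in> mpolys {..<n}" using mpolys_sub_cancel[of "X 0 (2 * M)" "{..<n}" U] U by simp
  have "(\<Sum>j<m. snd (q j) * row_form \<phi> j) = (\<Sum>j<m. (if j < m then snd (q j) else 0) * row_form \<phi> j)"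
    by (intro sum.cong) auto
  then have "(\<Sum>j<m. snd (q j) * row_form \<phi> j) \<in> J"
    unfolding J_def lin_ideal_def using q(3)
    by (auto intro!: exI[of _ "\<lambda>j. if j < m then snd (q j) else 0"])
  then have "to_w \<xi> ?A = X 0 (2 * M) * u"
    unfolding X2 by (simp add: to_w.hom_minus to_w.hom_mult to_w_J toP mult.assoc)
  then have "X 0 (2 * M) * u = X 0 (2 * M) * to_w \<xi> U" by (simp add: U to_w.hom_mult)
  then have "u = to_w \<xi> U" by (metis X_nonzero mult_left_cancel)
  then show ?thesis using Un unfolding RE_def by blast
qed

text \<open>With \<open>a\<close> the coefficient vector of \<open>g\<close>, the substitution \<open>w\<^sub>k \<mapsto> x\<^sub>i\<^sup>N w\<^sub>k - \<beta>\<^sub>k g\<close> sends \<open>g\<close> to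
\<open>x\<^sub>i\<^sup>N g - (\<beta> \<bullet> a) g = 0\<close>, and modulo \<open>g\<close> it is scaling by \<open>x\<^sub>i\<^sup>N\<close>. As it kills \<open>c q\<close> it kills \<open>q\<close>, so
\<open>x\<^sub>i\<^sup>M q\<close> is a multiple of \<open>g\<close> for some \<open>M\<close>. Doing this for both variables and cancelling the
powers shows that \<open>q\<close> itself is a multiple.\<close>

lemma g_torsion_free:
  assumes q: "q \<in> mpolys {..<s}" and c: "c \<noteq> 0" and eq: "MConst c * q = g * h'"
  obtains h where "h \<in> mpolys {..<s}" "q = g * h"
proof -
  let ?a = "gv"
  note a = gv_carrier
  let ?I = "lin_ideal {..<s} (\<lambda>_. g) 1"
  have I: "is_ideal {..<s} ?I" by (rule is_ideal_lin_ideal)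
  have power: "\<exists>M. X i M * q \<in> ?I" for i
  proof -
    \<comment> \<open>the matrix of the substitution that kills \<open>g\<close>\<close>
    define B where "B = mat s s (\<lambda>(l, k). (if l = k then MVar i ^ N else 0) - ?a $ l * \<beta> i $ k)"
    have B: "B \<in> carrier_mat s s" by (simp add: B_def)
    have "(B *\<^sub>v ?a) $ l = 0" if l: "l < s" for l
    proof -
      have "(B *\<^sub>v ?a) $ l = (\<Sum>k<s. ((if l = k then MVar i ^ N else 0) - ?a $ l * \<beta> i $ k) * ?a $ k)"
        using l a by (simp add: B_def scalar_prod_def lessThan_atLeast0)
      also have "\<dots> = (\<Sum>k<s. (if l = k then MVar i ^ N * ?a $ k else 0)) - (\<Sum>k<s. ?a $ l * (\<beta> i $ k * ?a $ k))"
        unfolding sum_subtractf[symmetric] by (intro sum.cong refl) (auto simp: algebra_simps)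
      also have "\<dots> = MVar i ^ N * ?a $ l - ?a $ l * (\<beta> i \<bullet> ?a)"
        using l a by (simp add: sum_distrib_left scalar_prod_def lessThan_atLeast0)
      finally show ?thesis by (simp add: beta_gv mult.commute)
    qed
    then have "B *\<^sub>v ?a = 0\<^sub>v s" using B by auto
    then have "to_w B g = 0" using to_w_lin_form[OF B a] by (simp add: g_eq)
    then have "MConst c * to_w B q = 0"
      using arg_cong[OF eq, of "to_w B"] by (simp add: to_w.hom_mult)
    then have Bq: "to_w B q = 0" using c by (metis MConst.hom_zero MConst_eq_iff mult_eq_0_iff)
    have cong: "to_w (MVar i ^ N \<cdot>\<^sub>m 1\<^sub>m s) p - to_w B p \<in> ?I" if p: "p \<in> mpolys {..<s}" for p
    proof (rule to_w_congruent[OF I _ B p])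
      fix k assume k: "k < s"
      have "col (MVar i ^ N \<cdot>\<^sub>m 1\<^sub>m s) k - col B k = \<beta> i $ k \<cdot>\<^sub>v ?a"
        using k a by (intro eq_vecI) (auto simp: B_def)
      then have "lin_form (col (MVar i ^ N \<cdot>\<^sub>m 1\<^sub>m s) k - col B k) = MConst (\<beta> i $ k) * g"
        by (simp add: lin_form_smult g_eq)
      then show "lin_form (col (MVar i ^ N \<cdot>\<^sub>m 1\<^sub>m s) k - col B k) \<in> ?I"
        using is_idealD(3)[OF I mpolys_MConst lin_ideal_gen[of 0 1 "\<lambda>_. g"]] by simp
    qed simp
    obtain D where D: "q = (\<Sum>b\<le>D. tcomp b q)" using sum_of_tcomps[of q] by blast
    have "X i (N * D) * tcomp b q \<in> ?I" if "b \<le> D" for b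
    proof -
      have "to_w B (tcomp b q) = 0" by (simp add: to_w_tcomp Bq)
      moreover have "to_w (MVar i ^ N \<cdot>\<^sub>m 1\<^sub>m s) (tcomp b q) = X i (N * b) * tcomp b q"
        using q by (subst to_w_scalar[of _ _ b]) (auto simp: power_mult)
      ultimately have "X i (N * b) * tcomp b q \<in> ?I"
        using cong[of "tcomp b q"] q by (auto simp: tcomp_mpolys)
      then have "X i (N * (D - b)) * (X i (N * b) * tcomp b q) \<in> ?I"
        by (rule is_idealD(3)[OF I mpolys_MConst])
      also have "X i (N * (D - b)) * (X i (N * b) * tcomp b q) = X i (N * D) * tcomp b q"
        using that by (simp only: mult.assoc[symmetric] X_add add_mult_distrib2[symmetric]) simp
      finally show ?thesis .
    qed
    then have "(\<Sum>b\<le>D. X i (N * D) * tcomp b q) \<in> ?I" by (intro is_ideal_sum[OF I]) auto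
    then have "X i (N * D) * q \<in> ?I" using D by (metis sum_distrib_left)
    then show ?thesis ..
  qed
  have multiple: "\<exists>M u. X i M * q = g * u" for i
    using power[of i] by (auto simp: lin_ideal_def mult.commute)
  obtain M0 u where u: "X 0 M0 * q = g * u" using multiple[of 0] by blast
  obtain M1 v where v: "X 1 M1 * q = g * v" using multiple[of 1] by blast
  have "g * (X 1 M1 * u) = X 1 M1 * (X 0 M0 * q)" unfolding u by (rule mult.left_commute)
  also have "\<dots> = X 0 M0 * (g * v)" unfolding v[symmetric] by (rule mult.left_commute)
  also have "\<dots> = g * (X 0 M0 * v)" by (rule mult.left_commute)
  finally have "X 1 M1 * u = X 0 M0 * v" using g_nonzero mult_left_cancel by blast
  then obtain h where h: "u = X 0 M0 * h" by (rule MConst_variable_powers_coprime) auto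
  have "X 0 M0 * q = X 0 M0 * (g * h)" using u h by (simp add: mult_ac)
  then have qgh: "q = g * h" using X_nonzero mult_left_cancel by blast
  moreover have "h \<in> mpolys {..<s}"
    using mpolys_sub_cancel[OF g_mpolys _ g_nonzero, of h] q qgh by simp
  ultimately show ?thesis using that by blast
qed

text \<open>The left side is the image of the kernel of \<open>S \<longrightarrow> Rees(E')\<close>, where \<open>E'\<close> is the cokernel of all
\<open>m + 1\<close> columns. Modulo the first \<open>m\<close> columns, torsion elements are those with a nonzero multiple in
\<open>g R[w]\<close>, and \<open>g R[w]\<close> is already saturated.\<close>

lemma K_eq_image:
  "to_w \<xi> ` {p \<in> mpolys {..<n}. \<exists>c. c \<noteq> 0 \<and> MConst c * p \<in> lin_ideal {..<n} (row_form \<phi>) (Suc m)} = K"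
proof (intro equalityI subsetI)
  fix q assume "q \<in> to_w \<xi> ` {p \<in> mpolys {..<n}. \<exists>c. c \<noteq> 0 \<and> MConst c * p \<in> lin_ideal {..<n} (row_form \<phi>) (Suc m)}"
  then obtain p c h where p: "q = to_w \<xi> p" "p \<in> mpolys {..<n}" "c \<noteq> 0" "\<forall>j. h j \<in> mpolys {..<n}"
    "MConst c * p = (\<Sum>j<Suc m. h j * row_form \<phi> j)"
    unfolding lin_ideal_def by blast
  have J: "(\<Sum>j<m. h j * row_form \<phi> j) \<in> J" using p(4) unfolding J_def lin_ideal_def by blast
  have "MConst c * q = to_w \<xi> (MConst c * p)" by (simp add: p(1) to_w.hom_mult)
  also have "\<dots> = g * to_w \<xi> (h m)"
    unfolding p(5) using to_w_J[OF J] by (simp add: to_w.hom_add to_w.hom_mult g_def mult.commute)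
  finally have eq: "MConst c * q = g * to_w \<xi> (h m)" .
  have "q \<in> mpolys {..<s}" using p(1) to_w_xi_mpolys by simp
  from g_torsion_free[OF this p(3) eq] obtain h where "h \<in> mpolys {..<s}" "q = g * h" .
  then show "q \<in> K" unfolding K_def RE_def using p(1,2) by blast
next
  fix q assume "q \<in> K"
  then obtain p h where p: "q = to_w \<xi> p" "p \<in> mpolys {..<n}" "h \<in> mpolys {..<s}" "q = g * h"
    unfolding K_def RE_def by blast
  obtain M t where t: "t \<in> mpolys {..<n}" "to_w \<xi> t = X 0 M * h" using multiple_in_RE[OF p(3)] .
  let ?z = "X 0 M * p - row_form \<phi> m * t"
  have "to_w \<xi> ?z = X 0 M * q - g * (X 0 M * h)"
    by (simp add: to_w.hom_minus to_w.hom_mult t p(1) g_def)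
  then have "to_w \<xi> ?z = 0" by (simp add: p(4) mult_ac)
  moreover have "?z \<in> mpolys {..<n}" using p t by (auto intro!: row_form_phi_mpolys)
  ultimately obtain L where L: "X 0 L * ?z \<in> J" by (metis kernel_to_w)
  let ?I = "lin_ideal {..<n} (row_form \<phi>) (Suc m)"
  have I: "is_ideal {..<n} ?I" by (rule is_ideal_lin_ideal)
  have "X 0 L * ?z \<in> ?I" using L lin_ideal_mono[of m "Suc m"] unfolding J_def by auto
  moreover have "(X 0 L * t) * row_form \<phi> m \<in> ?I"
    using t by (intro is_idealD(3)[OF I] lin_ideal_gen) auto
  ultimately have "X 0 L * ?z + (X 0 L * t) * row_form \<phi> m \<in> ?I" by (rule is_idealD(2)[OF I])
  also have "X 0 L * ?z + (X 0 L * t) * row_form \<phi> m = X 0 (L + M) * p"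
    by (simp add: algebra_simps X_add[symmetric])
  finally have "MConst (MVar 0 ^ (L + M)) * p \<in> ?I" .
  moreover have "MVar 0 ^ (L + M) \<noteq> (0 :: 'k plane_ring)" using X_nonzero[of 0 "L + M"] by auto
  ultimately show "q \<in> to_w \<xi> ` {p \<in> mpolys {..<n}. \<exists>c. c \<noteq> 0 \<and> MConst c * p \<in> ?I}"
    using p by blast
qed

end

section \<open>Minimal generators\<close>

lemma mpolys_induct:
  assumes p: "p \<in> mpolys V"
    and const: "\<And>c. MConst c \<in> Q" and var: "\<And>v. v \<in> V \<Longrightarrow> MVar v \<in> Q"
    and add: "\<And>p q. p \<in> Q \<Longrightarrow> q \<in> Q \<Longrightarrow> p + q \<in> Q"
    and mult: "\<And>p q. p \<in> Q \<Longrightarrow> q \<in> Q \<Longrightarrow> p * q \<in> Q"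
  shows "p \<in> Q"
proof -
  have zero: "0 \<in> Q" using const[of 0] by simp
  have one: "1 \<in> Q" using const[of 1] by simp
  have power: "q ^ k \<in> Q" if "q \<in> Q" for q k by (induction k) (auto simp: one mult that)
  have prod: "(\<Prod>v\<in>A. MVar v ^ e v) \<in> Q" if "A \<subseteq> V" for A and e :: "_ \<Rightarrow> nat"
    using that by (induction A rule: infinite_finite_induct) (auto intro!: one mult power var)
  have sum: "sum f A \<in> Q" if "\<And>\<alpha>. \<alpha> \<in> A \<Longrightarrow> f \<alpha> \<in> Q" for A and f :: "('a \<Rightarrow>\<^sub>0 nat) \<Rightarrow> _"
    using that by (induction A rule: infinite_finite_induct) (auto intro!: zero add)
  have "(\<Sum>\<alpha>\<in>keys p. single \<alpha> (lookup p \<alpha>)) \<in> Q"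
    unfolding single_eq_MConst_power_prod power_prod_def
    using p by (intro sum mult const prod) (auto simp: mpolys_def)
  then show ?thesis using sum_of_singles[of p] by simp
qed

text \<open>A basis of \<open>U\<close>, together with \<open>A\<close>, is independent and extends to a basis of the span with \<open>H\<close>. The new
elements and \<open>A\<close> are a basis modulo \<open>U\<close>.\<close>

lemma (in vector_space) independent_modulo_extend:
  assumes U: "subspace U"
    and ind: "\<And>t u. finite t \<Longrightarrow> t \<subseteq> A \<Longrightarrow> (\<Sum>a\<in>t. scale (u a) a) \<in> U \<Longrightarrow> \<forall>a\<in>t. u a = 0"
  obtains G where "A \<subseteq> G" "G \<subseteq> A \<union> H" "A \<union> H \<subseteq> span (U \<union> G)"
    "\<And>x. x \<in> G \<Longrightarrow> x \<notin> span (U \<union> (G - {x}))"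
proof -
  obtain B0 where B0: "B0 \<subseteq> U" "independent B0" "U \<subseteq> span B0"
    using maximal_independent_subset[of U] by blast
  have span_B0: "span B0 = U" using B0 U by (metis span_eq_iff span_mono subset_antisym)
  have disj: "a \<notin> B0" if "a \<in> A" for a
  proof
    assume "a \<in> B0"
    then have "(\<Sum>x\<in>{a}. scale 1 x) \<in> U" using B0(1) by auto
    from ind[OF _ _ this] that show False by auto
  qed
  have "independent (B0 \<union> A)"
    unfolding independent_explicit_finite_subsets
  proof (intro allI impI ballI)
    fix t u v assume t: "t \<subseteq> B0 \<union> A" "finite t" "(\<Sum>v\<in>t. scale (u v) v) = 0" and v: "v \<in> t"
    have split: "(\<Sum>v\<in>t. scale (u v) v) = (\<Sum>v\<in>t \<inter> A. scale (u v) v) + (\<Sum>v\<in>t - A. scale (u v) v)"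
      using t(2) by (metis sum.Int_Diff)
    have B: "t - A \<subseteq> B0" using t(1) by auto
    have "(\<Sum>v\<in>t - A. scale (u v) v) \<in> U"
      using B B0(1) by (intro subspace_sum[OF U] subspace_scale[OF U]) auto
    moreover have "(\<Sum>v\<in>t \<inter> A. scale (u v) v) = - (\<Sum>v\<in>t - A. scale (u v) v)"
      using split t(3) by (simp add: eq_neg_iff_add_eq_0)
    ultimately have "(\<Sum>v\<in>t \<inter> A. scale (u v) v) \<in> U" using subspace_neg[OF U] by simp
    then have A: "\<forall>a\<in>t \<inter> A. u a = 0" using ind[of "t \<inter> A" u] t(2) by auto
    then have "(\<Sum>v\<in>t - A. scale (u v) v) = 0" using split t(3) by simp
    then have "\<forall>v\<in>t - A. u v = 0"
      using B0(2) B t(2) unfolding independent_explicit_finite_subsets by (metis finite_Diff)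
    with A v show "u v = 0" by auto
  qed
  then obtain B where B: "B0 \<union> A \<subseteq> B" "B \<subseteq> B0 \<union> A \<union> H" "independent B" "B0 \<union> A \<union> H \<subseteq> span B"
    using maximal_independent_subset_extend[of "B0 \<union> A" "B0 \<union> A \<union> H"] by blast
  show ?thesis
  proof (rule that[of "B - B0"])
    show "A \<subseteq> B - B0" using B(1) disj by auto
    show "B - B0 \<subseteq> A \<union> H" using B(2) by auto
    have "span B \<subseteq> span (U \<union> (B - B0))" using B0(1) by (intro span_mono) auto
    then show "A \<union> H \<subseteq> span (U \<union> (B - B0))" using B(4) by auto
    fix x assume x: "x \<in> B - B0"
    have "span (U \<union> (B - B0 - {x})) \<subseteq> span (B - {x})"
    proof (rule span_minimal[OF _ subspace_span])
      have "U \<subseteq> span (B - {x})" using span_B0 B(1) x span_mono[of B0 "B - {x}"] by auto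
      then show "U \<union> (B - B0 - {x}) \<subseteq> span (B - {x})" using span_superset[of "B - {x}"] by auto
    qed
    then show "x \<notin> span (U \<union> (B - B0 - {x}))" using B(3) x unfolding dependent_def by auto
  qed
qed

definition kscale :: "'k::field \<Rightarrow> (nat, 'k plane_ring) mpoly \<Rightarrow> (nat, 'k plane_ring) mpoly" where
  "kscale c p = MConst (MConst c) * p"

interpretation vs: vector_space kscale
  by unfold_locales (simp_all add: kscale_def algebra_simps MConst.hom_add MConst.hom_mult)

lemma bicomp_kscale: "bicomp \<sigma> a b (kscale c p) = kscale c (bicomp \<sigma> a b p)"
proof -
  have "MConst (MConst c) \<in> bigraded_part \<sigma> 0 0" by auto
  from bicomp_mult[OF this] show ?thesis by (simp add: kscale_def)
qed

text \<open>The constant coefficient is the value at the origin.\<close>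

lemma comm_ring_hom_constant_coeff: "comm_ring_hom (\<lambda>c :: ('v, 'a::comm_ring_1) mpoly. lookup c 0)"
proof -
  have "comm_ring_hom (\<lambda>x :: 'a. x)" by unfold_locales auto
  then have hom: "comm_ring_hom (subst (\<lambda>x. x) (\<lambda>_. 0) :: ('v, 'a) mpoly \<Rightarrow> 'a)" by (rule comm_ring_hom_subst)
  have "subst (\<lambda>x. x) (\<lambda>_. 0) c = lookup c 0" for c :: "('v, 'a) mpoly"
  proof -
    have "power_prod (\<lambda>_. 0 :: 'a) \<alpha> = (if \<alpha> = 0 then 1 else 0)" for \<alpha> :: "'v \<Rightarrow>\<^sub>0 nat"
    proof (cases "\<alpha> = 0")
      case False
      then obtain v where "v \<in> keys \<alpha>" by (metis keys_eq_empty ex_in_conv)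
      then have "(\<Prod>v\<in>keys \<alpha>. 0 ^ lookup \<alpha> v) = (0 :: 'a)"
        by (intro prod_zero bexI[of _ v]) (auto simp: in_keys_iff zero_power)
      then show ?thesis using False by (simp only: power_prod_def if_False)
    qed simp
    then have "subst (\<lambda>x. x) (\<lambda>_. 0) c = (\<Sum>\<alpha>\<in>keys c. if \<alpha> = 0 then lookup c \<alpha> else 0)"
      unfolding subst_def by (intro sum.cong) auto
    then show ?thesis by (simp add: in_keys_iff)
  qed
  then have "subst (\<lambda>x. x) (\<lambda>_. 0) = (\<lambda>c :: ('v, 'a) mpoly. lookup c 0)" by (rule ext)
  with hom show ?thesis by simp
qed

context rees_extension
begin

abbreviation T :: "nat \<Rightarrow> (nat, 'k plane_ring) mpoly" where "T \<equiv> row_form \<xi>"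
abbreviation Y :: "2 \<Rightarrow> (nat, 'k plane_ring) mpoly" where "Y i \<equiv> MConst (MVar i)"

text \<open>The product of \<open>K\<close> with the ideal of \<open>RE\<close> that is generated by the variables \<open>x\<^sub>i\<close> and \<open>T\<^sub>j\<close>. The span over
the field is enough, because \<open>K\<close> is closed under multiplication by \<open>RE\<close>.\<close>

definition nK :: "(nat, 'k plane_ring) mpoly set" where
  "nK = vs.span ({Y i * p | i p. p \<in> K} \<union> {T j * p | j p. j < n \<and> p \<in> K})"

text \<open>The elements of the theorem, with exponents collected in one finitely supported function.\<close>

definition A0 :: "(nat, 'k plane_ring) mpoly set" where
  "A0 = {g * single \<beta> 1 | \<beta>. keys \<beta> \<subseteq> {..<r} \<and> wt \<sigma> \<beta> \<le> d m - d (m - 1)}"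

definition H :: "(nat, 'k plane_ring) mpoly set" where
  "H = {p \<in> K. \<exists>a b. p \<in> bigraded_part \<sigma> a b \<and> a < int (d (m - 1))}"

lemma RE_add: "p \<in> RE \<Longrightarrow> q \<in> RE \<Longrightarrow> p + q \<in> RE"
  unfolding RE_def by (auto simp: to_w.hom_add[symmetric])

lemma RE_mult: "p \<in> RE \<Longrightarrow> q \<in> RE \<Longrightarrow> p * q \<in> RE"
  unfolding RE_def by (auto simp: to_w.hom_mult[symmetric])

lemma RE_MConst [simp]: "MConst c \<in> RE"
  unfolding RE_def by (intro image_eqI[of _ _ "MConst c"]) auto

lemma RE_zero [simp]: "0 \<in> RE" using RE_MConst[of 0] by simp

lemma RE_T: "j < n \<Longrightarrow> T j \<in> RE"
  unfolding RE_def by (intro image_eqI[of _ _ "MVar j"]) (auto simp: to_w_def)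

lemma RE_bicomp: "q \<in> RE \<Longrightarrow> bicomp \<sigma> a b q \<in> RE"
  unfolding RE_def by (auto simp: bicomp_to_w_xi)

lemma RE_negative:
  assumes "q \<in> RE" "q \<in> bigraded_part \<sigma> a b" "a < 0" shows "q = 0"
proof -
  obtain p where p: "q = to_w \<xi> p" "p \<in> mpolys {..<n}" using assms(1) by (auto simp: RE_def)
  have "bicomp (\<lambda>_. 0) a b p = 0"
  proof (rule poly_mapping_eqI)
    fix \<alpha>
    have "lookup (bicomp (\<lambda>_. 0) a b p) \<alpha> \<in> forms (a + int (wt (\<lambda>_. 0) \<alpha>))"
      by (rule bigraded_part_lookup[OF bicomp_in])
    then show "lookup (bicomp (\<lambda>_. 0) a b p) \<alpha> = lookup 0 \<alpha>"
      using assms(3) by (simp add: forms_neg)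
  qed
  then have "bicomp \<sigma> a b q = 0" using p by (simp add: bicomp_to_w_xi)
  then show ?thesis using bicomp_homogeneous[OF assms(2)] by simp
qed

lemma K_subset_RE: "K \<subseteq> RE" by (auto simp: K_def)

lemma K_zero [simp]: "0 \<in> K" by (auto simp: K_def intro: bexI[of _ 0])

lemma K_add: "p \<in> K \<Longrightarrow> q \<in> K \<Longrightarrow> p + q \<in> K"
  unfolding K_def by (auto intro!: RE_add) (metis distrib_left mpolys_add)

lemma K_mult: "p \<in> RE \<Longrightarrow> q \<in> K \<Longrightarrow> p * q \<in> K"
  unfolding K_def by (auto intro!: RE_mult) (metis RE_mpolys mult.left_commute mpolys_mult)

lemma K_kscale: "p \<in> K \<Longrightarrow> kscale c p \<in> K" by (simp add: kscale_def K_mult)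

lemma K_bicomp: assumes "p \<in> K" shows "bicomp \<sigma> a b p \<in> K"
proof -
  obtain h where h: "h \<in> mpolys {..<s}" "p = g * h" "p \<in> RE" using assms by (auto simp: K_def)
  have "bicomp \<sigma> a b p = g * (if 1 \<le> b then bicomp \<sigma> (a - int (d m)) (b - 1) h else 0)"
    unfolding h(2) by (simp add: bicomp_mult[OF g_bigraded])
  moreover have "(if 1 \<le> b then bicomp \<sigma> (a - int (d m)) (b - 1) h else 0) \<in> mpolys {..<s}"
    using h(1) by auto
  ultimately show ?thesis unfolding K_def using RE_bicomp[OF h(3)] by blast
qed

lemma subspace_K: "vs.subspace K"
  unfolding vs.subspace_def by (auto simp: K_add K_kscale)

lemma subspace_nK: "vs.subspace nK" by (simp add: nK_def)

lemma nK_Y: "p \<in> K \<Longrightarrow> Y i * p \<in> nK"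
  unfolding nK_def by (rule vs.span_base) blast

lemma nK_T: "j < n \<Longrightarrow> p \<in> K \<Longrightarrow> T j * p \<in> nK"
  unfolding nK_def by (rule vs.span_base) blast

lemma nK_subset_K: "nK \<subseteq> K"
  unfolding nK_def by (rule vs.span_minimal[OF _ subspace_K]) (auto intro!: K_mult RE_T)

lemma nK_mult: "q \<in> RE \<Longrightarrow> p \<in> nK \<Longrightarrow> q * p \<in> nK"
proof -
  assume q: "q \<in> RE" and p: "p \<in> nK"
  have "nK \<subseteq> {p. q * p \<in> nK}"
    unfolding nK_def[of] 
  proof (rule vs.span_minimal)
    show "{Y i * p | i p. p \<in> K} \<union> {T j * p | j p. j < n \<and> p \<in> K} \<subseteq> {p. q * p \<in> vs.span ({Y i * p | i p. p \<in> K} \<union> {T j * p | j p. j < n \<and> p \<in> K})}"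
      using nK_Y nK_T K_mult[OF q] unfolding nK_def[symmetric] by (auto simp: mult.left_commute[of q])
    show "vs.subspace {p. q * p \<in> vs.span ({Y i * p | i p. p \<in> K} \<union> {T j * p | j p. j < n \<and> p \<in> K})}"
      unfolding vs.subspace_def nK_def[symmetric]
      using vs.subspace_0[OF subspace_nK] vs.subspace_add[OF subspace_nK] vs.subspace_scale[OF subspace_nK]
      by (auto simp: distrib_left kscale_def mult.left_commute[of q])
  qed
  with p show ?thesis by auto
qed

text \<open>The algebra \<open>RE\<close> is generated over the field by the \<open>x\<^sub>i\<close> and \<open>T\<^sub>j\<close>, so its elements act on \<open>K\<close> modulo
\<open>nK\<close> through their constant terms.\<close>

lemma RE_mult_modulo_nK:
  assumes "q \<in> RE" "p \<in> K" shows "\<exists>c. q * p - kscale c p \<in> nK"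
proof -
  define Q where "Q = {q \<in> RE. \<exists>c. \<forall>p\<in>K. q * p - kscale c p \<in> nK}"
  have add: "q + q' \<in> Q" if qq: "q \<in> Q" "q' \<in> Q" for q q'
  proof -
    obtain c c' where c: "\<And>p. p \<in> K \<Longrightarrow> q * p - kscale c p \<in> nK" "\<And>p. p \<in> K \<Longrightarrow> q' * p - kscale c' p \<in> nK"
      using qq by (auto simp: Q_def)
    have "(q + q') * p - kscale (c + c') p \<in> nK" if "p \<in> K" for p
      using vs.subspace_add[OF subspace_nK c(1)[OF that] c(2)[OF that]]
      by (simp add: algebra_simps vs.scale_left_distrib)
    then show ?thesis using qq RE_add by (auto simp: Q_def)
  qed
  have mult: "q * q' \<in> Q" if qq: "q \<in> Q" "q' \<in> Q" for q q'
  proof -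
    obtain c c' where c: "\<And>p. p \<in> K \<Longrightarrow> q * p - kscale c p \<in> nK" "\<And>p. p \<in> K \<Longrightarrow> q' * p - kscale c' p \<in> nK"
      using qq by (auto simp: Q_def)
    have q: "q \<in> RE" using qq by (simp add: Q_def)
    have "(q * q') * p - kscale (c * c') p \<in> nK" if "p \<in> K" for p
      using vs.subspace_add[OF subspace_nK nK_mult[OF q c(2)[OF that]] vs.subspace_scale[OF subspace_nK c(1)[OF that], of c']]
      by (simp add: algebra_simps kscale_def MConst.hom_mult)
    then show ?thesis using qq RE_mult by (auto simp: Q_def)
  qed
  have const: "MConst (MConst c) \<in> Q" for c
    unfolding Q_def using vs.subspace_0[OF subspace_nK] by (auto intro!: exI[of _ c] simp: kscale_def)
  have Y: "Y i \<in> Q" for i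
    unfolding Q_def by (auto intro!: exI[of _ 0] nK_Y)
  have T: "T j \<in> Q" if "j < n" for j
    unfolding Q_def using that by (auto intro!: exI[of _ 0] nK_T RE_T)
  have const': "MConst c \<in> Q" for c
  proof -
    have "c \<in> {c. MConst c \<in> Q}"
      by (rule mpolys_induct[of c UNIV]) (auto simp: const Y MConst.hom_add MConst.hom_mult add mult)
    then show ?thesis by simp
  qed
  obtain P where P: "q = to_w \<xi> P" "P \<in> mpolys {..<n}" using assms(1) by (auto simp: RE_def)
  have "P \<in> {P. to_w \<xi> P \<in> Q}"
  proof (rule mpolys_induct[OF P(2)])
    fix v assume "v \<in> {..<n}"
    then show "MVar v \<in> {P. to_w \<xi> P \<in> Q}" using T by (simp add: to_w_def)
  qed (auto simp: const' to_w.hom_add to_w.hom_mult add mult)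
  then show ?thesis using P(1) assms(2) by (auto simp: Q_def)
qed

end

lemma form_split_one:
  assumes "c \<in> forms D" "0 < D"
  obtains c0 c1 where "c = MVar 0 * c0 + MVar 1 * c1" "c0 \<in> forms (D - 1)" "c1 \<in> forms (D - 1)"
  using form_split[OF assms(1), of 1] assms(2) by auto

lemma single_mpolys: "keys \<mu> \<subseteq> V \<Longrightarrow> single \<mu> c \<in> mpolys V"
  by (auto simp: mpolys_def split: if_splits)

lemma single_eq_MConst_mult: "single \<mu> c = MConst c * single \<mu> 1"
  by (simp add: MConst_def mult_single)

lemma single_MConst_mult: "single \<mu> (a * c) = MConst a * single \<mu> c"
  by (simp add: MConst_def mult_single)

context rees_extension
begin

lemma mult_g_in_K:
  assumes h: "h \<in> mpolys {..<s}" "h \<in> bigraded_part \<sigma> a b" and a: "int (d (m - 1)) - 1 \<le> int (d m) + a"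
  shows "g * h \<in> K"
proof -
  have "g * h \<in> bigraded_part \<sigma> (int (d m) + a) (1 + b)"
    by (rule bigraded_part_mult[OF g_bigraded h(2)])
  moreover have "g * h \<in> mpolys {..<s}" using g_mpolys h by auto
  ultimately have "g * h \<in> RE" using a by (intro high_degree_in_RE)
  then show ?thesis using h(1) by (auto simp: K_def)
qed

text \<open>A coefficient of positive degree is \<open>x\<^sub>0 c\<^sub>0 + x\<^sub>1 c\<^sub>1\<close>, and lowering the \<open>x\<close>-degree by one keeps the
element in the range where \<open>RE\<close> is everything.\<close>

lemma single_in_nK:
  assumes c: "c \<in> forms D" "0 < D" and \<mu>: "keys \<mu> \<subseteq> {..<s}"
    and a: "int (d (m - 1)) \<le> int (d m) + D - int (wt \<sigma> \<mu>)"
  shows "g * single \<mu> c \<in> nK"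
proof -
  obtain c0 c1 where c01: "c = MVar 0 * c0 + MVar 1 * c1" "c0 \<in> forms (D - 1)" "c1 \<in> forms (D - 1)"
    using form_split_one[OF c] .
  have K: "g * single \<mu> c' \<in> K" if "c' \<in> forms (D - 1)" for c'
  proof (rule mult_g_in_K)
    show "single \<mu> c' \<in> bigraded_part \<sigma> (D - 1 - int (wt \<sigma> \<mu>)) (mdeg \<mu>)"
      using that by (intro bigraded_part_single) auto
  qed (use a \<mu> in \<open>auto intro: single_mpolys\<close>)
  have "g * single \<mu> c = Y 0 * (g * single \<mu> c0) + Y 1 * (g * single \<mu> c1)"
    unfolding c01(1) single_add single_MConst_mult by (simp add: algebra_simps)
  also have "\<dots> \<in> nK"
    by (intro vs.subspace_add[OF subspace_nK] nK_Y K c01)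
  finally show ?thesis .
qed

text \<open>The row of \<open>\<xi>\<close> for a variable of degree zero has constant entries. Comparing the coefficients of
\<open>x\<^sub>0\<^sup>N\<close> in \<open>\<xi> \<eta> = x\<^sub>0\<^sup>N\<close> gives constants \<open>k j\<close> for which \<open>\<Sum> k\<^sub>j T\<^sub>j\<close> involves, among the variables of degree
zero, only \<open>w\<^sub>l\<close>.\<close>

lemma degree_zero_variable:
  assumes l: "r \<le> l" "l < s"
  obtains k c where "MVar l = (\<Sum>j<n. kscale (k j) (T j)) - (\<Sum>i<r. MConst (c i) * MVar i)"
    "\<forall>i<r. c i \<in> forms (int (\<sigma> i))"
proof -
  define k where "k j = lookup (\<eta> 0 $$ (j, l)) (single 0 N)" for j
  define c where "c i = (\<Sum>j<n. \<xi> $$ (i, j) * MConst (k j))" for i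
  have c_forms: "c i \<in> forms (int (\<sigma> i))" if "i < s" for i
    unfolding c_def
  proof (rule forms_sum)
    fix j assume "j \<in> {..<n}"
    then show "\<xi> $$ (i, j) * MConst (k j) \<in> forms (int (\<sigma> i))"
      using forms_mult[OF xi_forms[of i j] forms_MConst] that by simp
  qed
  have c_const: "c i = (if i = l then 1 else 0)" if i: "r \<le> i" "i < s" for i
  proof -
    have "c i \<in> forms 0" using c_forms[of i] i sigma_zero by simp
    have "(\<Sum>j<n. \<xi> $$ (i, j) * \<eta> 0 $$ (j, l)) = (\<xi> * \<eta> 0) $$ (i, l)"
      using xi_carrier eta_carrier[of 0] i l by (simp add: scalar_prod_def lessThan_atLeast0)
    also have "\<dots> = (if i = l then MVar 0 ^ N else 0)"
      using i l by (simp add: xi_eta)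
    finally have eq: "(\<Sum>j<n. \<xi> $$ (i, j) * \<eta> 0 $$ (j, l)) = (if i = l then MVar 0 ^ N else 0)" .
    have const: "\<xi> $$ (i, j) = MConst (lookup (\<xi> $$ (i, j)) 0)" if "j < n" for j
      using xi_forms[of i j] that i sigma_zero[of i] by (intro forms_0_const) simp
    have "c i = (\<Sum>j<n. MConst (lookup (\<xi> $$ (i, j)) 0 * k j))"
      unfolding c_def by (intro sum.cong refl) (metis const lessThan_iff MConst.hom_mult)
    also have "\<dots> = MConst (\<Sum>j<n. lookup (\<xi> $$ (i, j)) 0 * k j)" by (simp add: MConst.hom_sum)
    also have "(\<Sum>j<n. lookup (\<xi> $$ (i, j)) 0 * k j) = (\<Sum>j<n. lookup (\<xi> $$ (i, j) * \<eta> 0 $$ (j, l)) (single 0 N))"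
    proof (intro sum.cong refl)
      fix j assume "j \<in> {..<n}"
      then have "\<xi> $$ (i, j) = MConst (lookup (\<xi> $$ (i, j)) 0)" using const by simp
      then show "lookup (\<xi> $$ (i, j)) 0 * k j = lookup (\<xi> $$ (i, j) * \<eta> 0 $$ (j, l)) (single 0 N)"
        unfolding k_def by (metis lookup_MConst_mult)
    qed
    also have "\<dots> = lookup (\<Sum>j<n. \<xi> $$ (i, j) * \<eta> 0 $$ (j, l)) (single 0 N)"
      by (simp only: lookup_sum)
    also have "\<dots> = lookup (if i = l then MVar 0 ^ N else 0 :: 'k plane_ring) (single 0 N)"
      by (simp only: eq)
    also have "\<dots> = (if i = l then 1 else 0)" by (simp add: MVar_power)
    finally show ?thesis by (simp split: if_splits)
  qed
  have "(\<Sum>j<n. kscale (k j) (T j)) = (\<Sum>j<n. \<Sum>i<s. MConst (\<xi> $$ (i, j) * MConst (k j)) * MVar i)"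
    using xi_carrier unfolding kscale_def row_form_def
    by (simp add: sum_distrib_left MConst.hom_mult mult_ac)
  also have "\<dots> = (\<Sum>i<s. MConst (c i) * MVar i)"
    unfolding c_def by (subst sum.swap) (simp add: MConst.hom_sum sum_distrib_right)
  also have "\<dots> = (\<Sum>i<r. MConst (c i) * MVar i) + (\<Sum>i\<in>{r..<s}. MConst (c i) * MVar i)"
    using r_le by (subst sum.union_disjoint[symmetric]) (auto simp: ivl_disj_un intro!: sum.cong)
  also have "(\<Sum>i\<in>{r..<s}. MConst (c i) * MVar i) = (\<Sum>i\<in>{r..<s}. if i = l then MVar i else 0)"
    by (intro sum.cong refl) (simp add: c_const)
  also have "\<dots> = MVar l" using l by simp
  finally have "MVar l = (\<Sum>j<n. kscale (k j) (T j)) - (\<Sum>i<r. MConst (c i) * MVar i)" by (simp add: algebra_simps)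
  then show ?thesis using c_forms r_le by (intro that[of k c]) auto
qed

text \<open>If a variable of degree zero occurs, it is replaced by means of the previous lemma: the \<open>T\<^sub>j\<close> lead
into \<open>nK\<close>, and so do the other variables, whose coefficients have positive degree.\<close>

lemma monomial_in_span:
  assumes \<mu>: "keys \<mu> \<subseteq> {..<s}" and w: "int (wt \<sigma> \<mu>) + int (d (m - 1)) \<le> int (d m)"
  shows "g * single \<mu> 1 \<in> vs.span (nK \<union> A0)"
proof (cases "keys \<mu> \<subseteq> {..<r}")
  case True
  then have "g * single \<mu> 1 \<in> A0" using w by (auto simp: A0_def intro!: exI[of _ \<mu>])
  then show ?thesis by (intro vs.span_base) auto
next
  case False
  then obtain l where "l \<in> keys \<mu>" "l \<notin> {..<r}" by blast
  then have l: "l \<in> keys \<mu>" "r \<le> l" "l < s" using \<mu> by auto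
  \<comment> \<open>split off one factor \<open>w\<^sub>l\<close>; as \<open>\<sigma> l = 0\<close>, this does not change the \<open>x\<close>-degree\<close>
  define \<gamma> where "\<gamma> = \<mu> - single l 1"
  have \<mu>\<gamma>: "\<mu> = \<gamma> + single l 1"
    unfolding \<gamma>_def using l(1)
    by (intro poly_mapping_eqI) (auto simp: lookup_add lookup_minus lookup_single when_def in_keys_iff)
  have "keys \<gamma> \<subseteq> keys \<mu>"
    by (auto simp: \<gamma>_def in_keys_iff lookup_minus)
  then have \<gamma>: "keys \<gamma> \<subseteq> {..<s}" using \<mu> by auto
  have wt: "wt \<sigma> \<gamma> = wt \<sigma> \<mu>" unfolding \<mu>\<gamma> using sigma_zero[OF l(2,3)] by (simp add: wt_add)
  obtain k c where kc: "MVar l = (\<Sum>j<n. kscale (k j) (T j)) - (\<Sum>i<r. MConst (c i) * MVar i)"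
    "\<forall>i<r. c i \<in> forms (int (\<sigma> i))" using degree_zero_variable[OF l(2,3)] .
  have t1: "kscale c' x * y = kscale c' (x * y)" for c' x y by (simp add: kscale_def mult.assoc)
  have t2: "MConst c' * MVar i * (g * single \<gamma> 1) = g * single (\<gamma> + single i 1) c'" for c' :: "'k plane_ring" and i
  proof -
    have "MConst c' * MVar i * single \<gamma> 1 = single (\<gamma> + single i 1) c'"
      by (simp add: MConst_def MVar_def mult_single add.commute)
    then show ?thesis by (simp only: mult.left_commute[of _ g])
  qed
  have "single \<mu> 1 = MVar l * (single \<gamma> 1 :: (nat, 'k plane_ring) mpoly)"
    unfolding \<mu>\<gamma> by (simp add: MVar_def mult_single add.commute)
  then have "g * single \<mu> 1 = MVar l * (g * single \<gamma> 1)" by (simp only: mult.left_commute)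
  also have "\<dots> = (\<Sum>j<n. kscale (k j) (T j * (g * single \<gamma> 1))) - (\<Sum>i<r. g * single (\<gamma> + single i 1) (c i))"
    unfolding kc(1) left_diff_distrib sum_distrib_right
    by (simp only: t1 t2)
  also have "\<dots> \<in> nK"
  proof (intro vs.subspace_diff[OF subspace_nK] vs.subspace_sum[OF subspace_nK] vs.subspace_scale[OF subspace_nK] nK_T)
    have "single \<gamma> 1 \<in> bigraded_part \<sigma> (- int (wt \<sigma> \<gamma>)) (mdeg \<gamma>)"
      using forms_MConst[of 1] by (intro bigraded_part_single) auto
    then show "g * single \<gamma> 1 \<in> K"
      using w wt by (intro mult_g_in_K single_mpolys \<gamma>) auto
  next
    fix i assume i: "i \<in> {..<r}"
    have "keys (\<gamma> + single i 1) \<subseteq> {..<s}"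
      using Poly_Mapping.keys_add[of \<gamma> "single i 1"] \<gamma> i r_le by auto
    then show "g * single (\<gamma> + single i 1) (c i) \<in> nK"
      using i kc(2) sigma_pos[of i] w wt by (intro single_in_nK[of _ "int (\<sigma> i)"]) (auto simp: wt_add)
  qed auto
  finally show ?thesis by (intro vs.span_base) auto
qed

lemma high_degree_in_span:
  assumes q: "q \<in> K" "q \<in> bigraded_part \<sigma> a b" and a: "int (d (m - 1)) \<le> a"
  shows "q \<in> vs.span (nK \<union> A0)"
proof -
  obtain h' where h': "q = g * h'" "h' \<in> mpolys {..<s}" using q(1) by (auto simp: K_def)
  have "q = bicomp \<sigma> a b q" using bicomp_homogeneous[OF q(2), of a b] by simp
  also have "\<dots> = (if 1 \<le> b then g * bicomp \<sigma> (a - int (d m)) (b - 1) h' else 0)"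
    unfolding h'(1) by (rule bicomp_mult[OF g_bigraded])
  finally have q_eq: "q = (if 1 \<le> b then g * bicomp \<sigma> (a - int (d m)) (b - 1) h' else 0)" .
  define h where "h = (if 1 \<le> b then bicomp \<sigma> (a - int (d m)) (b - 1) h' else 0)"
  have "q = g * h"
    using q_eq unfolding h_def by (cases "1 \<le> b") (simp_all only: if_True if_False mult_zero_right)
  then have h: "q = g * h" "h \<in> mpolys {..<s}" "h \<in> bigraded_part \<sigma> (a - int (d m)) (b - 1)"
    using h'(2) by (auto simp: h_def)
  have "g * single \<mu> (lookup h \<mu>) \<in> vs.span (nK \<union> A0)" if \<mu>: "\<mu> \<in> keys h" for \<mu>
  proof -
    let ?D = "a - int (d m) + int (wt \<sigma> \<mu>)"
    have c: "lookup h \<mu> \<in> forms ?D" by (rule bigraded_part_lookup[OF h(3)])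
    have "lookup h \<mu> \<noteq> 0" using \<mu> by (simp add: in_keys_iff)
    then have "0 \<le> ?D" using forms_neg[OF c] by linarith
    have \<mu>s: "keys \<mu> \<subseteq> {..<s}" using h(2) \<mu> by (auto simp: mpolys_def)
    show ?thesis
    proof (cases "?D = 0")
      case True
      then have "single \<mu> (lookup h \<mu>) = kscale (lookup (lookup h \<mu>) 0) (single \<mu> 1)"
        using forms_0_const[of "lookup h \<mu>"] c single_eq_MConst_mult[of \<mu> "lookup h \<mu>"] by (simp add: kscale_def)
      then have "g * single \<mu> (lookup h \<mu>) = kscale (lookup (lookup h \<mu>) 0) (g * single \<mu> 1)"
        by (simp add: kscale_def mult.left_commute)
      moreover have "g * single \<mu> 1 \<in> vs.span (nK \<union> A0)"
        using True a by (intro monomial_in_span \<mu>s) auto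
      ultimately show ?thesis by (simp add: vs.span_scale)
    next
      case False
      then have "g * single \<mu> (lookup h \<mu>) \<in> nK"
        using \<open>0 \<le> ?D\<close> a by (intro single_in_nK[OF c _ \<mu>s]) auto
      then show ?thesis by (intro vs.span_base) auto
    qed
  qed
  then have "(\<Sum>\<mu>\<in>keys h. g * single \<mu> (lookup h \<mu>)) \<in> vs.span (nK \<union> A0)" by (rule vs.span_sum)
  also have "(\<Sum>\<mu>\<in>keys h. g * single \<mu> (lookup h \<mu>)) = g * h"
    by (simp only: sum_distrib_left[symmetric] sum_of_singles[symmetric])
  finally show ?thesis by (simp only: h(1))
qed

lemma A0_subset_K: "A0 \<subseteq> K"
proof
  fix p assume "p \<in> A0"
  then obtain \<mu> where \<mu>: "p = g * single \<mu> 1" "keys \<mu> \<subseteq> {..<r}" "wt \<sigma> \<mu> \<le> d m - d (m - 1)"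
    by (auto simp: A0_def)
  have "single \<mu> 1 \<in> bigraded_part \<sigma> (- int (wt \<sigma> \<mu>)) (mdeg \<mu>)"
    using forms_MConst[of 1] by (intro bigraded_part_single) auto
  then show "p \<in> K"
    unfolding \<mu>(1) using \<mu>(2,3) r_le d_mono(2) by (intro mult_g_in_K single_mpolys) auto
qed

lemma A0_bigraded:
  assumes "p \<in> A0" obtains a b where "p \<in> bigraded_part \<sigma> a b" "int (d (m - 1)) \<le> a"
proof -
  from assms obtain \<mu> where \<mu>: "p = g * single \<mu> 1" "wt \<sigma> \<mu> \<le> d m - d (m - 1)"
    by (auto simp: A0_def)
  have "single \<mu> 1 \<in> bigraded_part \<sigma> (- int (wt \<sigma> \<mu>)) (mdeg \<mu>)"
    using forms_MConst[of 1] by (intro bigraded_part_single) auto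
  from bigraded_part_mult[OF g_bigraded this] show ?thesis
    unfolding \<mu>(1)[symmetric] using \<mu>(2) d_mono(2) by (intro that) auto
qed

lemma K_subset_span: "K \<subseteq> vs.span (nK \<union> (A0 \<union> H))"
proof
  fix p assume p: "p \<in> K"
  obtain D where D: "finite D" "\<And>D'. finite D' \<Longrightarrow> D \<subseteq> D' \<Longrightarrow> p = (\<Sum>(a,b)\<in>D'. bicomp \<sigma> a b p)"
    using sum_of_bicomps[where p = p and \<sigma> = \<sigma>] by metis
  have "bicomp \<sigma> a b p \<in> vs.span (nK \<union> (A0 \<union> H))" for a b
  proof (cases "int (d (m - 1)) \<le> a")
    case True
    have "bicomp \<sigma> a b p \<in> vs.span (nK \<union> A0)"
      by (rule high_degree_in_span[OF K_bicomp[OF p] bicomp_in True])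
    then show ?thesis using vs.span_mono[of "nK \<union> A0" "nK \<union> (A0 \<union> H)"] by blast
  next
    case False
    then have "bicomp \<sigma> a b p \<in> H" unfolding H_def using K_bicomp[OF p] bicomp_in
      by (auto intro!: exI[of _ a] exI[of _ b])
    then show ?thesis by (intro vs.span_base) auto
  qed
  then have "(\<Sum>(a,b)\<in>D. bicomp \<sigma> a b p) \<in> vs.span (nK \<union> (A0 \<union> H))" by (intro vs.span_sum) auto
  then show "p \<in> vs.span (nK \<union> (A0 \<union> H))" using D by (metis order_refl)
qed

text \<open>Reduction modulo \<open>x\<^sub>0, x\<^sub>1\<close> and the variables \<open>w\<^sub>l\<close> of degree zero. It kills the \<open>x\<^sub>i\<close>, and it kills
every \<open>T\<^sub>j\<close>, because the coefficient of \<open>w\<^sub>l\<close> in \<open>T\<^sub>j\<close> has degree \<open>\<sigma> l\<close>.\<close>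

definition at_zero :: "(nat, 'k plane_ring) mpoly \<Rightarrow> (nat, 'k) mpoly" where
  "at_zero = subst (\<lambda>c. MConst (lookup c 0)) (\<lambda>l. if l < r then MVar l else 0)"

lemma comm_ring_hom_at_zero: "comm_ring_hom at_zero"
  unfolding at_zero_def
  by (intro comm_ring_hom_subst comm_ring_hom_compose[OF comm_ring_hom_MConst] comm_ring_hom_constant_coeff)

lemma at_zero_single: "at_zero (single \<mu> c) = MConst (lookup c 0) * power_prod (\<lambda>l. if l < r then MVar l else 0) \<mu>"
  unfolding at_zero_def
  by (intro subst_single comm_ring_hom_compose[OF comm_ring_hom_MConst] comm_ring_hom_constant_coeff)

lemma at_zero_MConst: "at_zero (MConst c) = MConst (lookup c 0)"
  unfolding MConst_def[of c] at_zero_single by simp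

lemma at_zero_MVar: "at_zero (MVar l) = (if l < r then MVar l else 0)"
  unfolding MVar_def[of l] at_zero_single by (simp add: MVar_def)

lemma at_zero_monomial:
  assumes "keys \<mu> \<subseteq> {..<r}" shows "at_zero (single \<mu> 1) = single \<mu> 1"
proof -
  have "power_prod (\<lambda>l. if l < r then MVar l else 0) \<mu> = power_prod (MVar :: nat \<Rightarrow> (nat, 'k) mpoly) \<mu>"
    unfolding power_prod_def using assms by (intro prod.cong) auto
  then have "at_zero (single \<mu> 1) = power_prod MVar \<mu>" by (simp add: at_zero_single)
  also have "\<dots> = single \<mu> 1" by (simp add: single_eq_MConst_power_prod)
  finally show ?thesis .
qed

lemma nK_at_zero: "nK \<subseteq> {g * h | h. at_zero h = 0}"
proof -
  interpret hom: comm_ring_hom at_zero by (rule comm_ring_hom_at_zero)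
  have T: "at_zero (T j) = 0" if j: "j < n" for j
  proof -
    have "at_zero (MVar l * MConst (\<xi> $$ (l, j))) = 0" if "l < s" for l
    proof (cases "l < r")
      case True
      then have "lookup (\<xi> $$ (l, j)) 0 = 0"
        using forms_pos_lookup_0[OF xi_forms[OF that j]] sigma_pos[of l] by simp
      then show ?thesis by (simp add: hom.hom_mult at_zero_MConst)
    qed (simp add: hom.hom_mult at_zero_MVar)
    then show ?thesis using xi_carrier by (simp add: row_form_def hom.hom_sum)
  qed
  have Y: "at_zero (Y i) = 0" for i
  proof -
    have "lookup (MVar i :: 'k plane_ring) 0 = 0" by (rule forms_pos_lookup_0[OF forms_MVar]) simp
    then show ?thesis by (simp add: at_zero_MConst)
  qed
  show ?thesis
    unfolding nK_def
  proof (rule vs.span_minimal)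
    show "{Y i * p | i p. p \<in> K} \<union> {T j * p | j p. j < n \<and> p \<in> K} \<subseteq> {g * h | h. at_zero h = 0}"
    proof
      fix x assume "x \<in> {Y i * p | i p. p \<in> K} \<union> {T j * p | j p. j < n \<and> p \<in> K}"
      then obtain y p where x: "x = y * p" "at_zero y = 0" "p \<in> K" using T Y by auto
      then obtain h where "p = g * h" by (auto simp: K_def)
      then have "x = g * (y * h)" "at_zero (y * h) = 0" using x by (auto simp: hom.hom_mult mult.left_commute)
      then show "x \<in> {g * h | h. at_zero h = 0}" by blast
    qed
    show "vs.subspace {g * h | h. at_zero h = 0}"
      unfolding vs.subspace_def
    proof (intro conjI ballI allI)
      show "0 \<in> {g * h | h. at_zero h = 0}" by (auto intro!: exI[of _ 0])
      fix x y assume "x \<in> {g * h | h. at_zero h = 0}" "y \<in> {g * h | h. at_zero h = 0}"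
      then obtain h k where "x = g * h" "y = g * k" "at_zero h = 0" "at_zero k = 0" by blast
      then show "x + y \<in> {g * h | h. at_zero h = 0}"
        by (auto intro!: exI[of _ "h + k"] simp: distrib_left hom.hom_add)
    next
      fix c x assume "x \<in> {g * h | h. at_zero h = 0}"
      then obtain h where "x = g * h" "at_zero h = 0" by blast
      then show "kscale c x \<in> {g * h | h. at_zero h = 0}"
        by (auto intro!: exI[of _ "kscale c h"] simp: kscale_def mult.left_commute hom.hom_mult)
    qed
  qed
qed

text \<open>Elements of \<open>nK\<close> are \<open>g h\<close> with \<open>h\<close> killed by \<^const>\<open>at_zero\<close>, which leaves the monomials in the variables
of positive \<open>\<sigma>\<close> unchanged.\<close>

lemma A0_independent:
  assumes t: "finite t" "t \<subseteq> A0" and sum: "(\<Sum>p\<in>t. kscale (u p) p) \<in> nK"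
  shows "\<forall>p\<in>t. u p = 0"
proof -
  interpret hom: comm_ring_hom at_zero by (rule comm_ring_hom_at_zero)
  have "\<forall>p\<in>t. \<exists>\<mu>. p = g * single \<mu> 1 \<and> keys \<mu> \<subseteq> {..<r}" using t(2) by (auto simp: A0_def)
  then obtain \<mu> where \<mu>: "\<And>p. p \<in> t \<Longrightarrow> p = g * single (\<mu> p) 1" "\<And>p. p \<in> t \<Longrightarrow> keys (\<mu> p) \<subseteq> {..<r}" by metis
  obtain h where h: "(\<Sum>p\<in>t. kscale (u p) p) = g * h" "at_zero h = 0" using sum nK_at_zero by blast
  have "(\<Sum>p\<in>t. kscale (u p) p) = (\<Sum>p\<in>t. g * kscale (u p) (single (\<mu> p) 1))"
  proof (rule sum.cong[OF refl])
    fix p assume p: "p \<in> t"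
    have "kscale (u p) (g * single (\<mu> p) 1) = g * kscale (u p) (single (\<mu> p) 1)"
      by (simp only: kscale_def mult.left_commute)
    then show "kscale (u p) p = g * kscale (u p) (single (\<mu> p) 1)"
      by (simp only: \<mu>(1)[OF p, symmetric])
  qed
  also have "\<dots> = g * (\<Sum>p\<in>t. kscale (u p) (single (\<mu> p) 1))" by (simp only: sum_distrib_left)
  finally have "g * h = g * (\<Sum>p\<in>t. kscale (u p) (single (\<mu> p) 1))" unfolding h(1) .
  then have "h = (\<Sum>p\<in>t. kscale (u p) (single (\<mu> p) 1))" by (rule iffD1[OF mult_left_cancel[OF g_nonzero]])
  then have "0 = (\<Sum>p\<in>t. at_zero (kscale (u p) (single (\<mu> p) 1)))" using h(2) by (simp add: hom.hom_sum)
  also have "\<dots> = (\<Sum>p\<in>t. single (\<mu> p) (u p))"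
  proof (intro sum.cong refl)
    fix p assume "p \<in> t"
    then show "at_zero (kscale (u p) (single (\<mu> p) 1)) = single (\<mu> p) (u p)"
      by (simp add: kscale_def hom.hom_mult at_zero_MConst at_zero_monomial \<mu>(2)) (simp add: MConst_def mult_single)
  qed
  finally have zero: "(\<Sum>p\<in>t. single (\<mu> p) (u p)) = 0" ..
  show ?thesis
  proof
    fix q assume q: "q \<in> t"
    have inj: "p = q" if "p \<in> t" "\<mu> p = \<mu> q" for p
    proof -
      have "p = g * single (\<mu> q) 1" using \<mu>(1)[OF that(1)] unfolding that(2) .
      also have "\<dots> = q" using \<mu>(1)[OF q] by (rule sym)
      finally show ?thesis .
    qed
    have "0 = lookup (\<Sum>p\<in>t. single (\<mu> p) (u p)) (\<mu> q)" by (simp add: zero)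
    also have "\<dots> = (\<Sum>p\<in>t. if p = q then u p else 0)"
      unfolding lookup_sum by (intro sum.cong refl) (auto simp: lookup_single when_def dest: inj)
    also have "\<dots> = u q" using t(1) q by simp
    finally show "u q = 0" ..
  qed
qed

definition RE_submodule :: "(nat, 'k plane_ring) mpoly set \<Rightarrow> bool" where
  "RE_submodule I \<longleftrightarrow> 0 \<in> I \<and> (\<forall>p\<in>I. \<forall>q\<in>I. p + q \<in> I) \<and> (\<forall>p\<in>RE. \<forall>q\<in>I. p * q \<in> I)"

text \<open>Induction on the sum of the two degrees, which are both nonnegative on \<open>RE\<close>: the component of an
element of \<open>nK\<close> is a combination of products of \<open>x\<^sub>i\<close> and \<open>T\<^sub>j\<close> with components of smaller degree.\<close>

lemma graded_nakayama:
  assumes G: "\<And>p. p \<in> G \<Longrightarrow> \<exists>a b. p \<in> bigraded_part \<sigma> a b" and span: "K \<subseteq> vs.span (nK \<union> G)"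
    and I: "RE_submodule I" "G \<subseteq> I"
  shows "K \<subseteq> I"
proof -
  have I0: "0 \<in> I" and Iadd: "\<And>p q. p \<in> I \<Longrightarrow> q \<in> I \<Longrightarrow> p + q \<in> I" and Imult: "\<And>p q. p \<in> RE \<Longrightarrow> q \<in> I \<Longrightarrow> p * q \<in> I"
    using I(1) by (auto simp: RE_submodule_def)
  have hom: "q \<in> I" if "q \<in> K" "q \<in> bigraded_part \<sigma> a b" for q a b
    using that
  proof (induction "nat a + b" arbitrary: q a b rule: less_induct)
    case less
    define W where "W = {p. bicomp \<sigma> a b p \<in> I}"
    have W: "vs.subspace W"
      unfolding vs.subspace_def W_def using I0 Iadd
      by (auto simp: bicomp_add bicomp_kscale) (simp add: kscale_def Imult)
    have "G \<subseteq> W"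
    proof
      fix p assume p: "p \<in> G"
      then obtain a' b' where "p \<in> bigraded_part \<sigma> a' b'" using G by blast
      then show "p \<in> W" using p I(2) I0 by (auto simp: W_def bicomp_homogeneous)
    qed
    moreover have "nK \<subseteq> W"
      unfolding nK_def
    proof (rule vs.span_minimal[OF _ W], safe)
      fix i p assume p: "p \<in> K"
      have "Y i \<in> bigraded_part \<sigma> 1 0" by auto
      from bicomp_mult[OF this, of a b p] have eq: "bicomp \<sigma> a b (Y i * p) = Y i * bicomp \<sigma> (a - 1) b p" by simp
      have "bicomp \<sigma> (a - 1) b p \<in> I"
      proof (cases "1 \<le> a")
        case True
        then show ?thesis by (intro less(1)[OF _ K_bicomp[OF p] bicomp_in]) auto
      next
        case False
        then have "bicomp \<sigma> (a - 1) b p = 0"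
          using K_bicomp[OF p] K_subset_RE by (intro RE_negative[OF _ bicomp_in]) auto
        then show ?thesis by (simp add: I0)
      qed
      then show "Y i * p \<in> W" by (simp add: W_def eq Imult)
    next
      fix j p assume j: "j < n" and p: "p \<in> K"
      have eq: "bicomp \<sigma> a b (T j * p) = (if 1 \<le> b then T j * bicomp \<sigma> a (b - 1) p else 0)"
        using bicomp_mult[OF row_form_xi_bigraded[OF j], of a b p] by simp
      show "T j * p \<in> W"
      proof (cases "1 \<le> b")
        case True
        then have "bicomp \<sigma> a (b - 1) p \<in> I" by (intro less(1)[OF _ K_bicomp[OF p] bicomp_in]) auto
        then show ?thesis using True j by (simp add: W_def eq Imult RE_T)
      qed (simp add: W_def eq I0)
    qed
    ultimately have "vs.span (nK \<union> G) \<subseteq> W" using W by (intro vs.span_minimal) auto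
    then have "q \<in> W" using span less(2) by auto
    then show "q \<in> I" using bicomp_homogeneous[OF less(3)] by (simp add: W_def)
  qed
  show ?thesis
  proof
    fix p assume p: "p \<in> K"
    obtain D where D: "finite D" "\<And>D'. finite D' \<Longrightarrow> D \<subseteq> D' \<Longrightarrow> p = (\<Sum>(a,b)\<in>D'. bicomp \<sigma> a b p)"
      using sum_of_bicomps[where p = p and \<sigma> = \<sigma>] by metis
    have "(\<Sum>d\<in>D. case d of (a,b) \<Rightarrow> bicomp \<sigma> a b p) \<in> I"
      using D(1) by (induction D) (auto intro!: I0 Iadd hom[OF K_bicomp[OF p] bicomp_in])
    then show "p \<in> I" using D by (metis order_refl)
  qed
qed

lemma span_nK_submodule:
  assumes "G \<subseteq> K" shows "RE_submodule (vs.span (nK \<union> G))"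
  unfolding RE_submodule_def
proof (intro conjI ballI)
  let ?I = "vs.span (nK \<union> G)"
  show "0 \<in> ?I" by (rule vs.span_zero)
  show "p + q \<in> ?I" if "p \<in> ?I" "q \<in> ?I" for p q using that by (rule vs.span_add)
  fix p q assume p: "p \<in> RE" and q: "q \<in> ?I"
  have "?I \<subseteq> {q. p * q \<in> ?I}"
  proof (rule vs.span_minimal)
    show "nK \<union> G \<subseteq> {q. p * q \<in> ?I}"
    proof
      fix x assume "x \<in> nK \<union> G"
      then consider "x \<in> nK" | "x \<in> G" by blast
      then show "x \<in> {q. p * q \<in> ?I}"
      proof cases
        case 1
        then have "p * x \<in> nK" by (rule nK_mult[OF p])
        then show ?thesis using vs.span_base[of _ "nK \<union> G"] by auto
      next
        case 2
        then obtain c where "p * x - kscale c x \<in> nK" using RE_mult_modulo_nK[OF p] assms by blast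
        then have "p * x - kscale c x \<in> ?I" using vs.span_base[of _ "nK \<union> G"] by auto
        moreover have "kscale c x \<in> ?I" using 2 by (intro vs.span_scale vs.span_base) auto
        ultimately have "p * x - kscale c x + kscale c x \<in> ?I" by (rule vs.span_add)
        then show ?thesis by simp
      qed
    qed
    show "vs.subspace {q. p * q \<in> ?I}"
      unfolding vs.subspace_def
      by (auto simp: distrib_left vs.span_zero vs.span_add kscale_def mult.left_commute[of p])
         (metis kscale_def vs.span_scale)
  qed
  with q show "p * q \<in> ?I" by auto
qed

text \<open>A basis of \<open>K\<close> modulo \<open>nK\<close> that contains \<open>A0\<close> generates by the graded Nakayama lemma. Without one of
its elements it generates a submodule of \<open>span (nK \<union> (G - {x}))\<close>, which does not contain that element.\<close>

lemma exists_minimal_generators: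
  obtains G where "A0 \<subseteq> G" "G \<subseteq> A0 \<union> H" "0 \<notin> G"
    "\<And>I. RE_submodule I \<Longrightarrow> G \<subseteq> I \<Longrightarrow> K \<subseteq> I"
    "\<And>G'. G' \<subset> G \<Longrightarrow> \<exists>I. RE_submodule I \<and> G' \<subseteq> I \<and> I \<subseteq> K \<and> I \<noteq> K"
proof (rule vs.independent_modulo_extend[OF subspace_nK, of A0 H])
  fix t u assume "finite t" "t \<subseteq> A0" "(\<Sum>p\<in>t. kscale (u p) p) \<in> nK"
  then show "\<forall>p\<in>t. u p = 0" by (rule A0_independent)
next
  fix G assume G: "A0 \<subseteq> G" "G \<subseteq> A0 \<union> H" "A0 \<union> H \<subseteq> vs.span (nK \<union> G)"
    "\<And>x. x \<in> G \<Longrightarrow> x \<notin> vs.span (nK \<union> (G - {x}))"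
  have GK: "G \<subseteq> K" using G(2) A0_subset_K by (auto simp: H_def)
  have span: "K \<subseteq> vs.span (nK \<union> G)"
  proof -
    have "nK \<union> (A0 \<union> H) \<subseteq> vs.span (nK \<union> G)" using G(3) vs.span_superset[of "nK \<union> G"] by auto
    then show ?thesis using K_subset_span vs.span_minimal[OF _ vs.subspace_span] by blast
  qed
  show thesis
  proof (rule that[OF G(1,2)])
    show "0 \<notin> G" using G(4) vs.span_zero by blast
    fix I assume I: "RE_submodule I" "G \<subseteq> I"
    have "\<exists>a b. p \<in> bigraded_part \<sigma> a b" if p: "p \<in> G" for p
    proof -
      consider "p \<in> A0" | "p \<in> H" using p G(2) by auto
      then show ?thesis by cases (metis A0_bigraded, auto simp: H_def)
    qed
    from graded_nakayama[OF this span I] show "K \<subseteq> I" .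
  next
    fix G' assume "G' \<subset> G"
    then obtain x where x: "x \<in> G" "G' \<subseteq> G - {x}" by auto
    let ?I = "vs.span (nK \<union> (G - {x}))"
    have "RE_submodule ?I" using GK by (intro span_nK_submodule) auto
    moreover have "G' \<subseteq> ?I" using x vs.span_superset[of "nK \<union> (G - {x})"] by auto
    moreover have "?I \<subseteq> K" using GK nK_subset_K by (intro vs.span_minimal subspace_K) auto
    moreover have "?I \<noteq> K" using G(4)[OF x(1)] x(1) GK by auto
    ultimately show "\<exists>I. RE_submodule I \<and> G' \<subseteq> I \<and> I \<subseteq> K \<and> I \<noteq> K" by blast
  qed
qed

lemma A0_alt:
  "{g * (\<Prod>i<s. MVar i ^ \<alpha> i) | \<alpha> :: nat \<Rightarrow> nat.
     (\<forall>i. r \<le> i \<longrightarrow> i < s \<longrightarrow> \<alpha> i = 0) \<and> (\<Sum>i<s. \<alpha> i * \<sigma> i) \<le> d m - d (m - 1)} = A0"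
proof (intro equalityI subsetI)
  fix p assume "p \<in> {g * (\<Prod>i<s. MVar i ^ \<alpha> i) | \<alpha> :: nat \<Rightarrow> nat.
     (\<forall>i. r \<le> i \<longrightarrow> i < s \<longrightarrow> \<alpha> i = 0) \<and> (\<Sum>i<s. \<alpha> i * \<sigma> i) \<le> d m - d (m - 1)}"
  then obtain \<alpha> :: "nat \<Rightarrow> nat" where \<alpha>: "p = g * (\<Prod>i<s. MVar i ^ \<alpha> i)"
    "\<And>i. r \<le> i \<Longrightarrow> i < s \<Longrightarrow> \<alpha> i = 0" "(\<Sum>i<s. \<alpha> i * \<sigma> i) \<le> d m - d (m - 1)" by blast
  define \<mu> where "\<mu> = (\<Sum>i<s. single i (\<alpha> i))"
  have lk: "lookup \<mu> i = (if i < s then \<alpha> i else 0)" for i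
    by (simp add: \<mu>_def lookup_sum lookup_single when_def)
  have ks: "keys \<mu> \<subseteq> {..<s}" and kr: "keys \<mu> \<subseteq> {..<r}"
    using \<alpha>(2) by (auto simp: in_keys_iff lk split: if_splits) (metis not_less not_gr_zero)
  have "single \<mu> 1 = (power_prod MVar \<mu> :: (nat, 'k plane_ring) mpoly)" by (simp add: single_eq_MConst_power_prod)
  also have "\<dots> = (\<Prod>i<s. MVar i ^ \<alpha> i)" using ks by (simp add: power_prod_superset[of "{..<s}"] lk)
  finally have "p = g * single \<mu> 1" using \<alpha>(1) by simp
  moreover have "wt \<sigma> \<mu> \<le> d m - d (m - 1)" using \<alpha>(3) ks by (simp add: wt_superset[of "{..<s}"] lk)
  ultimately show "p \<in> A0" using kr unfolding A0_def by blast
next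
  fix p assume "p \<in> A0"
  then obtain \<mu> where \<mu>: "p = g * single \<mu> 1" "keys \<mu> \<subseteq> {..<r}" "wt \<sigma> \<mu> \<le> d m - d (m - 1)"
    by (auto simp: A0_def)
  then have ks: "keys \<mu> \<subseteq> {..<s}" using r_le by auto
  have "single \<mu> 1 = (power_prod MVar \<mu> :: (nat, 'k plane_ring) mpoly)" by (simp add: single_eq_MConst_power_prod)
  also have "\<dots> = (\<Prod>i<s. MVar i ^ lookup \<mu> i)" using ks by (simp add: power_prod_superset[of "{..<s}"])
  finally have "p = g * (\<Prod>i<s. MVar i ^ lookup \<mu> i)" using \<mu>(1) by simp
  moreover have "lookup \<mu> i = 0" if "r \<le> i" for i using \<mu>(2) that by (metis in_keys_iff lessThan_iff not_le subsetD)
  moreover have "(\<Sum>i<s. lookup \<mu> i * \<sigma> i) \<le> d m - d (m - 1)" using \<mu>(3) ks by (simp add: wt_superset[of "{..<s}"])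
  ultimately show "p \<in> {g * (\<Prod>i<s. MVar i ^ \<alpha> i) | \<alpha> :: nat \<Rightarrow> nat.
     (\<forall>i. r \<le> i \<longrightarrow> i < s \<longrightarrow> \<alpha> i = 0) \<and> (\<Sum>i<s. \<alpha> i * \<sigma> i) \<le> d m - d (m - 1)}" by blast
qed

lemma high_degree_part:
  assumes "A0 \<subseteq> G" "G \<subseteq> A0 \<union> H" "0 \<notin> G"
  shows "{p \<in> G. \<exists>a b. int (d (m - 1)) \<le> a \<and> p \<in> bigraded_part \<sigma> a b} = A0"
proof (intro equalityI subsetI)
  fix p assume "p \<in> {p \<in> G. \<exists>a b. int (d (m - 1)) \<le> a \<and> p \<in> bigraded_part \<sigma> a b}"
  then obtain a b where p: "p \<in> G" "int (d (m - 1)) \<le> a" "p \<in> bigraded_part \<sigma> a b" by blast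
  then have "p \<noteq> 0" using assms(3) by auto
  have "p \<notin> H"
  proof
    assume "p \<in> H"
    then obtain a' b' where "p \<in> bigraded_part \<sigma> a' b'" "a' < int (d (m - 1))" by (auto simp: H_def)
    with bigraded_part_unique(1)[OF p(3) _ \<open>p \<noteq> 0\<close>] p(2) show False by fastforce
  qed
  then show "p \<in> A0" using p assms(2) by auto
next
  fix p assume p: "p \<in> A0"
  obtain a b where "p \<in> bigraded_part \<sigma> a b" "int (d (m - 1)) \<le> a" using A0_bigraded[OF p] .
  then show "p \<in> {p \<in> G. \<exists>a b. int (d (m - 1)) \<le> a \<and> p \<in> bigraded_part \<sigma> a b}"
    using p assms(1) by auto
qed

end

section \<open>Ideals in subrings\<close>

abbreviation (input) subring_record :: "'a::comm_ring_1 set \<Rightarrow> 'a ring" where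
  "subring_record C \<equiv> \<lparr>carrier = C, monoid.mult = (*), one = 1, zero = 0, add = (+)\<rparr>"

definition subring_closed :: "'a::comm_ring_1 set \<Rightarrow> bool" where
  "subring_closed C \<longleftrightarrow> 1 \<in> C \<and> (\<forall>x\<in>C. - x \<in> C) \<and> (\<forall>x\<in>C. \<forall>y\<in>C. x + y \<in> C \<and> x * y \<in> C)"

lemma subring_closed_zero: "subring_closed C \<Longrightarrow> 0 \<in> C"
  unfolding subring_closed_def by (metis add.right_inverse)

lemma cring_subring_record:
  assumes C: "subring_closed C" shows "cring (subring_record C)"
proof (rule cringI)
  show "abelian_group (subring_record C)"
  proof (rule abelian_groupI)
    fix x assume "x \<in> carrier (subring_record C)"
    then show "\<exists>y\<in>carrier (subring_record C). y \<oplus>\<^bsub>subring_record C\<^esub> x = \<zero>\<^bsub>subring_record C\<^esub>"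
      using C by (auto simp: subring_closed_def intro!: bexI[of _ "- x"])
  qed (use C subring_closed_zero[OF C] in \<open>auto simp: subring_closed_def algebra_simps\<close>)
  show "comm_monoid (subring_record C)"
    by (rule comm_monoidI) (use C in \<open>auto simp: subring_closed_def algebra_simps\<close>)
qed (use C in \<open>auto simp: subring_closed_def algebra_simps\<close>)

lemma ideal_of_closed:
  assumes "cring A" and I: "I \<subseteq> carrier A" "\<zero>\<^bsub>A\<^esub> \<in> I"
    and add: "\<And>x y. x \<in> I \<Longrightarrow> y \<in> I \<Longrightarrow> x \<oplus>\<^bsub>A\<^esub> y \<in> I"
    and mult: "\<And>a x. a \<in> carrier A \<Longrightarrow> x \<in> I \<Longrightarrow> a \<otimes>\<^bsub>A\<^esub> x \<in> I"
  shows "ideal I A"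
proof -
  interpret A: cring A by fact
  have neg: "\<ominus>\<^bsub>A\<^esub> x \<in> I" if "x \<in> I" for x
    using mult[of "\<ominus>\<^bsub>A\<^esub> \<one>\<^bsub>A\<^esub>" x] that I(1) by (auto simp: A.l_minus)
  show ?thesis
  proof (rule idealI)
    show "subgroup I (add_monoid A)"
      by (rule A.add.subgroupI) (use I add neg in \<open>auto simp: a_inv_def\<close>)
    show "a \<otimes>\<^bsub>A\<^esub> x \<in> I" if "a \<in> I" "x \<in> carrier A" for a x
      using mult[OF that(2,1)] that I(1) A.m_comm by (metis subsetD)
  qed (use mult A.ring_axioms in auto)
qed

lemma ideal_subring_record_iff:
  assumes C: "subring_closed C"
  shows "ideal I (subring_record C) \<longleftrightarrow>
    I \<subseteq> C \<and> 0 \<in> I \<and> (\<forall>x\<in>I. \<forall>y\<in>I. x + y \<in> I) \<and> (\<forall>a\<in>C. \<forall>x\<in>I. a * x \<in> I)"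
proof
  assume "ideal I (subring_record C)"
  then interpret ideal I "subring_record C" .
  show "I \<subseteq> C \<and> 0 \<in> I \<and> (\<forall>x\<in>I. \<forall>y\<in>I. x + y \<in> I) \<and> (\<forall>a\<in>C. \<forall>x\<in>I. a * x \<in> I)"
    using a_subset additive_subgroup.zero_closed[OF is_additive_subgroup]
      additive_subgroup.a_closed[OF is_additive_subgroup] I_l_closed by auto
next
  assume "I \<subseteq> C \<and> 0 \<in> I \<and> (\<forall>x\<in>I. \<forall>y\<in>I. x + y \<in> I) \<and> (\<forall>a\<in>C. \<forall>x\<in>I. a * x \<in> I)"
  then show "ideal I (subring_record C)"
    by (intro ideal_of_closed cring_subring_record[OF C]) auto
qed

lemma subring_closed_UNIV: "subring_closed UNIV" by (simp add: subring_closed_def)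

section \<open>Ideals of height two in the polynomial ring of the plane\<close>

text \<open>With \<open>z\<close> the outer and \<open>t\<close> the inner variable, \<open>x\<^sub>i\<close> goes to \<open>z\<close> and the other variable to \<open>z t\<close>. A form
\<open>p\<close> of degree \<open>D\<close> goes to \<open>z\<^sup>D\<close> times its dehomogenization, so a prime of \<open>k[t]\<close> pulls back to a homogeneous
prime. The map becomes surjective when \<open>z\<close> is inverted.\<close>

definition chart :: "2 \<Rightarrow> 'k::field plane_ring \<Rightarrow> 'k poly poly" where
  "chart i = subst (\<lambda>c. [:[:c:]:]) (\<lambda>v. if v = i then [:0, 1:] else [:0, [:0, 1:]:])"

lemma comm_ring_hom_chart: "comm_ring_hom (chart i)"
proof -
  have "comm_ring_hom (\<lambda>c :: 'k::field. [:[:c:]:])" by unfold_locales (auto simp: one_pCons)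
  then show ?thesis unfolding chart_def by (rule comm_ring_hom_subst)
qed

interpretation chart: comm_ring_hom "chart i" by (rule comm_ring_hom_chart)

lemma power_prod_two:
  assumes "(i::2) \<noteq> j" shows "power_prod h \<mu> = h i ^ lookup \<mu> i * h j ^ lookup \<mu> j"
proof -
  have "v = i \<or> v = j" for v using assms two_cases[of v] two_cases[of i] two_cases[of j] by auto
  then have "keys \<mu> \<subseteq> {i, j}" by blast
  then have "power_prod h \<mu> = (\<Prod>v\<in>{i, j}. h v ^ lookup \<mu> v)" by (intro power_prod_superset) auto
  then show ?thesis using assms by simp
qed

lemma mdeg_two': "(i::2) \<noteq> j \<Longrightarrow> mdeg \<mu> = lookup \<mu> i + lookup \<mu> j"
  using two_cases[of i] two_cases[of j] by (auto simp: mdeg_two)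

lemma chart_single:
  assumes "i \<noteq> j"
  shows "chart i (single \<mu> c) = monom (monom c (lookup \<mu> j)) (mdeg \<mu>)"
proof -
  have hom: "comm_ring_hom (\<lambda>c :: 'a. [:[:c:]:])" by unfold_locales (auto simp: one_pCons)
  have p1: "[:0, 1:] ^ k = (monom 1 k :: 'a poly poly)" for k
    by (simp add: monom_altdef)
  have p2: "[:0, [:0, 1:]:] ^ k = (monom (monom 1 k) k :: 'a poly poly)" for k
  proof -
    have "[:0, [:0, 1:]:] = (monom (monom 1 1) 1 :: 'a poly poly)" by (simp add: monom_altdef)
    then show ?thesis by (simp add: monom_power)
  qed
  have c: "[:[:c:]:] = monom (monom c 0) 0" by (simp add: monom_0)
  have "chart i (single \<mu> c) = [:[:c:]:] * ([:0, 1:] ^ lookup \<mu> i * [:0, [:0, 1:]:] ^ lookup \<mu> j)"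
    unfolding chart_def subst_single[OF hom] power_prod_two[OF assms] using assms by simp
  also have "\<dots> = monom (monom c (lookup \<mu> j)) (mdeg \<mu>)"
    unfolding p1 p2 c mult_monom mdeg_two'[OF assms] by (simp add: mult_monom)
  finally show ?thesis .
qed

lemma chart_sum: "i \<noteq> j \<Longrightarrow> chart i p = (\<Sum>\<mu>\<in>keys p. monom (monom (lookup p \<mu>) (lookup \<mu> j)) (mdeg \<mu>))"
proof -
  assume ij: "i \<noteq> j"
  have "chart i p = chart i (\<Sum>\<mu>\<in>keys p. single \<mu> (lookup p \<mu>))"
    using sum_of_singles[of p] by simp
  then show ?thesis by (simp add: chart.hom_sum chart_single[OF ij])
qed

lemma two_eqI: "(i::2) \<noteq> j \<Longrightarrow> lookup \<mu> i = lookup \<nu> i \<Longrightarrow> lookup \<mu> j = lookup \<nu> j \<Longrightarrow> \<mu> = \<nu>"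
proof (rule poly_mapping_eqI)
  fix v assume "i \<noteq> j" "lookup \<mu> i = lookup \<nu> i" "lookup \<mu> j = lookup \<nu> j"
  then show "lookup \<mu> v = lookup \<nu> v" using two_cases[of v] two_cases[of i] two_cases[of j] by auto
qed

lemma coeff_chart:
  assumes "i \<noteq> j"
  shows "coeff (coeff (chart i p) (mdeg \<nu>)) (lookup \<nu> j) = lookup p \<nu>"
proof -
  have "coeff (coeff (chart i p) (mdeg \<nu>)) (lookup \<nu> j) = (\<Sum>\<mu>\<in>keys p. if \<mu> = \<nu> then lookup p \<mu> else 0)"
    unfolding chart_sum[OF assms] coeff_sum
  proof (rule sum.cong[OF refl])
    fix \<mu>
    have "mdeg \<mu> = mdeg \<nu> \<and> lookup \<mu> j = lookup \<nu> j \<longleftrightarrow> \<mu> = \<nu>"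
      using two_eqI[OF assms, of \<mu> \<nu>] by (auto simp: mdeg_two'[OF assms])
    then show "coeff (coeff (monom (monom (lookup p \<mu>) (lookup \<mu> j)) (mdeg \<mu>)) (mdeg \<nu>)) (lookup \<nu> j) =
      (if \<mu> = \<nu> then lookup p \<mu> else 0)" by auto
  qed
  also have "\<dots> = lookup p \<nu>" by (simp add: in_keys_iff)
  finally show ?thesis .
qed

lemma other_index: obtains j :: 2 where "i \<noteq> j"
  by (cases "i = 0") (auto intro: that[of 1] that[of 0])

lemma chart_inj: "chart i p = chart i q \<Longrightarrow> p = q"
proof -
  assume eq: "chart i p = chart i q"
  obtain j where j: "i \<noteq> j" by (rule other_index)
  show ?thesis
  proof (rule poly_mapping_eqI)
    fix \<nu>
    show "lookup p \<nu> = lookup q \<nu>"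
      using coeff_chart[OF j, of p \<nu>] coeff_chart[OF j, of q \<nu>] unfolding eq by simp
  qed
qed

lemma chart_eq_0_iff: "chart i p = 0 \<longleftrightarrow> p = 0"
  using chart_inj[of i p 0] by auto

lemma chart_MVar: "chart i (MVar i) = monom 1 1"
proof -
  obtain j where j: "i \<noteq> j" by (rule other_index)
  then show ?thesis unfolding MVar_def chart_single[OF j] by (simp add: lookup_single when_def monom_0)
qed

lemma chart_form:
  assumes "p \<in> forms (int D)"
  shows "chart i p = monom (coeff (chart i p) D) D"
proof -
  obtain j where j: "i \<noteq> j" by (rule other_index)
  have deg: "mdeg \<mu> = D" if "\<mu> \<in> keys p" for \<mu> using formsD[OF assms that] by simp
  have "chart i p = (\<Sum>\<mu>\<in>keys p. monom (monom (lookup p \<mu>) (lookup \<mu> j)) D)"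
    unfolding chart_sum[OF j] by (intro sum.cong) (auto simp: deg)
  also have "\<dots> = monom (\<Sum>\<mu>\<in>keys p. monom (lookup p \<mu>) (lookup \<mu> j)) D"
    by (induction "keys p" rule: infinite_finite_induct) (auto simp: monom_sum)
  finally have "chart i p = monom (\<Sum>\<mu>\<in>keys p. monom (lookup p \<mu>) (lookup \<mu> j)) D" .
  then show ?thesis by simp
qed

lemma chart_almost_surj:
  fixes u :: "'k::field poly poly"
  shows "\<exists>M0. \<forall>M\<ge>M0. \<exists>y. chart i y = monom 1 M * u"
proof -
  define Q where "Q u \<longleftrightarrow> (\<exists>M0. \<forall>M\<ge>M0. \<exists>y. chart i y = monom 1 M * u)" for u :: "'k poly poly"
  obtain j where j: "i \<noteq> j" by (rule other_index)
  have zero: "Q 0" unfolding Q_def by (auto intro!: exI[of _ 0])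
  have add: "Q (u + v)" if uv: "Q u" "Q v" for u v
  proof -
    obtain M1 M2 where M: "\<And>M. M \<ge> M1 \<Longrightarrow> \<exists>y. chart i y = monom 1 M * u" "\<And>M. M \<ge> M2 \<Longrightarrow> \<exists>y. chart i y = monom 1 M * v"
      using uv unfolding Q_def by blast
    have "\<exists>y. chart i y = monom 1 M * (u + v)" if MM: "M \<ge> max M1 M2" for M
    proof -
      obtain y y' where "chart i y = monom 1 M * u" "chart i y' = monom 1 M * v"
        using M[of M] MM by auto
      then show ?thesis by (intro exI[of _ "y + y'"]) (simp add: chart.hom_add distrib_left)
    qed
    then show ?thesis unfolding Q_def by blast
  qed
  have sum: "Q (sum h A)" if "\<And>a. a \<in> A \<Longrightarrow> Q (h a)" for h and A :: "nat set"
    using that by (induction A rule: infinite_finite_induct) (auto intro: zero add)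
  have mon: "Q (monom (monom c e) D)" for c e D
    unfolding Q_def
  proof (rule exI[of _ e], intro allI impI)
    fix M :: nat assume M: "e \<le> M"
    let ?\<mu> = "single i (D + M - e) + single j e"
    have "mdeg ?\<mu> = M + D" "lookup ?\<mu> j = e" using M j by (auto simp: mdeg_add lookup_add lookup_single)
    then have "chart i (single ?\<mu> c) = monom 1 M * monom (monom c e) D"
      by (simp add: chart_single[OF j] mult_monom)
    then show "\<exists>y. chart i y = monom 1 M * monom (monom c e) D" by blast
  qed
  have "Q (monom p D)" for p D
  proof -
    have "monom p D = (\<Sum>e\<le>degree p. monom (monom (coeff p e) e) D)"
      using poly_as_sum_of_monoms[of p] by (simp add: monom_sum[symmetric])
    then show ?thesis using sum[of "{..degree p}"] mon by simp
  qed
  then have "Q (\<Sum>D\<le>degree u. monom (coeff u D) D)" by (intro sum)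
  then show ?thesis by (simp add: poly_as_sum_of_monoms Q_def)
qed

lemma chart_lift:
  obtains M y where "chart i y = monom 1 M * u"
  using chart_almost_surj[of i u] by blast

text \<open>The ring \<open>k[t]\<close> is a principal ideal domain: an element of least degree in the ideal divides all
generators, and a nonconstant divisor of least degree of that element is prime.\<close>

lemma prime_common_factor:
  fixes F :: "nat \<Rightarrow> 'k::field poly"
  assumes nz: "\<exists>l<n. F l \<noteq> 0" and no_unit: "\<nexists>c. 1 = (\<Sum>l<n. c l * F l)"
  obtains \<pi> where "prime_elem \<pi>" "\<And>l. l < n \<Longrightarrow> \<pi> dvd F l"
proof -
  let ?S = "{\<Sum>l<n. c l * F l | c. True}"
  have gen: "F l \<in> ?S" if "l < n" for l
  proof -
    have "F l = (\<Sum>i<n. (if i = l then 1 else 0) * F i)"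
      using that by (subst sum.cong[OF refl, of _ _ "\<lambda>i. if i = l then F i else 0"]) auto
    then show ?thesis by (intro CollectI exI[of _ "\<lambda>i. if i = l then 1 else 0"] conjI TrueI)
  qed
  obtain h where h: "h \<in> ?S" "h \<noteq> 0" "\<And>h'. h' \<in> ?S \<Longrightarrow> h' \<noteq> 0 \<Longrightarrow> degree h \<le> degree h'"
    using ex_has_least_nat[of "\<lambda>h. h \<in> ?S \<and> h \<noteq> 0" _ degree] nz gen by (metis (no_types, lifting))
  have dvd: "h dvd F l" if l: "l < n" for l
  proof (rule ccontr)
    assume "\<not> h dvd F l"
    then have nz: "F l mod h \<noteq> 0" by (simp add: dvd_eq_mod_eq_0)
    obtain c where c: "h = (\<Sum>l<n. c l * F l)" using h(1) by blast
    obtain e where e: "F l = (\<Sum>l<n. e l * F l)" using gen[OF l] by blast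
    have "(\<Sum>k<n. (e k - F l div h * c k) * F k) = (\<Sum>k<n. e k * F k) - (F l div h) * (\<Sum>k<n. c k * F k)"
      by (simp add: sum_distrib_left sum_subtractf left_diff_distrib mult.assoc)
    also have "\<dots> = F l - (F l div h) * h" by (simp only: e[symmetric] c[symmetric])
    also have "\<dots> = F l mod h" by (rule minus_div_mult_eq_mod)
    finally have "F l mod h = (\<Sum>k<n. (e k - F l div h * c k) * F k)" ..
    then have "F l mod h \<in> ?S"
      by (intro CollectI exI[of _ "\<lambda>k. e k - F l div h * c k"] conjI TrueI)
    with h(3) nz have "degree h \<le> degree (F l mod h)" by blast
    moreover have "degree (F l mod h) < degree h" using degree_mod_less[OF h(2), of "F l"] nz by auto
    ultimately show False by simp
  qed
  have nu: "\<not> is_unit h"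
  proof
    assume "is_unit h"
    then obtain k where k: "1 = h * k" by (auto elim: dvdE)
    obtain c where c: "h = (\<Sum>l<n. c l * F l)" using h(1) by blast
    have "1 = (\<Sum>l<n. (k * c l) * F l)"
      using k unfolding c by (simp add: sum_distrib_left mult_ac)
    then have "\<exists>c. 1 = (\<Sum>l<n. c l * F l)" by (rule exI[of _ "\<lambda>l. k * c l"])
    with no_unit show False by blast
  qed
  obtain \<pi> where \<pi>: "\<pi> dvd h" "\<not> is_unit \<pi>" "\<And>q. q dvd h \<Longrightarrow> \<not> is_unit q \<Longrightarrow> degree \<pi> \<le> degree q"
    using ex_has_least_nat[of "\<lambda>q. q dvd h \<and> \<not> is_unit q" h degree] nu by auto
  have "\<pi> \<noteq> 0" using \<pi>(1) h(2) by auto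
  have "irreducible \<pi>"
  proof (rule irreducibleI[OF \<open>\<pi> \<noteq> 0\<close> \<pi>(2)])
    fix a b assume ab: "\<pi> = a * b"
    show "is_unit a \<or> is_unit b"
    proof (rule ccontr)
      assume "\<not> ?thesis"
      then have nu: "\<not> is_unit a" "\<not> is_unit b" by auto
      have "a \<noteq> 0" "b \<noteq> 0" using ab \<open>\<pi> \<noteq> 0\<close> by auto
      have "a dvd h" using ab \<pi>(1) by (metis dvd_mult_left)
      then have "degree \<pi> \<le> degree a" using \<pi>(3) nu by auto
      moreover have "degree \<pi> = degree a + degree b" using ab \<open>a \<noteq> 0\<close> \<open>b \<noteq> 0\<close> by (simp add: degree_mult_eq)
      ultimately have "degree b = 0" by simp
      then show False using nu \<open>b \<noteq> 0\<close> by (simp add: is_unit_iff_degree)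
    qed
  qed
  then have "prime_elem \<pi>" by (rule field_poly_irreducible_imp_prime)
  then show ?thesis using dvd \<pi>(1) by (intro that) (auto intro: dvd_trans)
qed

lemma const_poly_dvd_monom_mult:
  fixes \<pi> :: "'k::field poly"
  assumes \<pi>: "prime_elem \<pi>" and dvd: "[:\<pi>:] dvd monom 1 M * u"
  shows "[:\<pi>:] dvd u"
proof -
  have p: "prime_elem [:\<pi>:]" using \<pi> by (simp add: prime_elem_const_poly_iff)
  have "\<not> [:\<pi>:] dvd monom 1 M"
  proof
    assume "[:\<pi>:] dvd monom 1 M"
    then have "\<pi> dvd coeff (monom 1 M) M" unfolding const_poly_dvd_iff by blast
    then show False using \<pi> by (auto simp: prime_elem_def)
  qed
  then show ?thesis using prime_elem_dvd_mult_iff[OF p] dvd by blast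
qed

text \<open>The homogeneous prime of the lines through the origin on which \<open>t\<close> is a root of \<open>\<pi>\<close>.\<close>

definition cone_prime :: "2 \<Rightarrow> 'k::field poly \<Rightarrow> 'k plane_ring set" where
  "cone_prime i \<pi> = {q. [:\<pi>:] dvd chart i q}"

lemma MVar_power_not_cone_prime:
  assumes \<pi>: "prime_elem \<pi>" shows "MVar i ^ M \<notin> cone_prime i \<pi>"
proof
  assume "MVar i ^ M \<in> cone_prime i \<pi>"
  then have "[:\<pi>:] dvd monom 1 M * 1"
    by (simp add: cone_prime_def chart.hom_power chart_MVar monom_power)
  from const_poly_dvd_monom_mult[OF \<pi> this] have "\<pi> dvd coeff 1 0" unfolding const_poly_dvd_iff by blast
  then show False using \<pi> by (simp add: prime_elem_def)
qed

lemma primeideal_cone_prime: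
  assumes \<pi>: "prime_elem \<pi>"
  shows "primeideal (cone_prime i \<pi>) class_ring"
proof (rule primeidealI)
  show "ideal (cone_prime i \<pi>) class_ring"
    unfolding ideal_subring_record_iff[OF subring_closed_UNIV] cone_prime_def
    by (auto simp: chart.hom_add chart.hom_mult)
  show "cring (class_ring :: 'a plane_ring ring)" by (rule cring_subring_record[OF subring_closed_UNIV])
  show "carrier class_ring \<noteq> cone_prime i \<pi>"
    using MVar_power_not_cone_prime[OF \<pi>, of i 0] by auto
  fix a b :: "'a plane_ring" assume "a \<otimes>\<^bsub>class_ring\<^esub> b \<in> cone_prime i \<pi>"
  then have "[:\<pi>:] dvd chart i a * chart i b" by (simp add: cone_prime_def chart.hom_mult)
  moreover have "prime_elem [:\<pi>:]" using \<pi> by (simp add: prime_elem_const_poly_iff)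
  ultimately show "a \<in> cone_prime i \<pi> \<or> b \<in> cone_prime i \<pi>"
    unfolding cone_prime_def using prime_elem_dvd_multD by blast
qed

lemma primeideal_class_ringD:
  fixes Q :: "'a::comm_ring_1 set"
  assumes "primeideal Q class_ring"
  shows "0 \<in> Q" "x \<in> Q \<Longrightarrow> a * x \<in> Q" "a * b \<in> Q \<Longrightarrow> a \<in> Q \<or> b \<in> Q"
proof -
  interpret primeideal Q class_ring by fact
  have "ideal Q class_ring" by (rule is_ideal)
  then show "0 \<in> Q" "x \<in> Q \<Longrightarrow> a * x \<in> Q"
    unfolding ideal_subring_record_iff[OF subring_closed_UNIV] by auto
  show "a * b \<in> Q \<Longrightarrow> a \<in> Q \<or> b \<in> Q" using I_prime[of a b] by simp
qed

text \<open>Up to powers of \<open>x\<^sub>i\<close> the prime is generated by one element \<open>pp\<close>, a power of \<open>x\<^sub>i\<close> times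
the homogenization of \<open>\<pi>\<close>. Take a nonzero element of \<open>Q\<close> with the smallest possible degree in \<open>t\<close> of its leading coefficient. It is
divisible by \<open>\<pi>\<close>; the cofactor has smaller degree, so it is not in \<open>Q\<close>, and \<open>pp\<close> is. Then all multiples of
\<open>pp\<close> are in \<open>Q\<close>, and \<open>x\<^sub>i\<close> is not, so \<open>Q\<close> is the whole prime.\<close>

lemma prime_in_cone_prime:
  fixes \<pi> :: "'k::field poly"
  assumes \<pi>: "prime_elem \<pi>" and Q: "primeideal Q class_ring" "Q \<subseteq> cone_prime i \<pi>" and nz: "q0 \<in> Q" "q0 \<noteq> 0"
  shows "Q = cone_prime i \<pi>"
proof -
  have \<pi>0: "\<pi> \<noteq> 0" using \<pi> by (auto simp: prime_elem_def)
  have deg\<pi>: "degree \<pi> > 0"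
    using \<pi> is_unit_iff_degree[OF \<pi>0] by (auto simp: prime_elem_def)
  define \<mu> where "\<mu> q = degree (lead_coeff (chart i q))" for q :: "'k plane_ring"
  obtain q where q: "q \<in> Q" "q \<noteq> 0" "\<And>q'. q' \<in> Q \<Longrightarrow> q' \<noteq> 0 \<Longrightarrow> \<mu> q \<le> \<mu> q'"
    using ex_has_least_nat[of "\<lambda>q. q \<in> Q \<and> q \<noteq> 0" q0 \<mu>] nz by blast
  obtain a pp where pp: "chart i pp = monom 1 a * [:\<pi>:]" by (rule chart_lift)
  have "[:\<pi>:] dvd chart i q" using q(1) Q(2) by (auto simp: cone_prime_def)
  then obtain u where u: "chart i q = [:\<pi>:] * u" by (auto elim: dvdE)
  obtain b u' where u': "chart i u' = monom 1 b * u" by (rule chart_lift)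
  have X: "chart i (MVar i ^ k) = monom 1 k" for k
    by (simp add: chart.hom_power chart_MVar monom_power)
  have "MVar i ^ (a + b) * q = pp * u'"
    by (rule chart_inj[of i]) (simp add: power_add chart.hom_mult X pp u u' mult_ac)
  then have "pp * u' \<in> Q" using primeideal_class_ringD(2)[OF Q(1) q(1)] by metis
  moreover have "u' \<notin> Q"
  proof
    assume "u' \<in> Q"
    have u0: "u \<noteq> 0" using u q(2) chart_eq_0_iff[of i q] by auto
    have "u' \<noteq> 0" using u' u0 chart_eq_0_iff[of i u'] by auto
    then have "\<mu> q \<le> \<mu> u'" using q(3) \<open>u' \<in> Q\<close> by blast
    moreover have "\<mu> u' = degree (lead_coeff u)" unfolding \<mu>_def u' by (simp add: lead_coeff_mult degree_monom_eq)
    moreover have "\<mu> q = degree \<pi> + degree (lead_coeff u)"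
      unfolding \<mu>_def u using \<pi>0 u0 by (simp add: lead_coeff_mult degree_mult_eq)
    ultimately show False using deg\<pi> by simp
  qed
  ultimately have ppQ: "pp \<in> Q" using primeideal_class_ringD(3)[OF Q(1)] by blast
  have "y \<in> Q" if y: "y \<in> cone_prime i \<pi>" for y
  proof -
    obtain v where v: "chart i y = [:\<pi>:] * v" using y by (auto simp: cone_prime_def elim: dvdE)
    obtain c v' where v': "chart i v' = monom 1 c * v" by (rule chart_lift)
    have "MVar i ^ (a + c) * y = v' * pp"
      by (rule chart_inj[of i]) (simp add: power_add chart.hom_mult X pp v v' mult_ac)
    then have "MVar i ^ (a + c) * y \<in> Q" using primeideal_class_ringD(2)[OF Q(1) ppQ, of v'] by simp
    then show "y \<in> Q"
      using primeideal_class_ringD(3)[OF Q(1)] MVar_power_not_cone_prime[OF \<pi>, of i "a + c"] Q(2) by blast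
  qed
  then show ?thesis using Q(2) by blast
qed

lemma height_cone_prime:
  fixes \<pi> :: "'k::field poly"
  assumes \<pi>: "prime_elem \<pi>"
  shows "prime_height class_ring (cone_prime i \<pi>) \<le> 1"
  unfolding prime_height_def
proof (rule Sup_least)
  fix x assume "x \<in> {enat k |k. \<exists>Q. Q k = cone_prime i \<pi> \<and> (\<forall>i\<le>k. primeideal (Q i) class_ring) \<and> (\<forall>i<k. Q i \<subset> Q (Suc i))}"
  then obtain k Q where x: "x = enat k" and Q: "Q k = cone_prime i \<pi>" "\<And>i. i \<le> k \<Longrightarrow> primeideal (Q i) class_ring"
    "\<And>i. i < k \<Longrightarrow> Q i \<subset> Q (Suc i)" by blast
  have "k \<le> 1"
  proof (rule ccontr)
    assume "\<not> k \<le> 1"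
    then obtain j where k: "k = Suc (Suc j)" by (metis One_nat_def le_SucI not_less_eq_eq old.nat.exhaust order_refl)
    have "0 \<in> Q j" using primeideal_class_ringD(1)[OF Q(2)[of j]] k by simp
    moreover obtain q where "q \<in> Q (Suc j)" "q \<notin> Q j" using Q(3)[of j] k by auto
    ultimately have "q \<in> Q (Suc j)" "q \<noteq> 0" by auto
    moreover have "Q (Suc j) \<subset> cone_prime i \<pi>" using Q(3)[of "Suc j"] Q(1) k by simp
    ultimately show False using prime_in_cone_prime[OF \<pi> Q(2)[of "Suc j"], of i q] k by auto
  qed
  then show "x \<le> 1" unfolding x by (simp add: one_enat_def)
qed

text \<open>If the dehomogenized generators had a common prime factor, the ideal would be contained in a cone
prime, which has height at most one. So they generate the unit ideal of \<open>k[t]\<close>, and homogenizing an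
expression of \<open>1\<close> gives a power of \<open>x\<^sub>i\<close>.\<close>

lemma variable_power_in_height_two_ideal:
  fixes f :: "nat \<Rightarrow> 'k::field plane_ring"
  assumes f: "\<And>l. l < n \<Longrightarrow> f l \<in> forms (int D)" and nz: "\<exists>l<n. f l \<noteq> 0"
    and I: "I = Idl\<^bsub>class_ring\<^esub> (f ` {..<n})" and ht: "ideal_height class_ring I = 2"
  obtains N c where "MVar i ^ N = (\<Sum>l<n. c l * f l)"
proof -
  define F where "F l = coeff (chart i (f l)) D" for l
  have F: "chart i (f l) = monom (F l) D" if "l < n" for l
    unfolding F_def by (rule chart_form[OF f[OF that]])
  have Fnz: "\<exists>l<n. F l \<noteq> 0"
    using nz F chart_eq_0_iff by (metis monom_eq_0)
  have "\<exists>c. 1 = (\<Sum>l<n. c l * F l)"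
  proof (rule ccontr)
    assume no: "\<nexists>c. 1 = (\<Sum>l<n. c l * F l)"
    obtain \<pi> where \<pi>: "prime_elem \<pi>" "\<And>l. l < n \<Longrightarrow> \<pi> dvd F l"
      using prime_common_factor[OF Fnz no] by metis
    have "f l \<in> cone_prime i \<pi>" if "l < n" for l
      using \<pi>(2)[OF that] by (auto simp: cone_prime_def F[OF that] const_poly_dvd_iff)
    then have "f ` {..<n} \<subseteq> cone_prime i \<pi>" by auto
    moreover have "ideal (cone_prime i \<pi>) class_ring"
      using primeideal_cone_prime[OF \<pi>(1)] by (rule primeideal.axioms(1))
    moreover have ring: "ring (class_ring :: 'k plane_ring ring)"
      by (rule cring.axioms(1)[OF cring_subring_record[OF subring_closed_UNIV]])
    ultimately have "I \<subseteq> cone_prime i \<pi>"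
      unfolding I by (intro ring.genideal_minimal)
    then have "ideal_height class_ring I \<le> prime_height class_ring (cone_prime i \<pi>)"
      unfolding ideal_height_def using primeideal_cone_prime[OF \<pi>(1)] by (intro Inf_lower) auto
    also have "\<dots> \<le> 1" by (rule height_cone_prime[OF \<pi>(1)])
    finally show False using ht by simp
  qed
  then obtain c where c: "1 = (\<Sum>l<n. c l * F l)" by blast
  have "\<exists>M0. \<forall>M\<ge>M0. \<exists>y. chart i y = monom 1 M * [:c l:]" for l by (rule chart_almost_surj)
  then obtain M0 where M0: "\<And>l M. M \<ge> M0 l \<Longrightarrow> \<exists>y. chart i y = monom 1 M * [:c l:]" by metis
  let ?M = "Max (insert 0 (M0 ` {..<n}))"
  have "\<exists>y. chart i y = monom 1 ?M * [:c l:]" if "l < n" for l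
    using that by (intro M0) auto
  then obtain y where y: "\<And>l. l < n \<Longrightarrow> chart i (y l) = monom 1 ?M * [:c l:]" by metis
  have "chart i (\<Sum>l<n. y l * f l) = (\<Sum>l<n. monom (c l * F l) (?M + D))"
    unfolding chart.hom_sum
  proof (rule sum.cong[OF refl])
    fix l assume "l \<in> {..<n}"
    then show "chart i (y l * f l) = monom (c l * F l) (?M + D)"
      by (simp add: chart.hom_mult y F mult_monom smult_monom mult.commute[of _ "[:c l:]"] mult.assoc)
  qed
  also have "\<dots> = monom (\<Sum>l<n. c l * F l) (?M + D)" by (simp add: monom_sum)
  also have "\<dots> = chart i (MVar i ^ (?M + D))"
    unfolding c[symmetric] by (simp add: chart.hom_power chart_MVar monom_power)
  finally have "MVar i ^ (?M + D) = (\<Sum>l<n. y l * f l)" by (intro chart_inj[of i]) simp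
  then show ?thesis by (rule that)
qed

section \<open>Cokernels and their biduals\<close>

lemma linear_eq_scalar_prod:
  fixes h :: "'a::comm_ring_1 vec \<Rightarrow> 'a"
  assumes add: "\<And>v u. v \<in> carrier_vec n \<Longrightarrow> u \<in> carrier_vec n \<Longrightarrow> h (v + u) = h v + h u"
    and smult: "\<And>a v. v \<in> carrier_vec n \<Longrightarrow> h (a \<cdot>\<^sub>v v) = a * h v"
    and v: "v \<in> carrier_vec n"
  shows "h v = vec n (\<lambda>j. h (unit_vec n j)) \<bullet> v"
proof -
  define t where "t k = vec n (\<lambda>j. if j < k then v $ j else 0)" for k
  have "h (t k) = (\<Sum>j<k. h (unit_vec n j) * v $ j)" if "k \<le> n" for k
    using that
  proof (induction k)
    case 0
    have "t 0 = 0 \<cdot>\<^sub>v 0\<^sub>v n" by (auto simp: t_def)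
    then show ?case using smult[of "0\<^sub>v n" 0] by simp
  next
    case (Suc k)
    have "t (Suc k) = t k + v $ k \<cdot>\<^sub>v unit_vec n k"
      using Suc.prems by (intro eq_vecI) (auto simp: t_def unit_vec_def less_Suc_eq)
    then have "h (t (Suc k)) = h (t k) + v $ k * h (unit_vec n k)"
      using add[of "t k" "v $ k \<cdot>\<^sub>v unit_vec n k"] smult[of "unit_vec n k" "v $ k"] by (simp add: t_def)
    then show ?case using Suc by (simp add: mult.commute)
  qed
  from this[of n] have "h (t n) = vec n (\<lambda>j. h (unit_vec n j)) \<bullet> v"
    using v by (simp add: scalar_prod_def lessThan_atLeast0)
  moreover have "t n = v" using v by (auto simp: t_def)
  ultimately show ?thesis by simp
qed

locale coker_matrix =
  fixes A :: "'a::comm_ring_1 mat" and n m :: nat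
  assumes A_carrier: "A \<in> carrier_mat n m"
begin

abbreviation cls :: "'a vec \<Rightarrow> 'a vec set" where "cls \<equiv> coker_class A"
abbreviation E :: "('a, 'a vec set) module" where "E \<equiv> coker A"

abbreviation F :: "('a, ('a vec set \<Rightarrow> 'a) \<Rightarrow> 'a) module" where "F \<equiv> dual_module (dual_module E)"

lemma dims: "dim_row A = n" "dim_col A = m" using A_carrier by auto

lemma cls_eq: "cls v = {A *\<^sub>v c + v | c. c \<in> carrier_vec m}"
  by (auto simp: coker_class_def col_space_def dims a_r_coset_def r_coset_def module_vec_simps)

lemma Av_carrier: "c \<in> carrier_vec m \<Longrightarrow> A *\<^sub>v c \<in> carrier_vec n"
  using A_carrier by simp

lemma carrier_E: "carrier E = cls ` carrier_vec n"
  by (auto simp: coker_def quotient_module_def A_RCOSETS_def RCOSETS_def coker_class_def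
      a_r_coset_def dims module_vec_simps)

lemma cls_in_E [simp, intro]: "v \<in> carrier_vec n \<Longrightarrow> cls v \<in> carrier E"
  by (auto simp: carrier_E)

lemma cls_eq_iff:
  assumes v: "v \<in> carrier_vec n" "u \<in> carrier_vec n"
  shows "cls v = cls u \<longleftrightarrow> (\<exists>c\<in>carrier_vec m. v = A *\<^sub>v c + u)"
proof
  assume eq: "cls v = cls u"
  have "A *\<^sub>v 0\<^sub>v m + v \<in> cls v" unfolding cls_eq by (auto intro!: exI[of _ "0\<^sub>v m"])
  moreover have "A *\<^sub>v 0\<^sub>v m + v = v" using A_carrier v by auto
  ultimately have "v \<in> cls u" using eq by simp
  then show "\<exists>c\<in>carrier_vec m. v = A *\<^sub>v c + u" unfolding cls_eq by auto
next
  assume "\<exists>c\<in>carrier_vec m. v = A *\<^sub>v c + u"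
  then obtain c where c: "c \<in> carrier_vec m" "v = A *\<^sub>v c + u" by blast
  show "cls v = cls u"
    unfolding cls_eq
  proof (intro equalityI subsetI)
    fix x assume "x \<in> {A *\<^sub>v c + v |c. c \<in> carrier_vec m}"
    then obtain e where e: "x = A *\<^sub>v e + v" "e \<in> carrier_vec m" by blast
    have "x = A *\<^sub>v (e + c) + u"
      unfolding e(1) c(2) using mult_add_distrib_mat_vec[OF A_carrier e(2) c(1)] Av_carrier[OF e(2)] Av_carrier[OF c(1)] v
      by (simp add: assoc_add_vec[of _ n])
    then show "x \<in> {A *\<^sub>v c + u |c. c \<in> carrier_vec m}" using e c by auto
  next
    fix x assume "x \<in> {A *\<^sub>v c + u |c. c \<in> carrier_vec m}"
    then obtain e where e: "x = A *\<^sub>v e + u" "e \<in> carrier_vec m" by blast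
    have "A *\<^sub>v (e - c) = A *\<^sub>v e - A *\<^sub>v c" by (rule mult_minus_distrib_mat_vec[OF A_carrier e(2) c(1)])
    then have "x = A *\<^sub>v (e - c) + v"
      unfolding e(1) c(2) using v by (intro eq_vecI) (auto simp: dims simp del: index_mult_mat_vec)
    then show "x \<in> {A *\<^sub>v c + v |c. c \<in> carrier_vec m}" using e c by auto
  qed
qed

lemma cls_zero_iff: "v \<in> carrier_vec n \<Longrightarrow> cls v = cls (0\<^sub>v n) \<longleftrightarrow> v \<in> col_space A"
  using cls_eq_iff[of v "0\<^sub>v n"] Av_carrier by (auto simp: col_space_def dims)

lemma add_E:
  assumes "v \<in> carrier_vec n" "u \<in> carrier_vec n"
  shows "cls v \<oplus>\<^bsub>E\<^esub> cls u = cls (v + u)"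
proof -
  have "cls v \<oplus>\<^bsub>E\<^esub> cls u = {x + y | x y. x \<in> cls v \<and> y \<in> cls u}"
    by (auto simp: coker_def quotient_module_def set_add_def set_mult_def module_vec_simps)
  also have "\<dots> = cls (v + u)"
  proof (intro equalityI subsetI)
    fix x assume "x \<in> {x + y | x y. x \<in> cls v \<and> y \<in> cls u}"
    then obtain c e where ce: "x = (A *\<^sub>v c + v) + (A *\<^sub>v e + u)" "c \<in> carrier_vec m" "e \<in> carrier_vec m"
      unfolding cls_eq by blast
    have "x = A *\<^sub>v (c + e) + (v + u)"
      unfolding ce(1) mult_add_distrib_mat_vec[OF A_carrier ce(2,3)] using assms
      by (intro eq_vecI) (auto simp: dims simp del: index_mult_mat_vec)
    then show "x \<in> cls (v + u)" unfolding cls_eq using ce by auto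
  next
    fix x assume "x \<in> cls (v + u)"
    then obtain c where c: "x = A *\<^sub>v c + (v + u)" "c \<in> carrier_vec m" unfolding cls_eq by blast
    have "x = (A *\<^sub>v c + v) + (A *\<^sub>v 0\<^sub>v m + u)"
      unfolding c(1) using Av_carrier[OF c(2)] assms A_carrier by (intro eq_vecI) auto
    then show "x \<in> {x + y | x y. x \<in> cls v \<and> y \<in> cls u}" unfolding cls_eq using c zero_carrier_vec[of m] by blast
  qed
  finally show ?thesis .
qed

lemma smult_E:
  assumes "v \<in> carrier_vec n"
  shows "a \<odot>\<^bsub>E\<^esub> cls v = cls (a \<cdot>\<^sub>v v)"
proof -
  have "a \<odot>\<^bsub>E\<^esub> cls v = (\<Union>x\<in>cls v. cls (a \<cdot>\<^sub>v x))"
    by (simp add: coker_def quotient_module_def coker_class_def module_vec_simps)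
  also have "\<dots> = cls (a \<cdot>\<^sub>v v)"
  proof -
    have "cls (a \<cdot>\<^sub>v x) = cls (a \<cdot>\<^sub>v v)" if x: "x \<in> cls v" for x
    proof -
      obtain c where c: "x = A *\<^sub>v c + v" "c \<in> carrier_vec m" using x unfolding cls_eq by blast
      have "a \<cdot>\<^sub>v x = A *\<^sub>v (a \<cdot>\<^sub>v c) + a \<cdot>\<^sub>v v"
        unfolding c(1) mult_mat_smult_vec[OF A_carrier c(2)]
        using Av_carrier[OF c(2)] assms by (simp add: smult_add_distrib_vec[of _ n])
      then have "\<exists>e\<in>carrier_vec m. a \<cdot>\<^sub>v x = A *\<^sub>v e + a \<cdot>\<^sub>v v"
        by (rule bexI) (use c(2) in simp)
      moreover have "x \<in> carrier_vec n"
        unfolding c(1) using Av_carrier[OF c(2)] assms by (rule add_carrier_vec)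
      ultimately show ?thesis
        using cls_eq_iff[of "a \<cdot>\<^sub>v x" "a \<cdot>\<^sub>v v"] assms unfolding smult_carrier_vec by blast
    qed
    moreover have "cls v \<noteq> {}" unfolding cls_eq using zero_carrier_vec[of m] by blast
    ultimately show ?thesis by blast
  qed
  finally show ?thesis .
qed

text \<open>By the universal property of the cokernel, these row vectors are its functionals.\<close>

definition W :: "'a vec set" where
  "W = {y \<in> carrier_vec n. \<forall>c\<in>carrier_vec m. y \<bullet> (A *\<^sub>v c) = 0}"

definition functional :: "'a vec \<Rightarrow> 'a vec set \<Rightarrow> 'a" where
  "functional y = (\<lambda>X\<in>carrier E. y \<bullet> (SOME v. v \<in> carrier_vec n \<and> X = cls v))"

lemma functional_cls:
  assumes y: "y \<in> W" and v: "v \<in> carrier_vec n"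
  shows "functional y (cls v) = y \<bullet> v"
proof -
  define u where "u = (SOME u. u \<in> carrier_vec n \<and> cls v = cls u)"
  have u: "u \<in> carrier_vec n \<and> cls v = cls u"
    unfolding u_def by (rule someI[of "\<lambda>u. u \<in> carrier_vec n \<and> cls v = cls u" v]) (simp add: v)
  then obtain c where c: "c \<in> carrier_vec m" "v = A *\<^sub>v c + u" using cls_eq_iff[OF v, of u] by blast
  have "y \<bullet> v = y \<bullet> (A *\<^sub>v c + u)" by (rule arg_cong[OF c(2)])
  also have "\<dots> = y \<bullet> (A *\<^sub>v c) + y \<bullet> u"
    using y u Av_carrier[OF c(1)] by (intro scalar_prod_add_distrib[of _ n]) (auto simp: W_def)
  also have "\<dots> = y \<bullet> u" using y c(1) by (simp add: W_def)
  finally show ?thesis using v by (simp add: functional_def u_def)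
qed

lemma regular_simps [simp]:
  "carrier regular_module = UNIV" "a \<oplus>\<^bsub>regular_module\<^esub> b = a + b" "a \<odot>\<^bsub>regular_module\<^esub> b = a * b"
  by (simp_all add: regular_module_def)

lemma dual_simps [simp]:
  "carrier (dual_module M) = module_hom class_ring M regular_module \<inter> extensional (carrier M)"
  "f \<oplus>\<^bsub>dual_module M\<^esub> h = (\<lambda>x\<in>carrier M. f x + h x)"
  "a \<odot>\<^bsub>dual_module M\<^esub> f = (\<lambda>x\<in>carrier M. a * f x)"
  by (simp_all add: dual_module_def)

lemma functional_dual:
  assumes y: "y \<in> W" shows "functional y \<in> carrier (dual_module E)"
proof -
  have yc: "y \<in> carrier_vec n" using y by (simp add: W_def)
  have "functional y \<in> extensional (carrier E)" by (simp add: functional_def)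
  moreover have "functional y \<in> module_hom class_ring E regular_module"
    unfolding module_hom_def
    by (auto simp: carrier_E add_E smult_E functional_cls[OF y] scalar_prod_add_distrib[OF yc] scalar_prod_smult_distrib[OF yc])
  ultimately show ?thesis by simp
qed

lemma dual_functional:
  assumes f: "f \<in> carrier (dual_module E)"
  obtains y where "y \<in> W" "f = functional y"
proof -
  define y where "y = vec n (\<lambda>j. f (cls (unit_vec n j)))"
  have add: "f (cls (v + u)) = f (cls v) + f (cls u)" if "v \<in> carrier_vec n" "u \<in> carrier_vec n" for v u
    using f that add_E[OF that] by (auto simp: module_hom_def) (metis cls_in_E)
  have smult: "f (cls (a \<cdot>\<^sub>v v)) = a * f (cls v)" if "v \<in> carrier_vec n" for a v
    using f that smult_E[OF that, of a] by (auto simp: module_hom_def) (metis cls_in_E)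
  have fv: "f (cls v) = y \<bullet> v" if v: "v \<in> carrier_vec n" for v
    unfolding y_def by (rule linear_eq_scalar_prod[of n "\<lambda>v. f (cls v)"]) (use add smult v in auto)
  have y: "y \<in> W"
    unfolding W_def
  proof (intro CollectI conjI ballI)
    show "y \<in> carrier_vec n" by (simp add: y_def)
    fix c :: "'a vec" assume c: "c \<in> carrier_vec m"
    have "cls (A *\<^sub>v c) = cls (0\<^sub>v n)"
      using cls_zero_iff[OF Av_carrier[OF c]] c by (auto simp: col_space_def dims)
    then have "y \<bullet> (A *\<^sub>v c) = y \<bullet> 0\<^sub>v n" using fv[OF Av_carrier[OF c]] fv[of "0\<^sub>v n"] by simp
    then show "y \<bullet> (A *\<^sub>v c) = 0" by (simp add: y_def)
  qed
  have "f = functional y"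
  proof (rule extensionalityI)
    show "f \<in> extensional (carrier E)" using f by simp
    show "functional y \<in> extensional (carrier E)" by (simp add: functional_def)
    fix X assume "X \<in> carrier E"
    then show "f X = functional y X" using fv functional_cls[OF y] by (auto simp: carrier_E)
  qed
  with y show ?thesis by (rule that)
qed

lemma functional_add: "y \<in> W \<Longrightarrow> z \<in> W \<Longrightarrow> functional (y + z) = functional y \<oplus>\<^bsub>dual_module E\<^esub> functional z"
  and W_add: "y \<in> W \<Longrightarrow> z \<in> W \<Longrightarrow> y + z \<in> W"
proof -
  assume yz: "y \<in> W" "z \<in> W"
  then have c: "y \<in> carrier_vec n" "z \<in> carrier_vec n" by (auto simp: W_def)
  show W: "y + z \<in> W"
    using yz c add_scalar_prod_distrib[OF c Av_carrier] by (auto simp: W_def)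
  show "functional (y + z) = functional y \<oplus>\<^bsub>dual_module E\<^esub> functional z"
  proof (rule extensionalityI[of _ "carrier E"])
    show "functional (y + z) \<in> extensional (carrier E)" by (simp add: functional_def)
    show "functional y \<oplus>\<^bsub>dual_module E\<^esub> functional z \<in> extensional (carrier E)" by simp
    fix X assume "X \<in> carrier E"
    then show "functional (y + z) X = (functional y \<oplus>\<^bsub>dual_module E\<^esub> functional z) X"
      using add_scalar_prod_distrib[OF c] by (auto simp: carrier_E functional_cls W yz)
  qed
qed

lemma functional_smult: "y \<in> W \<Longrightarrow> functional (a \<cdot>\<^sub>v y) = a \<odot>\<^bsub>dual_module E\<^esub> functional y"
  and W_smult: "y \<in> W \<Longrightarrow> a \<cdot>\<^sub>v y \<in> W"
proof -
  assume y: "y \<in> W"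
  then have c: "y \<in> carrier_vec n" by (auto simp: W_def)
  show W: "a \<cdot>\<^sub>v y \<in> W"
    using y c smult_scalar_prod_distrib[OF c Av_carrier] by (auto simp: W_def)
  show "functional (a \<cdot>\<^sub>v y) = a \<odot>\<^bsub>dual_module E\<^esub> functional y"
  proof (rule extensionalityI[of _ "carrier E"])
    show "functional (a \<cdot>\<^sub>v y) \<in> extensional (carrier E)" by (simp add: functional_def)
    show "a \<odot>\<^bsub>dual_module E\<^esub> functional y \<in> extensional (carrier E)" by simp
    fix X assume "X \<in> carrier E"
    then show "functional (a \<cdot>\<^sub>v y) X = (a \<odot>\<^bsub>dual_module E\<^esub> functional y) X"
      using smult_scalar_prod_distrib[OF c] by (auto simp: carrier_E functional_cls W y)
  qed
qed

lemma to_bidual_functional: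
  "y \<in> W \<Longrightarrow> v \<in> carrier_vec n \<Longrightarrow> to_bidual E (cls v) (functional y) = y \<bullet> v"
  using functional_dual[of y] by (simp add: to_bidual_def functional_cls del: dual_simps)

lemma to_bidual_in:
  assumes v: "v \<in> carrier_vec n" shows "to_bidual E (cls v) \<in> carrier F"
proof -
  have "to_bidual E (cls v) \<in> extensional (carrier (dual_module E))" by (simp add: to_bidual_def)
  moreover have "to_bidual E (cls v) \<in> module_hom class_ring (dual_module E) regular_module"
    unfolding module_hom_def
  proof (intro CollectI conjI allI impI)
    show "to_bidual E (cls v) \<in> carrier (dual_module E) \<rightarrow> carrier regular_module" by simp
    fix f h assume "f \<in> carrier (dual_module E) \<and> h \<in> carrier (dual_module E)"
    then obtain y z where yz: "y \<in> W" "f = functional y" "z \<in> W" "h = functional z" by (metis dual_functional)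
    then have "y \<in> carrier_vec n" "z \<in> carrier_vec n" by (auto simp: W_def)
    then show "to_bidual E (cls v) (f \<oplus>\<^bsub>dual_module E\<^esub> h) =
      to_bidual E (cls v) f \<oplus>\<^bsub>regular_module\<^esub> to_bidual E (cls v) h"
      unfolding yz functional_add[OF yz(1,3), symmetric]
      using v add_scalar_prod_distrib[of y n z v] by (simp add: to_bidual_functional yz W_add)
  next
    fix a :: 'a and f assume "a \<in> carrier class_ring \<and> f \<in> carrier (dual_module E)"
    then obtain y where y: "y \<in> W" "f = functional y" by (metis dual_functional)
    then have "y \<in> carrier_vec n" by (auto simp: W_def)
    then show "to_bidual E (cls v) (a \<odot>\<^bsub>dual_module E\<^esub> f) = a \<odot>\<^bsub>regular_module\<^esub> to_bidual E (cls v) f"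
      unfolding y functional_smult[OF y(1), symmetric]
      using v smult_scalar_prod_distrib[of y n v a] by (simp add: to_bidual_functional y W_smult)
  qed
  ultimately show ?thesis by (simp add: dual_simps(1)[of "dual_module E"] del: dual_simps)
qed

lemma bidual_eqI:
  assumes "\<omega> \<in> extensional (carrier (dual_module E))" "\<omega>' \<in> extensional (carrier (dual_module E))"
    and "\<And>y. y \<in> W \<Longrightarrow> \<omega> (functional y) = \<omega>' (functional y)"
  shows "\<omega> = \<omega>'"
proof (rule extensionalityI[OF assms(1,2)])
  fix f assume "f \<in> carrier (dual_module E)"
  then obtain y where "y \<in> W" "f = functional y" by (rule dual_functional)
  then show "\<omega> f = \<omega>' f" using assms(3) by simp
qed

lemma bidual_extensional:
  "\<omega> \<in> carrier F \<Longrightarrow> \<omega> \<in> extensional (carrier (dual_module E))"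
  "\<omega> \<oplus>\<^bsub>F\<^esub> \<omega>' \<in> extensional (carrier (dual_module E))"
  "a \<odot>\<^bsub>F\<^esub> \<omega> \<in> extensional (carrier (dual_module E))"
  unfolding dual_simps(1)[of "dual_module E"] dual_simps(2)[where M = "dual_module E"] dual_simps(3)[where M = "dual_module E"]
  by auto

lemma bidual_apply_add:
  assumes "\<omega> \<in> carrier F" "y \<in> W" "z \<in> W"
  shows "\<omega> (functional (y + z)) = \<omega> (functional y) + \<omega> (functional z)"
proof -
  have "\<omega> \<in> module_hom class_ring (dual_module E) regular_module"
    using assms(1) unfolding dual_simps(1)[of "dual_module E"] by auto
  from module_hom_add[OF this functional_dual[OF assms(2)] functional_dual[OF assms(3)]]
  show ?thesis by (simp add: functional_add[OF assms(2,3)] del: dual_simps)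
qed

lemma bidual_apply_smult:
  assumes "\<omega> \<in> carrier F" "y \<in> W"
  shows "\<omega> (functional (a \<cdot>\<^sub>v y)) = a * \<omega> (functional y)"
proof -
  have "\<omega> \<in> module_hom class_ring (dual_module E) regular_module"
    using assms(1) unfolding dual_simps(1)[of "dual_module E"] by auto
  from module_hom_smult[OF this _ functional_dual[OF assms(2)], of a]
  show ?thesis by (simp add: functional_smult[OF assms(2)] del: dual_simps)
qed

lemma bidual_smult_apply:
  "y \<in> W \<Longrightarrow> (a \<odot>\<^bsub>F\<^esub> \<omega>) (functional y) = a * \<omega> (functional y)"
  using functional_dual[of y] unfolding dual_simps(3)[where M = "dual_module E"] by (simp del: dual_simps)

lemma bidual_add_apply:
  "y \<in> W \<Longrightarrow> (\<omega> \<oplus>\<^bsub>F\<^esub> \<omega>') (functional y) = \<omega> (functional y) + \<omega>' (functional y)"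
  using functional_dual[of y] unfolding dual_simps(2)[where M = "dual_module E"] by (simp del: dual_simps)

text \<open>The rows of \<open>c - A \<psi>\<close> kill \<open>A\<close>, and each functional \<open>y\<close> satisfies \<open>c y = y (c - A \<psi>)\<close>. So \<open>c\<close> times a
linear form \<open>\<omega>\<close> on the functionals is evaluation at the vector of its values on these rows.\<close>

lemma bidual_multiple:
  assumes \<psi>: "\<psi> \<in> carrier_mat m n" "\<psi> * A = c \<cdot>\<^sub>m 1\<^sub>m m" and \<omega>: "\<omega> \<in> carrier F"
  obtains v where "v \<in> carrier_vec n" "\<And>y. y \<in> W \<Longrightarrow> c * \<omega> (functional y) = y \<bullet> v"
proof -
  define D where "D = c \<cdot>\<^sub>m 1\<^sub>m n - A * \<psi>"
  have D: "D \<in> carrier_mat n n" using A_carrier \<psi> by (auto simp: D_def)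
  have "A * \<psi> * A = A * (c \<cdot>\<^sub>m 1\<^sub>m m)" using \<psi>(2) assoc_mult_mat[OF A_carrier \<psi>(1) A_carrier] by simp
  also have "\<dots> = c \<cdot>\<^sub>m A" using A_carrier by (simp add: mult_smult_distrib[OF A_carrier, of "1\<^sub>m m" m])
  finally have A\<psi>A: "A * \<psi> * A = c \<cdot>\<^sub>m A" .
  have "D * A = c \<cdot>\<^sub>m 1\<^sub>m n * A - A * \<psi> * A"
    unfolding D_def using A_carrier \<psi> by (intro minus_mult_distrib_mat[of _ n n]) auto
  also have "c \<cdot>\<^sub>m 1\<^sub>m n * A = c \<cdot>\<^sub>m A"
    using A_carrier mult_smult_assoc_mat[of "1\<^sub>m n" n n A m c] by simp
  finally have DA: "D * A = 0\<^sub>m n m" unfolding A\<psi>A using A_carrier by auto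
  have rowW: "row D k \<in> W" if "k < n" for k
    unfolding W_def
  proof (intro CollectI conjI ballI)
    show "row D k \<in> carrier_vec n" using D that by auto
    fix e :: "'a vec" assume e: "e \<in> carrier_vec m"
    have "row D k \<bullet> (A *\<^sub>v e) = (D *\<^sub>v (A *\<^sub>v e)) $ k" using D that by simp
    also have "D *\<^sub>v (A *\<^sub>v e) = (D * A) *\<^sub>v e" using assoc_mult_mat_vec[OF D A_carrier e] by simp
    also have "\<dots> = 0\<^sub>v n" unfolding DA using e by auto
    finally show "row D k \<bullet> (A *\<^sub>v e) = 0" using that by simp
  qed
  define v where "v = vec n (\<lambda>k. \<omega> (functional (row D k)))"
  have "c * \<omega> (functional y) = y \<bullet> v" if y: "y \<in> W" for y
  proof -
    have yc: "y \<in> carrier_vec n" using y by (simp add: W_def)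
    \<comment> \<open>partial sums of \<open>y D\<close>, along which linearity of \<open>\<omega>\<close> is applied\<close>
    define t where "t k = vec n (\<lambda>j. \<Sum>i<k. y $ i * D $$ (i, j))" for k
    have zero: "0\<^sub>v n \<in> W" using Av_carrier by (auto simp: W_def)
    have "t k \<in> W \<and> \<omega> (functional (t k)) = (\<Sum>i<k. y $ i * v $ i)" if "k \<le> n" for k
      using that
    proof (induction k)
      case 0
      have "t 0 = 0\<^sub>v n" by (auto simp: t_def)
      moreover have "0 \<cdot>\<^sub>v 0\<^sub>v n = (0\<^sub>v n :: 'a vec)" by (intro eq_vecI) auto
      then have "\<omega> (functional (0\<^sub>v n)) = 0"
        using bidual_apply_smult[OF \<omega> zero, of 0] by simp
      ultimately show ?case using zero by simp
    next
      case (Suc k)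
      have "t (Suc k) = t k + y $ k \<cdot>\<^sub>v row D k"
        using Suc.prems D by (intro eq_vecI) (auto simp: t_def)
      then show ?case
        using Suc W_add[OF _ W_smult[OF rowW[of k]], of "t k"] bidual_apply_add[OF \<omega> _ W_smult[OF rowW[of k]], of "t k"]
          bidual_apply_smult[OF \<omega> rowW[of k]] by (simp add: v_def)
    qed
    from this[of n] have "\<omega> (functional (t n)) = y \<bullet> v"
      by (simp add: scalar_prod_def lessThan_atLeast0 v_def)
    moreover have "t n = c \<cdot>\<^sub>v y"
    proof (rule eq_vecI)
      fix j assume "j < dim_vec (c \<cdot>\<^sub>v y)"
      then have j: "j < n" using yc by simp
      have colD: "col D j = c \<cdot>\<^sub>v unit_vec n j - A *\<^sub>v (col \<psi> j)"
        using j A_carrier \<psi> by (intro eq_vecI) (auto simp: D_def unit_vec_def)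
      have \<psi>c: "col \<psi> j \<in> carrier_vec m" using \<psi> by auto
      have "t n $ j = y \<bullet> col D j"
        using j D yc by (simp add: t_def scalar_prod_def lessThan_atLeast0)
      also have "\<dots> = y \<bullet> (c \<cdot>\<^sub>v unit_vec n j) - y \<bullet> (A *\<^sub>v col \<psi> j)"
        unfolding colD using yc Av_carrier[OF \<psi>c] by (intro scalar_prod_minus_distrib[of _ n]) auto
      also have "y \<bullet> (A *\<^sub>v col \<psi> j) = 0" using y \<psi>c by (simp add: W_def)
      also have "y \<bullet> (c \<cdot>\<^sub>v unit_vec n j) = c * y $ j" using yc j by (simp add: scalar_prod_smult_distrib[of _ n])
      finally show "t n $ j = (c \<cdot>\<^sub>v y) $ j" using j yc by simp
    qed (use yc in \<open>simp add: t_def\<close>)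
    ultimately show ?thesis using bidual_apply_smult[OF \<omega> y] by simp
  qed
  then show ?thesis by (intro that[of v]) (auto simp: v_def)
qed

end

lemma zero_smult_vec: "v \<in> carrier_vec k \<Longrightarrow> 0 \<cdot>\<^sub>v v = (0\<^sub>v k :: 'a::comm_ring_1 vec)"
  by (intro eq_vecI) auto

lemma scalar_mat_mult_vec:
  "v \<in> carrier_vec k \<Longrightarrow> (c \<cdot>\<^sub>m 1\<^sub>m k) *\<^sub>v v = (c :: 'a::comm_ring_1) \<cdot>\<^sub>v v"
  by (intro eq_vecI) auto

text \<open>The matrices \<open>\<psi> i\<close> say that the inclusion of the column space splits after \<open>x\<^sub>i\<close> is inverted.\<close>

locale bidual_setting = coker_matrix A n m
  for A :: "'k::field plane_ring mat" and n m :: nat +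
  fixes s N :: nat and \<sigma> :: "nat \<Rightarrow> nat" and \<psi> :: "2 \<Rightarrow> 'k plane_ring mat"
    and \<Theta> :: "(('k plane_ring vec set \<Rightarrow> 'k plane_ring) \<Rightarrow> 'k plane_ring) \<Rightarrow> 'k plane_ring vec"
  assumes psi_carrier: "\<psi> i \<in> carrier_mat m n"
    and psi_A: "\<psi> i * A = MVar i ^ N \<cdot>\<^sub>m 1\<^sub>m m"
    and Theta: "graded_iso_to_free (bidual A) (bidual_grading A) s \<sigma> \<Theta>"
begin

abbreviation "\<xi> \<equiv> xi_matrix A s \<Theta>"

definition L :: "'k plane_ring vec \<Rightarrow> 'k plane_ring vec" where
  "L v = \<Theta> (to_bidual E (cls v))"

lemma Theta_hom: "\<Theta> \<in> module_hom class_ring F (module_vec TYPE('k plane_ring) s)"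
  and Theta_bij: "bij_betw \<Theta> (carrier F) (carrier_vec s)"
  and Theta_graded: "\<Theta> ` bidual_grading A j = twisted_free s \<sigma> j"
  using Theta unfolding graded_iso_to_free_def bidual_def by auto

lemma to_bidual_in_F: "v \<in> carrier_vec n \<Longrightarrow> to_bidual E (cls v) \<in> carrier F"
  by (rule to_bidual_in)

lemma Theta_add: "\<omega> \<in> carrier F \<Longrightarrow> \<omega>' \<in> carrier F \<Longrightarrow> \<Theta> (\<omega> \<oplus>\<^bsub>F\<^esub> \<omega>') = \<Theta> \<omega> + \<Theta> \<omega>'"
  using module_hom_add[OF Theta_hom, of \<omega> \<omega>'] by (simp add: module_vec_simps del: dual_simps)

lemma Theta_smult: "\<omega> \<in> carrier F \<Longrightarrow> \<Theta> (a \<odot>\<^bsub>F\<^esub> \<omega>) = a \<cdot>\<^sub>v \<Theta> \<omega>"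
  using module_hom_smult[OF Theta_hom, of a \<omega>] by (simp add: module_vec_simps del: dual_simps)

lemma L_carrier: "v \<in> carrier_vec n \<Longrightarrow> L v \<in> carrier_vec s"
  unfolding L_def using bij_betwE[OF Theta_bij] to_bidual_in_F by blast

lemma L_add:
  assumes v: "v \<in> carrier_vec n" "u \<in> carrier_vec n" shows "L (v + u) = L v + L u"
proof -
  have "to_bidual E (cls (v + u)) = to_bidual E (cls v) \<oplus>\<^bsub>F\<^esub> to_bidual E (cls u)"
  proof (rule bidual_eqI[OF bidual_extensional(1)[OF to_bidual_in_F] bidual_extensional(2)])
    fix y assume y: "y \<in> W"
    then have "y \<in> carrier_vec n" by (simp add: W_def)
    then show "to_bidual E (cls (v + u)) (functional y) = (to_bidual E (cls v) \<oplus>\<^bsub>F\<^esub> to_bidual E (cls u)) (functional y)"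
      using v by (simp add: bidual_add_apply[OF y] to_bidual_functional[OF y] scalar_prod_add_distrib[of _ n] del: dual_simps)
  qed (use v in auto)
  then show ?thesis unfolding L_def using v by (simp add: Theta_add to_bidual_in_F del: dual_simps)
qed

lemma L_smult:
  assumes v: "v \<in> carrier_vec n" shows "L (a \<cdot>\<^sub>v v) = a \<cdot>\<^sub>v L v"
proof -
  have "to_bidual E (cls (a \<cdot>\<^sub>v v)) = a \<odot>\<^bsub>F\<^esub> to_bidual E (cls v)"
  proof (rule bidual_eqI[OF bidual_extensional(1)[OF to_bidual_in_F] bidual_extensional(3)])
    fix y assume y: "y \<in> W"
    then have "y \<in> carrier_vec n" by (simp add: W_def)
    then show "to_bidual E (cls (a \<cdot>\<^sub>v v)) (functional y) = (a \<odot>\<^bsub>F\<^esub> to_bidual E (cls v)) (functional y)"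
      using v by (simp add: bidual_smult_apply[OF y] to_bidual_functional[OF y] scalar_prod_smult_distrib[of _ n] del: dual_simps)
  qed (use v in auto)
  then show ?thesis unfolding L_def using v by (simp add: Theta_smult to_bidual_in_F del: dual_simps)
qed

lemma xi_carrier: "\<xi> \<in> carrier_mat s n"
  by (simp add: xi_matrix_def dims)

lemma xi_mult: assumes v: "v \<in> carrier_vec n" shows "\<xi> *\<^sub>v v = L v"
proof (rule eq_vecI)
  show "dim_vec (\<xi> *\<^sub>v v) = dim_vec (L v)" using xi_carrier L_carrier[OF v] by auto
  fix i assume "i < dim_vec (L v)"
  then have i: "i < s" using L_carrier[OF v] by simp
  have "L v $ i = vec n (\<lambda>j. L (unit_vec n j) $ i) \<bullet> v"
  proof (rule linear_eq_scalar_prod[of n "\<lambda>v. L v $ i", OF _ _ v])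
    fix v u :: "'k plane_ring vec" assume vu: "v \<in> carrier_vec n" "u \<in> carrier_vec n"
    show "L (v + u) $ i = L v $ i + L u $ i"
      unfolding L_add[OF vu] using L_carrier[OF vu(1)] L_carrier[OF vu(2)] i by simp
  next
    fix a and v :: "'k plane_ring vec" assume v: "v \<in> carrier_vec n"
    show "L (a \<cdot>\<^sub>v v) $ i = a * L v $ i" unfolding L_smult[OF v] using L_carrier[OF v] i by simp
  qed
  also have "vec n (\<lambda>j. L (unit_vec n j) $ i) = row \<xi> i"
    using i by (intro eq_vecI) (auto simp: xi_matrix_def dims L_def)
  finally show "(\<xi> *\<^sub>v v) $ i = L v $ i" using i xi_carrier by simp
qed

lemma xi_forms:
  assumes "l < s" "j < n" shows "\<xi> $$ (l, j) \<in> forms (int (\<sigma> l))"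
proof -
  let ?e = "unit_vec n j :: 'k plane_ring vec"
  have "cls ?e \<in> coker_grading A 0"
    unfolding coker_grading_def dims using forms_MConst[of "1::'k"] by (intro imageI) (auto simp: unit_vec_def)
  then have "to_bidual E (cls ?e) f \<in> forms (i + 0)" if "f \<in> dual_grading E (coker_grading A) i" for f i
  proof -
    have "f \<in> carrier (dual_module E)" "f (cls ?e) \<in> forms (0 + i)"
      using that \<open>cls ?e \<in> coker_grading A 0\<close> unfolding dual_grading_def by blast+
    then show ?thesis by (simp add: to_bidual_def del: dual_simps)
  qed
  then have "to_bidual E (cls ?e) \<in> bidual_grading A 0"
    unfolding bidual_grading_def dual_grading_def[of "dual_module E"]
    using to_bidual_in_F[of ?e] by (simp del: dual_simps)
  then have "L ?e \<in> twisted_free s \<sigma> 0" using Theta_graded[of 0] unfolding L_def by blast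
  then have "L ?e $ l \<in> forms (int (\<sigma> l))" using assms(1) by (auto simp: twisted_free_def)
  then show ?thesis using assms by (simp add: xi_matrix_def dims L_def)
qed

text \<open>Torsion-freeness of the cokernel. A vector that all functionals kill is killed by the rows of
\<open>x\<^sub>i\<^sup>N - A \<psi>\<^sub>i\<close>, so \<open>x\<^sub>i\<^sup>N v\<close> is in the column space for both \<open>i\<close>. The two coefficient vectors agree after
multiplication with the powers of the variables, which can therefore be cancelled.\<close>

lemma xi_kernel:
  assumes v: "v \<in> carrier_vec n" and zero: "\<xi> *\<^sub>v v = 0\<^sub>v s"
  obtains c where "c \<in> carrier_vec m" "v = A *\<^sub>v c"
proof -
  have "0 \<cdot>\<^sub>v L (0\<^sub>v n) = L (0 \<cdot>\<^sub>v 0\<^sub>v n)" by (rule L_smult[symmetric]) simp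
  also have "0 \<cdot>\<^sub>v 0\<^sub>v n = (0\<^sub>v n :: 'k plane_ring vec)" by (intro eq_vecI) auto
  finally have "L (0\<^sub>v n) = 0\<^sub>v s" using zero_smult_vec[OF L_carrier[of "0\<^sub>v n"]] by simp
  then have "\<Theta> (to_bidual E (cls v)) = \<Theta> (to_bidual E (cls (0\<^sub>v n)))"
    using zero xi_mult[OF v] by (simp add: L_def)
  then have eq: "to_bidual E (cls v) = to_bidual E (cls (0\<^sub>v n))"
    by (rule inj_onD[OF bij_betw_imp_inj_on[OF Theta_bij] _ to_bidual_in_F[OF v] to_bidual_in_F[OF zero_carrier_vec]])
  have Wv: "y \<bullet> v = 0" if "y \<in> W" for y
  proof -
    have "y \<bullet> v = y \<bullet> 0\<^sub>v n"
      using to_bidual_functional[OF that v] to_bidual_functional[OF that, of "0\<^sub>v n"] eq by simp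
    then show ?thesis using that by (simp add: W_def)
  qed
  have power: "MVar i ^ N \<cdot>\<^sub>v v = A *\<^sub>v (\<psi> i *\<^sub>v v)" for i
  proof (rule eq_vecI)
    show "dim_vec (MVar i ^ N \<cdot>\<^sub>v v) = dim_vec (A *\<^sub>v (\<psi> i *\<^sub>v v))" using v by (simp add: dims)
    fix k assume "k < dim_vec (A *\<^sub>v (\<psi> i *\<^sub>v v))"
    then have k: "k < n" by (simp add: dims)
    define y where "y = MVar i ^ N \<cdot>\<^sub>v unit_vec n k - row (A * \<psi> i) k"
    have A\<psi>: "A * \<psi> i \<in> carrier_mat n n" using A_carrier psi_carrier[of i] by auto
    have yv: "y \<bullet> u = MVar i ^ N * u $ k - (A *\<^sub>v (\<psi> i *\<^sub>v u)) $ k" if u: "u \<in> carrier_vec n" for u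
    proof -
      have "y \<bullet> u = (MVar i ^ N \<cdot>\<^sub>v unit_vec n k) \<bullet> u - row (A * \<psi> i) k \<bullet> u"
        unfolding y_def using u A\<psi> k by (intro minus_scalar_prod_distrib[of _ n]) auto
      also have "(MVar i ^ N \<cdot>\<^sub>v unit_vec n k) \<bullet> u = MVar i ^ N * u $ k"
        using u k by (simp add: smult_scalar_prod_distrib[of _ n])
      also have "row (A * \<psi> i) k \<bullet> u = ((A * \<psi> i) *\<^sub>v u) $ k"
        by (rule index_mult_mat_vec[symmetric]) (use k in \<open>simp add: dims\<close>)
      also have "(A * \<psi> i) *\<^sub>v u = A *\<^sub>v (\<psi> i *\<^sub>v u)" by (rule assoc_mult_mat_vec[OF A_carrier psi_carrier u])
      finally show ?thesis .
    qed
    have "y \<in> W"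
      unfolding W_def
    proof (intro CollectI conjI ballI)
      show "y \<in> carrier_vec n" using A\<psi> k by (auto simp: y_def)
      fix c :: "'k plane_ring vec" assume c: "c \<in> carrier_vec m"
      have "\<psi> i *\<^sub>v (A *\<^sub>v c) = (\<psi> i * A) *\<^sub>v c" by (rule assoc_mult_mat_vec[OF psi_carrier A_carrier c, symmetric])
      also have "\<dots> = MVar i ^ N \<cdot>\<^sub>v c" unfolding psi_A by (rule scalar_mat_mult_vec[OF c])
      finally have "A *\<^sub>v (\<psi> i *\<^sub>v (A *\<^sub>v c)) = MVar i ^ N \<cdot>\<^sub>v (A *\<^sub>v c)"
        using mult_mat_smult_vec[OF A_carrier c] by simp
      then show "y \<bullet> (A *\<^sub>v c) = 0" unfolding yv[OF Av_carrier[OF c]] using k A_carrier by simp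
    qed
    from Wv[OF this] show "(MVar i ^ N \<cdot>\<^sub>v v) $ k = (A *\<^sub>v (\<psi> i *\<^sub>v v)) $ k"
      unfolding yv[OF v] using k v by simp
  qed
  let ?u = "\<lambda>i. \<psi> i *\<^sub>v v"
  have u: "?u i \<in> carrier_vec m" for i using psi_carrier[of i] by (intro carrier_vecI) simp
  have eq01: "MVar 1 ^ N \<cdot>\<^sub>v ?u 0 = MVar 0 ^ N \<cdot>\<^sub>v ?u 1"
  proof -
    have "\<psi> 1 *\<^sub>v (MVar 0 ^ N \<cdot>\<^sub>v v) = MVar 1 ^ N \<cdot>\<^sub>v ?u 0"
    proof -
      have "\<psi> 1 *\<^sub>v (A *\<^sub>v ?u 0) = (\<psi> 1 * A) *\<^sub>v ?u 0" by (rule assoc_mult_mat_vec[OF psi_carrier A_carrier u, symmetric])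
      also have "\<dots> = MVar 1 ^ N \<cdot>\<^sub>v ?u 0" unfolding psi_A by (rule scalar_mat_mult_vec[OF u])
      finally show ?thesis unfolding power .
    qed
    then show ?thesis using mult_mat_smult_vec[OF psi_carrier v, of 1 "MVar 0 ^ N"] by simp
  qed
  have "\<exists>w. ?u 0 $ j = MVar 0 ^ N * w" if "j < m" for j
  proof -
    have "MVar 1 ^ N * ?u 0 $ j = MVar 0 ^ N * ?u 1 $ j"
      using arg_cong[OF eq01, of "\<lambda>v. vec_index v j"] that carrier_vecD[OF u[of 0]] carrier_vecD[OF u[of 1]]
      by (simp del: index_mult_mat_vec dim_mult_mat_vec)
    then show ?thesis by (rule variable_powers_coprime) auto
  qed
  then obtain w where w: "\<And>j. j < m \<Longrightarrow> ?u 0 $ j = MVar 0 ^ N * w j" by metis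
  have u0: "?u 0 = MVar 0 ^ N \<cdot>\<^sub>v vec m w"
    using w carrier_vecD[OF u[of 0]] by (intro eq_vecI) (auto simp del: index_mult_mat_vec dim_mult_mat_vec)
  have "MVar 0 ^ N \<cdot>\<^sub>v v = MVar 0 ^ N \<cdot>\<^sub>v (A *\<^sub>v vec m w)"
    unfolding power[of 0] u0 by (rule mult_mat_smult_vec[OF A_carrier]) simp
  then have "v = A *\<^sub>v vec m w"
    using v by (intro eq_vecI) (auto simp: vec_eq_iff dims simp del: index_mult_mat_vec)
  then show ?thesis by (intro that[of "vec m w"]) auto
qed

lemma xi_kills:
  assumes c: "c \<in> carrier_vec m" shows "\<xi> *\<^sub>v (A *\<^sub>v c) = 0\<^sub>v s"
proof -
  have "cls (A *\<^sub>v c) = cls (0\<^sub>v n)"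
    using cls_zero_iff[OF Av_carrier[OF c]] c by (auto simp: col_space_def dims)
  then have "L (A *\<^sub>v c) = L (0 \<cdot>\<^sub>v (A *\<^sub>v c))"
  proof -
    have "0 \<cdot>\<^sub>v (A *\<^sub>v c) = 0\<^sub>v n" by (rule zero_smult_vec[OF Av_carrier[OF c]])
    then show ?thesis using \<open>cls (A *\<^sub>v c) = cls (0\<^sub>v n)\<close> by (simp add: L_def)
  qed
  also have "\<dots> = 0 \<cdot>\<^sub>v L (A *\<^sub>v c)" by (rule L_smult[OF Av_carrier[OF c]])
  also have "\<dots> = 0\<^sub>v s" by (rule zero_smult_vec[OF L_carrier[OF Av_carrier[OF c]]])
  finally show ?thesis by (simp add: xi_mult[OF Av_carrier[OF c]])
qed

text \<open>The cokernel of \<open>\<xi>\<close> is killed by \<open>x\<^sub>i\<^sup>N\<close>, by the lemma on multiples of elements of the bidual.\<close>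

lemma xi_right_inverse:
  obtains \<eta> where "\<eta> \<in> carrier_mat n s" "\<xi> * \<eta> = MVar i ^ N \<cdot>\<^sub>m 1\<^sub>m s"
proof -
  have "\<exists>v. v \<in> carrier_vec n \<and> L v = MVar i ^ N \<cdot>\<^sub>v unit_vec s l" if "l < s" for l
  proof -
    have "unit_vec s l \<in> \<Theta> ` carrier F"
      unfolding bij_betw_imp_surj_on[OF Theta_bij] by simp
    then obtain \<omega> where \<omega>: "\<omega> \<in> carrier F" "\<Theta> \<omega> = unit_vec s l" by auto
    obtain v where v: "v \<in> carrier_vec n" "\<And>y. y \<in> W \<Longrightarrow> MVar i ^ N * \<omega> (functional y) = y \<bullet> v"
      using bidual_multiple[OF psi_carrier psi_A \<omega>(1)] by metis
    have "to_bidual E (cls v) = MVar i ^ N \<odot>\<^bsub>F\<^esub> \<omega>"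
    proof (rule bidual_eqI[OF bidual_extensional(1)[OF to_bidual_in_F[OF v(1)]] bidual_extensional(3)])
      fix y assume y: "y \<in> W"
      show "to_bidual E (cls v) (functional y) = (MVar i ^ N \<odot>\<^bsub>F\<^esub> \<omega>) (functional y)"
        unfolding bidual_smult_apply[OF y] to_bidual_functional[OF y v(1)] v(2)[OF y] ..
    qed
    then have "L v = MVar i ^ N \<cdot>\<^sub>v unit_vec s l" unfolding L_def using Theta_smult[OF \<omega>(1)] \<omega>(2) by simp
    then show ?thesis using v(1) by blast
  qed
  then obtain v where v: "\<And>l. l < s \<Longrightarrow> v l \<in> carrier_vec n" "\<And>l. l < s \<Longrightarrow> L (v l) = MVar i ^ N \<cdot>\<^sub>v unit_vec s l"
    by metis
  let ?\<eta> = "mat n s (\<lambda>(k, l). v l $ k)"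
  have "\<xi> * ?\<eta> = MVar i ^ N \<cdot>\<^sub>m 1\<^sub>m s"
  proof (rule eq_matI)
    fix k l assume "k < dim_row (MVar i ^ N \<cdot>\<^sub>m 1\<^sub>m s :: 'k plane_ring mat)" "l < dim_col (MVar i ^ N \<cdot>\<^sub>m 1\<^sub>m s :: 'k plane_ring mat)"
    then have kl: "k < s" "l < s" by auto
    have col: "col ?\<eta> l = v l" using kl v(1)[of l] by (intro eq_vecI) auto
    have "(\<xi> * ?\<eta>) $$ (k, l) = row \<xi> k \<bullet> v l"
      using kl xi_carrier col by simp
    also have "\<dots> = (\<xi> *\<^sub>v v l) $ k" using kl xi_carrier by simp
    also have "\<xi> *\<^sub>v v l = MVar i ^ N \<cdot>\<^sub>v unit_vec s l" using xi_mult[OF v(1)[OF kl(2)]] v(2)[OF kl(2)] by simp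
    finally show "(\<xi> * ?\<eta>) $$ (k, l) = (MVar i ^ N \<cdot>\<^sub>m 1\<^sub>m s) $$ (k, l)" using kl by (auto simp: unit_vec_def)
  qed (use xi_carrier in auto)
  then show ?thesis by (intro that[of ?\<eta>]) auto
qed

end

section \<open>The kernel of the map to the Rees algebra\<close>

lemma mpoly_on_eq: "mpoly_on V = subring_record (mpolys V)"
  by (simp add: mpoly_on_def mpolys_def)

lemma subring_closed_mpolys: "subring_closed (mpolys V)"
  by (auto simp: subring_closed_def)

lemma is_ideal_of_ideal:
  "ideal I (mpoly_on V) \<Longrightarrow> is_ideal V I"
  unfolding mpoly_on_eq ideal_subring_record_iff[OF subring_closed_mpolys] is_ideal_def by blast

context coker_matrix
begin

definition relations :: "('a vec set, 'a) mpoly set" where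
  "relations = {MVar (x \<oplus>\<^bsub>E\<^esub> y) - MVar x - MVar y | x y. x \<in> carrier E \<and> y \<in> carrier E} \<union>
    {MVar (a \<odot>\<^bsub>E\<^esub> x) - MConst a * MVar x | a x. x \<in> carrier E}"

lemma sym_relations_eq: "sym_relations E = Idl\<^bsub>mpoly_on (carrier E)\<^esub> relations"
  by (simp add: sym_relations_def relations_def)

lemma relations_carrier: "relations \<subseteq> mpolys (carrier E)"
proof -
  have "x \<oplus>\<^bsub>E\<^esub> y \<in> carrier E" "a \<odot>\<^bsub>E\<^esub> x \<in> carrier E" if "x \<in> carrier E" "y \<in> carrier E" for x y a
    using that by (auto simp: carrier_E add_E smult_E)
  then show ?thesis unfolding relations_def by (auto intro!: mpolys_diff mpolys_mult mpolys_MVar)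
qed

lemma cring_mpoly_on: "cring (mpoly_on V)"
  unfolding mpoly_on_eq by (rule cring_subring_record[OF subring_closed_mpolys])

lemma ideal_sym_relations: "ideal (sym_relations E) (mpoly_on (carrier E))"
  unfolding sym_relations_eq
  by (rule ring.genideal_ideal[OF cring.axioms(1)[OF cring_mpoly_on]]) (simp add: relations_carrier)

lemma relations_subset: "relations \<subseteq> sym_relations E"
  unfolding sym_relations_eq
  by (rule ring.genideal_self[OF cring.axioms(1)[OF cring_mpoly_on]]) (simp add: relations_carrier)

lemma add_relation:
  "x \<in> carrier E \<Longrightarrow> y \<in> carrier E \<Longrightarrow> MVar (x \<oplus>\<^bsub>E\<^esub> y) - MVar x - MVar y \<in> sym_relations E"
  by (rule subsetD[OF relations_subset], unfold relations_def, rule UnI1, rule CollectI) blast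

lemma smult_relation:
  "x \<in> carrier E \<Longrightarrow> MVar (a \<odot>\<^bsub>E\<^esub> x) - MConst a * MVar x \<in> sym_relations E"
  by (rule subsetD[OF relations_subset], unfold relations_def, rule UnI2, rule CollectI) blast

lemma sym_relations_minimal:
  "ideal I (mpoly_on (carrier E)) \<Longrightarrow> relations \<subseteq> I \<Longrightarrow> sym_relations E \<subseteq> I"
  unfolding sym_relations_eq
  by (rule ring.genideal_minimal[OF cring.axioms(1)[OF cring_mpoly_on]])

definition J :: "(nat, 'a) mpoly set" where "J = lin_ideal {..<n} (row_form A) m"

lemma is_ideal_J: "is_ideal {..<n} J" unfolding J_def by (rule is_ideal_lin_ideal)

lemma lin_form_congruent:
  assumes v: "v \<in> carrier_vec n" "u \<in> carrier_vec n" and eq: "cls v = cls u"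
  shows "lin_form v - lin_form u \<in> J"
proof -
  obtain c where c: "c \<in> carrier_vec m" "v = A *\<^sub>v c + u" using cls_eq_iff[OF v] eq by blast
  have "lin_form v = lin_form (A *\<^sub>v c) + lin_form u"
    unfolding c(2) by (rule lin_form_add[OF Av_carrier[OF c(1)] v(2)])
  then have "lin_form v - lin_form u = (\<Sum>j<m. MConst (c $ j) * row_form A j)"
    using lin_form_mult_mat_vec[OF A_carrier c(1)] by simp
  then show ?thesis
    unfolding J_def lin_ideal_def by (auto intro!: exI[of _ "\<lambda>j. MConst (c $ j)"])
qed

text \<open>A presentation of the symmetric algebra by \<open>n\<close> variables needs a linear form for each element of the
cokernel. The forms of two representatives differ by an element of \<open>J\<close>, so any choice is good.\<close>

definition rep :: "'a vec set \<Rightarrow> 'a vec" where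
  "rep x = (SOME v. v \<in> carrier_vec n \<and> x = cls v)"

lemma rep: "x \<in> carrier E \<Longrightarrow> rep x \<in> carrier_vec n" "x \<in> carrier E \<Longrightarrow> cls (rep x) = x"
proof -
  assume "x \<in> carrier E"
  then have "\<exists>v. v \<in> carrier_vec n \<and> x = cls v" by (auto simp: carrier_E)
  from someI_ex[OF this] show "rep x \<in> carrier_vec n" "cls (rep x) = x" unfolding rep_def by auto
qed

definition lower :: "('a vec set, 'a) mpoly \<Rightarrow> (nat, 'a) mpoly" where
  "lower = alg_eval (\<lambda>x. lin_form (rep x))"

interpretation lower: comm_ring_hom lower unfolding lower_def by (rule comm_ring_hom_alg_eval)

lemma lower_MVar: "lower (MVar x) = lin_form (rep x)" and lower_MConst: "lower (MConst c) = MConst c"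
  by (simp_all add: lower_def)

lemma lower_sym_relations: "q \<in> sym_relations E \<Longrightarrow> lower q \<in> J"
proof -
  let ?I = "{q \<in> mpolys (carrier E). lower q \<in> J}"
  have mem: "lower q \<in> mpolys {..<n}" if "q \<in> mpolys (carrier E)" for q
    unfolding lower_def using that by (rule mpolys_alg_eval) (auto intro!: lin_form_mpolys rep)
  have "ideal ?I (mpoly_on (carrier E))"
    unfolding mpoly_on_eq ideal_subring_record_iff[OF subring_closed_mpolys]
    using is_idealD[OF is_ideal_J] mem by (auto simp: lower.hom_add lower.hom_mult)
  moreover have "relations \<subseteq> ?I"
  proof
    fix q assume q: "q \<in> relations"
    then consider x y where "q = MVar (x \<oplus>\<^bsub>E\<^esub> y) - MVar x - MVar y" "x \<in> carrier E" "y \<in> carrier E"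
      | a x where "q = MVar (a \<odot>\<^bsub>E\<^esub> x) - MConst a * MVar x" "x \<in> carrier E"
      unfolding relations_def by blast
    then have "lower q \<in> J"
    proof cases
      case 1
      note r = rep[OF 1(2)] rep[OF 1(3)]
      have xy: "x \<oplus>\<^bsub>E\<^esub> y = cls (rep x + rep y)" using add_E[OF r(1,3)] r by simp
      have c: "rep x + rep y \<in> carrier_vec n" using r by simp
      then have "x \<oplus>\<^bsub>E\<^esub> y \<in> carrier E" by (simp add: xy)
      from lin_form_congruent[OF rep(1)[OF this] c] rep(2)[OF this]
      have "lin_form (rep (x \<oplus>\<^bsub>E\<^esub> y)) - lin_form (rep x + rep y) \<in> J" by (simp add: xy)
      then show ?thesis
        unfolding 1(1) by (simp add: lower.hom_minus lower.hom_add lower_MVar lin_form_add[OF r(1,3)] diff_diff_eq)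
    next
      case 2
      note r = rep[OF 2(2)]
      have ax: "a \<odot>\<^bsub>E\<^esub> x = cls (a \<cdot>\<^sub>v rep x)" using smult_E[OF r(1), of a] r by simp
      have c: "a \<cdot>\<^sub>v rep x \<in> carrier_vec n" using r by simp
      then have "a \<odot>\<^bsub>E\<^esub> x \<in> carrier E" by (simp add: ax)
      from lin_form_congruent[OF rep(1)[OF this] c] rep(2)[OF this]
      have "lin_form (rep (a \<odot>\<^bsub>E\<^esub> x)) - lin_form (a \<cdot>\<^sub>v rep x) \<in> J" by (simp add: ax)
      then show ?thesis
        by (simp add: 2(1) lower.hom_minus lower.hom_mult lin_form_smult lower_MVar lower_MConst)
    qed
    then show "q \<in> ?I" using q relations_carrier by auto
  qed
  ultimately have "sym_relations E \<subseteq> ?I" by (rule sym_relations_minimal)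
  then show "q \<in> sym_relations E \<Longrightarrow> lower q \<in> J" by auto
qed

definition lift :: "(nat, 'a) mpoly \<Rightarrow> ('a vec set, 'a) mpoly" where
  "lift = alg_eval (\<lambda>i. MVar (cls (unit_vec n i)))"

interpretation lift: comm_ring_hom lift unfolding lift_def by (rule comm_ring_hom_alg_eval)

lemma lift_MVar: "lift (MVar i) = MVar (cls (unit_vec n i))" and lift_MConst: "lift (MConst c) = MConst c"
  by (simp_all add: lift_def)

lemma lift_mpolys: "p \<in> mpolys {..<n} \<Longrightarrow> lift p \<in> mpolys (carrier E)"
  unfolding lift_def by (rule mpolys_alg_eval) (auto intro!: mpolys_MVar)

lemma lower_lift:
  assumes "p \<in> mpolys {..<n}" shows "lower (lift p) - p \<in> J"
proof -
  have "alg_eval (\<lambda>i. lin_form (rep (cls (unit_vec n i)))) p - alg_eval MVar p \<in> J"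
  proof (rule alg_eval_congruent[OF is_ideal_J assms])
    fix i assume "i \<in> {..<n}"
    then have i: "i < n" by simp
    have c: "cls (unit_vec n i) \<in> carrier E" by simp
    show "lin_form (rep (cls (unit_vec n i))) - MVar i \<in> J"
      using lin_form_congruent[OF rep(1)[OF c] _ rep(2)[OF c]] by (simp add: lin_form_unit[OF i])
    show "lin_form (rep (cls (unit_vec n i))) \<in> mpolys {..<n}" by (rule lin_form_mpolys[OF rep(1)[OF c]])
    show "MVar i \<in> mpolys {..<n}" using i by (intro mpolys_MVar) simp
  qed
  then show ?thesis by (simp add: lower_def lift_def alg_eval_alg_eval)
qed

lemma lift_lin_form:
  assumes v: "v \<in> carrier_vec n" shows "lift (lin_form v) - MVar (cls v) \<in> sym_relations E"
proof -
  let ?I = "sym_relations E"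
  have I: "is_ideal (carrier E) ?I" by (rule is_ideal_of_ideal[OF ideal_sym_relations])
  define t where "t k = vec n (\<lambda>j. if j < k then v $ j else 0)" for k
  have tc: "t k \<in> carrier_vec n" for k by (simp add: t_def)
  have "lift (lin_form (t k)) - MVar (cls (t k)) \<in> ?I" if "k \<le> n" for k
    using that
  proof (induction k)
    case 0
    have t0: "t 0 = 0\<^sub>v n" "t 0 = 0 \<cdot>\<^sub>v 0\<^sub>v n" by (auto simp: t_def)
    have "MVar (0 \<odot>\<^bsub>E\<^esub> cls (0\<^sub>v n)) - MConst 0 * MVar (cls (0\<^sub>v n)) \<in> ?I"
      by (rule smult_relation) simp
    then have "MVar (cls (t 0)) \<in> ?I" using smult_E[of "0\<^sub>v n" 0] unfolding t0(2) by simp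
    then have "- 1 * MVar (cls (t 0)) \<in> ?I" by (intro is_idealD(3)[OF I]) auto
    then show ?case by (simp add: t0(1))
  next
    case (Suc k)
    let ?e = "unit_vec n k :: 'a vec"
    have tS: "t (Suc k) = t k + v $ k \<cdot>\<^sub>v ?e"
      using Suc.prems by (intro eq_vecI) (auto simp: t_def unit_vec_def less_Suc_eq)
    have 1: "lift (lin_form (t k)) - MVar (cls (t k)) \<in> ?I" using Suc by simp
    have "MVar (cls (t k) \<oplus>\<^bsub>E\<^esub> cls (v $ k \<cdot>\<^sub>v ?e)) - MVar (cls (t k)) - MVar (cls (v $ k \<cdot>\<^sub>v ?e)) \<in> ?I"
      using tc[of k] by (intro add_relation) auto
    then have 2: "MVar (cls (t (Suc k))) - MVar (cls (t k)) - MVar (cls (v $ k \<cdot>\<^sub>v ?e)) \<in> ?I"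
      using add_E[OF tc[of k], of "v $ k \<cdot>\<^sub>v ?e"] by (simp add: tS)
    have "MVar (v $ k \<odot>\<^bsub>E\<^esub> cls ?e) - MConst (v $ k) * MVar (cls ?e) \<in> ?I"
      by (rule smult_relation) simp
    then have 3: "MVar (cls (v $ k \<cdot>\<^sub>v ?e)) - MConst (v $ k) * MVar (cls ?e) \<in> ?I"
      by (simp add: smult_E)
    have "lift (lin_form (t (Suc k))) = lift (lin_form (t k)) + MConst (v $ k) * MVar (cls ?e)"
      unfolding tS using Suc.prems
      by (simp add: lin_form_add[OF tc] lin_form_smult lin_form_unit lift.hom_add lift.hom_mult lift_MVar lift_MConst)
    then have "lift (lin_form (t (Suc k))) - MVar (cls (t (Suc k))) =
      (lift (lin_form (t k)) - MVar (cls (t k))) -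
      ((MVar (cls (t (Suc k))) - MVar (cls (t k)) - MVar (cls (v $ k \<cdot>\<^sub>v ?e))) +
       (MVar (cls (v $ k \<cdot>\<^sub>v ?e)) - MConst (v $ k) * MVar (cls ?e)))" by simp
    also have "\<dots> \<in> ?I" by (intro is_ideal_diff[OF I 1] is_idealD(2)[OF I 2 3])
    finally show ?case .
  qed
  from this[of n] have "lift (lin_form (t n)) - MVar (cls (t n)) \<in> ?I" by simp
  moreover have "t n = v" using v by (intro eq_vecI) (auto simp: t_def)
  ultimately show ?thesis by simp
qed

lemma lift_J: assumes "p \<in> J" shows "lift p \<in> sym_relations E"
proof -
  let ?I = "sym_relations E"
  have I: "is_ideal (carrier E) ?I" by (rule is_ideal_of_ideal[OF ideal_sym_relations])
  have zero: "MVar (cls (0\<^sub>v n)) \<in> ?I"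
  proof -
    have "lift (lin_form (0\<^sub>v n)) - MVar (cls (0\<^sub>v n)) \<in> ?I" by (rule lift_lin_form) simp
    then have "- 1 * (lift (lin_form (0\<^sub>v n)) - MVar (cls (0\<^sub>v n))) \<in> ?I" by (intro is_idealD(3)[OF I]) auto
    then show ?thesis by simp
  qed
  have row: "lift (row_form A j) \<in> ?I" if j: "j < m" for j
  proof -
    have col: "col A j \<in> carrier_vec n" using A_carrier by auto
    have "col A j = A *\<^sub>v unit_vec m j" using A_carrier j by (intro eq_vecI) auto
    then have "cls (col A j) = cls (0\<^sub>v n)"
      unfolding cls_zero_iff[OF col] by (auto simp: col_space_def dims)
    then have "lift (row_form A j) - MVar (cls (0\<^sub>v n)) \<in> ?I"
      using lift_lin_form[OF col] by (simp add: row_form_eq)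
    from is_idealD(2)[OF I this zero] show ?thesis by simp
  qed
  obtain h where h: "p = (\<Sum>j<m. h j * row_form A j)" "\<forall>j. h j \<in> mpolys {..<n}"
    using assms unfolding J_def lin_ideal_def by blast
  show ?thesis
    unfolding h(1) lift.hom_sum lift.hom_mult
    using h(2) by (intro is_ideal_sum[OF I] is_idealD(3)[OF I] row lift_mpolys) auto
qed

end

lemma (in coker_matrix) sym_class_mult_zero_iff:
  assumes "p \<in> mpolys (carrier E)"
  shows "sym_class E p \<in> carrier (sym_algebra E)"
    and "sym_class E (MConst a) \<otimes>\<^bsub>sym_algebra E\<^esub> sym_class E p = \<zero>\<^bsub>sym_algebra E\<^esub> \<longleftrightarrow>
      MConst a * p \<in> sym_relations E"
proof -
  let ?R = "mpoly_on (carrier E)"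
  interpret ideal "sym_relations E" ?R by (rule ideal_sym_relations)
  show "sym_class E p \<in> carrier (sym_algebra E)"
    using assms by (auto simp: sym_class_def sym_algebra_def FactRing_def A_RCOSETS_def RCOSETS_def a_r_coset_def)
  have "sym_class E (MConst a) \<otimes>\<^bsub>sym_algebra E\<^esub> sym_class E p = sym_class E (MConst a * p)"
    unfolding sym_class_def sym_algebra_def FactRing_def
    using rcoset_mult_add[of "MConst a" p] assms by (simp add: mpoly_on_def mpolys_def[symmetric])
  moreover have "sym_class E q = \<zero>\<^bsub>sym_algebra E\<^esub> \<longleftrightarrow> q \<in> sym_relations E" if "q \<in> mpolys (carrier E)" for q
    unfolding sym_class_def sym_algebra_def FactRing_def
    using that a_rcos_const[of q] a_rcos_self[of q] by auto
  ultimately show "sym_class E (MConst a) \<otimes>\<^bsub>sym_algebra E\<^esub> sym_class E p = \<zero>\<^bsub>sym_algebra E\<^esub> \<longleftrightarrow>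
      MConst a * p \<in> sym_relations E"
    using assms by (simp add: mpolys_mult)
qed

text \<open>Substituting representatives (\<open>lower\<close>) and classes of unit vectors (\<open>lift\<close>) are inverse to each other
modulo the relations, so the symmetric algebra of the cokernel is \<open>R[T]\<close> modulo the column forms. The
Rees algebra is its quotient by the torsion.\<close>

lemma rees_kernel_eq:
  fixes A :: "'a::idom mat"
  assumes A: "A \<in> carrier_mat n m"
  shows "rees_kernel A = {p \<in> mpolys {..<n}. \<exists>c. c \<noteq> 0 \<and> MConst c * p \<in> lin_ideal {..<n} (row_form A) m}"
proof -
  interpret coker_matrix A n m by unfold_locales (rule A)
  interpret I: ideal "sym_relations E" "mpoly_on (carrier E)" by (rule ideal_sym_relations)
  let ?Q = "sym_algebra E"
  have Q: "cring ?Q" unfolding sym_algebra_def by (rule I.quotient_is_cring[OF cring_mpoly_on])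
  interpret Q: cring ?Q by (rule Q)
  have carrierQ: "\<exists>p\<in>mpolys (carrier E). z = sym_class E p" if "z \<in> carrier ?Q" for z
    using that by (auto simp: sym_algebra_def FactRing_def A_RCOSETS_def RCOSETS_def sym_class_def a_r_coset_def)
  have constQ: "sym_class E (MConst a) \<in> carrier ?Q" for a by (rule sym_class_mult_zero_iff) auto
  have const_mult: "sym_class E (MConst (a * b)) = sym_class E (MConst a) \<otimes>\<^bsub>?Q\<^esub> sym_class E (MConst b)" for a b
    unfolding sym_class_def sym_algebra_def FactRing_def
    using I.rcoset_mult_add[of "MConst a" "MConst b"] by (simp add: mpoly_on_def mpolys_def[symmetric] MConst.hom_mult)
  have "ideal (sym_torsion E) ?Q"
  proof (rule ideal_of_closed[OF Q])
    show "sym_torsion E \<subseteq> carrier ?Q" by (auto simp: sym_torsion_def)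
    show "\<zero>\<^bsub>?Q\<^esub> \<in> sym_torsion E" using constQ[of 1] by (auto simp: sym_torsion_def intro!: exI[of _ 1])
  next
    fix x y assume "x \<in> sym_torsion E" "y \<in> sym_torsion E"
    then obtain a b where ab: "x \<in> carrier ?Q" "y \<in> carrier ?Q" "a \<noteq> 0" "b \<noteq> 0"
      "sym_class E (MConst a) \<otimes>\<^bsub>?Q\<^esub> x = \<zero>\<^bsub>?Q\<^esub>" "sym_class E (MConst b) \<otimes>\<^bsub>?Q\<^esub> y = \<zero>\<^bsub>?Q\<^esub>"
      by (auto simp: sym_torsion_def)
    have "sym_class E (MConst (a * b)) \<otimes>\<^bsub>?Q\<^esub> x = \<zero>\<^bsub>?Q\<^esub>"
      unfolding mult.commute[of a b] const_mult using ab constQ by (simp add: Q.m_assoc)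
    moreover have "sym_class E (MConst (a * b)) \<otimes>\<^bsub>?Q\<^esub> y = \<zero>\<^bsub>?Q\<^esub>"
      unfolding const_mult using ab constQ by (simp add: Q.m_assoc)
    ultimately have "sym_class E (MConst (a * b)) \<otimes>\<^bsub>?Q\<^esub> (x \<oplus>\<^bsub>?Q\<^esub> y) = \<zero>\<^bsub>?Q\<^esub>"
      using ab constQ by (simp add: Q.r_distr)
    moreover have "a * b \<noteq> 0" using ab by simp
    ultimately show "x \<oplus>\<^bsub>?Q\<^esub> y \<in> sym_torsion E" using ab by (auto simp: sym_torsion_def intro!: exI[of _ "a * b"])
  next
    fix q x assume q: "q \<in> carrier ?Q" and "x \<in> sym_torsion E"
    then obtain a where a: "x \<in> carrier ?Q" "a \<noteq> 0" "sym_class E (MConst a) \<otimes>\<^bsub>?Q\<^esub> x = \<zero>\<^bsub>?Q\<^esub>"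
      by (auto simp: sym_torsion_def)
    have "sym_class E (MConst a) \<otimes>\<^bsub>?Q\<^esub> (q \<otimes>\<^bsub>?Q\<^esub> x) = q \<otimes>\<^bsub>?Q\<^esub> (sym_class E (MConst a) \<otimes>\<^bsub>?Q\<^esub> x)"
      using a q constQ by (intro Q.m_lcomm) auto
    then show "q \<otimes>\<^bsub>?Q\<^esub> x \<in> sym_torsion E" using a q by (auto simp: sym_torsion_def intro!: exI[of _ a])
  qed
  then interpret T: ideal "sym_torsion E" ?Q .
  have "rees_class E (lift p) = \<zero>\<^bsub>rees_algebra E\<^esub> \<longleftrightarrow> (\<exists>a. a \<noteq> 0 \<and> MConst a * p \<in> J)"
    if p: "p \<in> mpolys {..<n}" for p
  proof -
    note lp = lift_mpolys[OF p]
    have c: "sym_class E (lift p) \<in> carrier ?Q" by (rule sym_class_mult_zero_iff[OF lp])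
    have "rees_class E (lift p) = \<zero>\<^bsub>rees_algebra E\<^esub> \<longleftrightarrow> sym_class E (lift p) \<in> sym_torsion E"
      unfolding rees_class_def rees_algebra_def FactRing_def
      using T.a_rcos_const T.a_rcos_self[OF c] by auto
    also have "\<dots> \<longleftrightarrow> (\<exists>a. a \<noteq> 0 \<and> MConst a * lift p \<in> sym_relations E)"
      unfolding sym_torsion_def mem_Collect_eq sym_class_mult_zero_iff(2)[OF lp] using c by blast
    also have "\<dots> \<longleftrightarrow> (\<exists>a. a \<noteq> 0 \<and> MConst a * p \<in> J)"
    proof -
      have "MConst a * lift p \<in> sym_relations E \<longleftrightarrow> MConst a * p \<in> J" for a
      proof
        assume "MConst a * lift p \<in> sym_relations E"
        from lower_sym_relations[OF this] have "MConst a * lower (lift p) \<in> J"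
          by (simp add: lower_def alg_eval.hom_mult)
        moreover have "MConst a * (lower (lift p) - p) \<in> J"
          by (rule is_idealD(3)[OF is_ideal_J mpolys_MConst lower_lift[OF p]])
        ultimately have "MConst a * lower (lift p) - MConst a * (lower (lift p) - p) \<in> J"
          by (rule is_ideal_diff[OF is_ideal_J])
        then show "MConst a * p \<in> J" by (simp add: algebra_simps)
      next
        assume "MConst a * p \<in> J"
        from lift_J[OF this] show "MConst a * lift p \<in> sym_relations E"
          by (simp add: lift_def alg_eval.hom_mult)
      qed
      then show ?thesis by simp
    qed
    finally show ?thesis .
  qed
  then show ?thesis
    unfolding rees_kernel_def a_kernel_def' dims J_def lift_def by auto
qed

section \<open>Ideals of the Rees algebra\<close>

context rees_extension
begin

lemma subring_closed_RE: "subring_closed RE"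
proof -
  have "- p \<in> RE" if "p \<in> RE" for p
    using RE_mult[OF RE_MConst[of "-1"] that] by (simp add: MConst.hom_uminus)
  then show ?thesis
    unfolding subring_closed_def using RE_MConst[of 1] RE_add RE_mult by auto
qed

lemma ideal_RE_iff: "ideal I (subring_record RE) \<longleftrightarrow> I \<subseteq> RE \<and> RE_submodule I"
  unfolding ideal_subring_record_iff[OF subring_closed_RE] RE_submodule_def ..

lemma RE_submodule_K: "RE_submodule K"
  unfolding RE_submodule_def using K_add K_mult by auto

text \<open>The closure properties under \<open>RE\<close> are the ideals of the ring record, so generation and minimality
can be read off from \<open>exists_minimal_generators\<close>.\<close>

theorem minimal_generators:
  "\<exists>G. minimal_generating_set (subring_record RE) G K \<and>
    (\<forall>p\<in>G. \<exists>a b. p \<in> bigraded_part \<sigma> a b) \<and>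
    {g * (\<Prod>i<s. MVar i ^ \<alpha> i) | \<alpha> :: nat \<Rightarrow> nat.
       (\<forall>i. r \<le> i \<longrightarrow> i < s \<longrightarrow> \<alpha> i = 0) \<and> (\<Sum>i<s. \<alpha> i * \<sigma> i) \<le> d m - d (m - 1)} =
    {p \<in> G. \<exists>a b. int (d (m - 1)) \<le> a \<and> p \<in> bigraded_part \<sigma> a b}"
proof -
  obtain G where G: "A0 \<subseteq> G" "G \<subseteq> A0 \<union> H" "0 \<notin> G"
    and gen: "\<And>I. RE_submodule I \<Longrightarrow> G \<subseteq> I \<Longrightarrow> K \<subseteq> I"
    and min: "\<And>G'. G' \<subset> G \<Longrightarrow> \<exists>I. RE_submodule I \<and> G' \<subseteq> I \<and> I \<subseteq> K \<and> I \<noteq> K"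
    using exists_minimal_generators by blast
  have GK: "G \<subseteq> K" using G(2) A0_subset_K by (auto simp: H_def)
  have ring: "ring (subring_record RE)" by (rule cring.axioms(1)[OF cring_subring_record[OF subring_closed_RE]])
  have GRE: "G \<subseteq> carrier (subring_record RE)" using GK K_subset_RE by simp
  have "Idl\<^bsub>subring_record RE\<^esub> G = K"
  proof (rule equalityI)
    have "ideal K (subring_record RE)" by (simp add: ideal_RE_iff K_subset_RE RE_submodule_K)
    then show "Idl\<^bsub>subring_record RE\<^esub> G \<subseteq> K" using GK by (rule ring.genideal_minimal[OF ring])
    have "ideal (Idl\<^bsub>subring_record RE\<^esub> G) (subring_record RE)" by (rule ring.genideal_ideal[OF ring GRE])
    then have "RE_submodule (Idl\<^bsub>subring_record RE\<^esub> G)" by (simp add: ideal_RE_iff)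
    then show "K \<subseteq> Idl\<^bsub>subring_record RE\<^esub> G" using ring.genideal_self[OF ring GRE] by (rule gen)
  qed
  moreover have "Idl\<^bsub>subring_record RE\<^esub> G' \<noteq> K" if sub: "G' \<subset> G" for G'
  proof -
    obtain I where I: "RE_submodule I" "G' \<subseteq> I" "I \<subseteq> K" "I \<noteq> K" using min[OF sub] by blast
    then have "ideal I (subring_record RE)" using K_subset_RE by (auto simp: ideal_RE_iff)
    then have "Idl\<^bsub>subring_record RE\<^esub> G' \<subseteq> I" using I(2) by (rule ring.genideal_minimal[OF ring])
    with I(3,4) show ?thesis by blast
  qed
  ultimately have mgs: "minimal_generating_set (subring_record RE) G K"
    unfolding minimal_generating_set_def using GK by blast
  have hom: "\<exists>a b. p \<in> bigraded_part \<sigma> a b" if "p \<in> G" for p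
  proof (cases "p \<in> A0")
    case True
    then show ?thesis by (rule A0_bigraded) blast
  next
    case False
    then have "p \<in> H" using that G(2) by blast
    then show ?thesis by (auto simp: H_def)
  qed
  show ?thesis
    unfolding A0_alt using mgs hom high_degree_part[OF G, symmetric] by (intro exI[of _ G] conjI ballI)
qed

end

section \<open>From the resolution to the Rees algebra\<close>

text \<open>If \<open>x = c \<bullet> f\<close>, then \<open>x v - (v \<bullet> f) c\<close> is a syzygy of \<open>f\<close>, so it is \<open>\<phi> \<psi> v\<close> for a matrix \<open>\<psi>\<close>. For a column \<open>v\<close>
of \<open>\<phi>\<close> the second term vanishes, and injectivity of \<open>\<phi>\<close> gives \<open>\<psi> \<phi> = x\<close>.\<close>

lemma hilbert_burch_left_inverse:
  fixes \<phi> :: "'a::comm_ring_1 mat"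
  assumes f: "f \<in> carrier_vec n" and \<phi>: "\<phi> \<in> carrier_mat n k"
    and inj: "inj_on (\<lambda>c. \<phi> *\<^sub>v c) (carrier_vec k)"
    and exact: "col_space \<phi> = {v \<in> carrier_vec n. v \<bullet> f = 0}"
    and x: "x = (\<Sum>l<n. c l * f $ l)"
  obtains \<psi> where "\<psi> \<in> carrier_mat k n" "\<psi> * \<phi> = x \<cdot>\<^sub>m 1\<^sub>m k"
proof -
  define cv where "cv = vec n c"
  have cv: "cv \<in> carrier_vec n" by (simp add: cv_def)
  have cvf: "cv \<bullet> f = x" using f by (simp add: x cv_def scalar_prod_def lessThan_atLeast0)
  have "\<exists>u. u \<in> carrier_vec k \<and> x \<cdot>\<^sub>v v - (v \<bullet> f) \<cdot>\<^sub>v cv = \<phi> *\<^sub>v u" if v: "v \<in> carrier_vec n" for v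
  proof -
    let ?w = "x \<cdot>\<^sub>v v - (v \<bullet> f) \<cdot>\<^sub>v cv"
    have "?w \<bullet> f = x * (v \<bullet> f) - (v \<bullet> f) * (cv \<bullet> f)"
      using v cv f by (simp add: minus_scalar_prod_distrib[of _ n] smult_scalar_prod_distrib[of _ n])
    then have "?w \<in> col_space \<phi>" unfolding exact using v cv by (simp add: cvf mult.commute)
    then show ?thesis using \<phi> by (auto simp: col_space_def)
  qed
  then obtain u where u: "\<And>v. v \<in> carrier_vec n \<Longrightarrow> u v \<in> carrier_vec k"
    "\<And>v. v \<in> carrier_vec n \<Longrightarrow> x \<cdot>\<^sub>v v - (v \<bullet> f) \<cdot>\<^sub>v cv = \<phi> *\<^sub>v u v" by metis
  define \<psi> where "\<psi> = mat k n (\<lambda>(i, j). u (unit_vec n j) $ i)"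
  have \<psi>: "\<psi> \<in> carrier_mat k n" by (simp add: \<psi>_def)
  have col: "col \<psi> j = u (unit_vec n j)" if "j < n" for j
    using that u(1)[of "unit_vec n j"] by (intro eq_vecI) (auto simp: \<psi>_def)
  have \<phi>\<psi>: "(\<phi> * \<psi>) $$ (i, j) = (if i = j then x else 0) - f $ j * c i" if ij: "i < n" "j < n" for i j
  proof -
    have "(\<phi> * \<psi>) $$ (i, j) = (\<phi> *\<^sub>v u (unit_vec n j)) $ i" using ij \<phi> \<psi> col[of j] by simp
    also have "\<dots> = (x \<cdot>\<^sub>v unit_vec n j - (unit_vec n j \<bullet> f) \<cdot>\<^sub>v cv) $ i" using u(2)[of "unit_vec n j"] by simp
    also have "unit_vec n j \<bullet> f = f $ j" using f ij by simp
    finally show ?thesis using ij by (simp add: cv_def unit_vec_def)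
  qed
  have "\<psi> * \<phi> = x \<cdot>\<^sub>m 1\<^sub>m k"
  proof (rule eq_matI)
    fix i j assume "i < dim_row (x \<cdot>\<^sub>m 1\<^sub>m k)" "j < dim_col (x \<cdot>\<^sub>m 1\<^sub>m k)"
    then have ij: "i < k" "j < k" by auto
    have cj: "col \<phi> j \<in> carrier_vec n" using \<phi> by auto
    have "col \<phi> j = \<phi> *\<^sub>v unit_vec k j" using \<phi> ij by (intro eq_vecI) auto
    then have "col \<phi> j \<in> col_space \<phi>" using \<phi> by (auto simp: col_space_def)
    then have cf: "col \<phi> j \<bullet> f = 0" unfolding exact by simp
    have "\<phi> *\<^sub>v (\<psi> *\<^sub>v col \<phi> j) = (\<phi> * \<psi>) *\<^sub>v col \<phi> j" by (rule assoc_mult_mat_vec[OF \<phi> \<psi> cj, symmetric])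
    also have "\<dots> = x \<cdot>\<^sub>v col \<phi> j"
    proof (rule eq_vecI)
      fix l assume "l < dim_vec (x \<cdot>\<^sub>v col \<phi> j)"
      then have l: "l < n" using \<phi> by simp
      have "(B *\<^sub>v col \<phi> j) $ l = (\<Sum>p<n. B $$ (l, p) * \<phi> $$ (p, j))" if "B \<in> carrier_mat n n" for B
        using that l ij \<phi> by (simp add: scalar_prod_def lessThan_atLeast0)
      from this[of "\<phi> * \<psi>"] have "((\<phi> * \<psi>) *\<^sub>v col \<phi> j) $ l = (\<Sum>p<n. (\<phi> * \<psi>) $$ (l, p) * \<phi> $$ (p, j))"
        using \<phi> \<psi> by simp
      also have "\<dots> = (\<Sum>p<n. (if l = p then x * \<phi> $$ (p, j) else 0) - c l * (\<phi> $$ (p, j) * f $ p))"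
        using l by (intro sum.cong refl) (auto simp: \<phi>\<psi> algebra_simps simp del: index_mult_mat(1))
      also have "\<dots> = x * \<phi> $$ (l, j) - c l * (col \<phi> j \<bullet> f)"
        using l ij \<phi> f by (simp add: sum_subtractf sum_distrib_left scalar_prod_def lessThan_atLeast0)
      finally show "((\<phi> * \<psi>) *\<^sub>v col \<phi> j) $ l = (x \<cdot>\<^sub>v col \<phi> j) $ l" using l ij \<phi> by (simp add: cf)
    qed (use \<phi> in simp)
    also have "\<dots> = \<phi> *\<^sub>v (x \<cdot>\<^sub>v unit_vec k j)"
      unfolding \<open>col \<phi> j = \<phi> *\<^sub>v unit_vec k j\<close> by (rule mult_mat_smult_vec[OF \<phi>, symmetric]) simp
    finally have "\<psi> *\<^sub>v col \<phi> j = x \<cdot>\<^sub>v unit_vec k j"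
      by (rule inj_onD[OF inj]) (use \<psi> in \<open>auto intro: carrier_vecI\<close>)
    then have "(\<psi> *\<^sub>v col \<phi> j) $ i = x * (if i = j then 1 else 0)" using ij by (simp add: unit_vec_def)
    then show "(\<psi> * \<phi>) $$ (i, j) = (x \<cdot>\<^sub>m 1\<^sub>m k) $$ (i, j)" using ij \<phi> \<psi> by simp
  qed (use \<phi> \<psi> in auto)
  with \<psi> show ?thesis by (rule that)
qed

lemma col_first_cols: "j < k \<Longrightarrow> col (first_cols k \<phi>) j = col \<phi> j"
  by (auto simp: first_cols_def col_def)

lemma row_form_first_cols: "j < k \<Longrightarrow> row_form (first_cols k \<phi>) j = row_form \<phi> j"
  by (simp add: row_form_eq col_first_cols)

lemma first_cols_carrier: "\<phi> \<in> carrier_mat n l \<Longrightarrow> first_cols k \<phi> \<in> carrier_mat n k"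
  by (simp add: first_cols_def)

text \<open>The first \<open>m\<close> rows of \<open>\<psi> i\<close> split the first \<open>m\<close> columns, which gives \<open>\<xi>\<close> its right inverse \<open>\<eta>0 i\<close>. The next
row \<open>\<rho>\<close> of \<open>\<psi> i\<close> is a functional on the cokernel with value \<open>x\<^sub>i\<^sup>N\<close> on column \<open>m\<close>, and \<open>\<beta> i = \<rho> \<eta>0 i\<close> extends it
to the bidual. The extension costs another factor \<open>x\<^sub>i\<^sup>N\<close>, hence the exponent \<open>2N\<close>.\<close>

lemma rees_extension_of_resolution:
  fixes \<phi> :: "'k::field plane_ring mat"
  assumes m: "m < k"
    and phi: "\<phi> \<in> carrier_mat n k" and forms: "\<And>i j. i < n \<Longrightarrow> j < k \<Longrightarrow> \<phi> $$ (i, j) \<in> forms (int (d j))"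
    and mono: "\<And>j. j < m \<Longrightarrow> d j \<le> d (m - 1)" "d (m - 1) \<le> d m"
    and psi: "\<And>i :: 2. \<psi> i \<in> carrier_mat k n" "\<And>i. \<psi> i * \<phi> = MVar i ^ N \<cdot>\<^sub>m 1\<^sub>m k"
    and Theta: "graded_iso_to_free (bidual (first_cols m \<phi>)) (bidual_grading (first_cols m \<phi>)) s \<sigma> \<Theta>"
    and r: "r \<le> s" "\<And>i. i < r \<Longrightarrow> 0 < \<sigma> i" "\<And>i. r \<le> i \<Longrightarrow> i < s \<Longrightarrow> \<sigma> i = 0"
  obtains \<eta> \<beta> where "rees_extension n m s r (2 * N) \<sigma> d (xi_matrix (first_cols m \<phi>) s \<Theta>) (first_cols (Suc m) \<phi>) \<eta> \<beta>"
proof -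
  let ?A = "first_cols m \<phi>"
  let ?P = "first_cols (Suc m) \<phi>"
  let ?\<psi> = "\<lambda>i. mat m n (\<lambda>(p, q). \<psi> i $$ (p, q))"
  let ?a = "col \<phi> m"
  have A: "?A \<in> carrier_mat n m" by (rule first_cols_carrier[OF phi])
  have a: "?a \<in> carrier_vec n" using phi by auto
  have prod: "row (\<psi> i) p \<bullet> col \<phi> q = (if p = q then MVar i ^ N else 0)" if "p < k" "q < k" for i p q
  proof -
    have "row (\<psi> i) p \<bullet> col \<phi> q = (\<psi> i * \<phi>) $$ (p, q)" using that psi(1)[of i] phi by simp
    then show ?thesis unfolding psi(2) using that by simp
  qed
  have "?\<psi> i * ?A = MVar i ^ N \<cdot>\<^sub>m 1\<^sub>m m" for i
  proof (rule eq_matI)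
    fix p q assume "p < dim_row (MVar i ^ N \<cdot>\<^sub>m 1\<^sub>m m :: 'k plane_ring mat)" "q < dim_col (MVar i ^ N \<cdot>\<^sub>m 1\<^sub>m m :: 'k plane_ring mat)"
    then have pq: "p < m" "q < m" by auto
    have "row (?\<psi> i) p = row (\<psi> i) p" using pq m psi(1)[of i] by (intro eq_vecI) auto
    then have "(?\<psi> i * ?A) $$ (p, q) = row (\<psi> i) p \<bullet> col \<phi> q"
      using pq A by (simp add: col_first_cols)
    then show "(?\<psi> i * ?A) $$ (p, q) = (MVar i ^ N \<cdot>\<^sub>m 1\<^sub>m m) $$ (p, q)"
      using prod[of p q i] pq m by simp
  qed (use A in auto)
  then interpret B: bidual_setting ?A n m s N \<sigma> ?\<psi> \<Theta>
    by unfold_locales (use A Theta in auto)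
  have "\<exists>\<eta>. \<eta> \<in> carrier_mat n s \<and> B.\<xi> * \<eta> = MVar i ^ N \<cdot>\<^sub>m 1\<^sub>m s" for i
    using B.xi_right_inverse[of i] by metis
  then obtain \<eta>0 where \<eta>0: "\<And>i. \<eta>0 i \<in> carrier_mat n s" "\<And>i. B.\<xi> * \<eta>0 i = MVar i ^ N \<cdot>\<^sub>m 1\<^sub>m s" by metis
  define \<eta> where "\<eta> i = MVar i ^ N \<cdot>\<^sub>m \<eta>0 i" for i
  define \<beta> where "\<beta> i = vec s (\<lambda>l. row (\<psi> i) m \<bullet> col (\<eta>0 i) l)" for i
  have xia: "B.\<xi> *\<^sub>v ?a \<in> carrier_vec s" using B.xi_carrier by (intro carrier_vecI) simp
  have "rees_extension n m s r (2 * N) \<sigma> d B.\<xi> ?P \<eta> \<beta>"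
  proof
    show "B.\<xi> \<in> carrier_mat s n" by (rule B.xi_carrier)
    show "?P \<in> carrier_mat n (Suc m)" by (rule first_cols_carrier[OF phi])
    show "\<eta> i \<in> carrier_mat n s" for i using \<eta>0(1)[of i] by (simp add: \<eta>_def)
    show "l < s \<Longrightarrow> j < n \<Longrightarrow> B.\<xi> $$ (l, j) \<in> forms (int (\<sigma> l))" for l j by (rule B.xi_forms)
    show "i < n \<Longrightarrow> j \<le> m \<Longrightarrow> ?P $$ (i, j) \<in> forms (int (d j))" for i j
      using forms[of i j] phi m by (simp add: first_cols_def)
    show "B.\<xi> * \<eta> i = MVar i ^ (2 * N) \<cdot>\<^sub>m 1\<^sub>m s" for i
      unfolding \<eta>_def mult_smult_distrib[OF B.xi_carrier \<eta>0(1)] \<eta>0(2)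
      by (intro eq_matI) (auto simp: mult_2 power_add)
    show "B.\<xi> *\<^sub>v col ?P j = 0\<^sub>v s" if "j < m" for j
    proof -
      have "col ?P j = ?A *\<^sub>v unit_vec m j"
        using that A phi by (intro eq_vecI) (auto simp: first_cols_def col_def)
      then show ?thesis using B.xi_kills[of "unit_vec m j"] by simp
    qed
    show "lin_form v \<in> lin_ideal {..<n} (row_form ?P) m" if v: "v \<in> carrier_vec n" and zero: "B.\<xi> *\<^sub>v v = 0\<^sub>v s" for v
    proof -
      obtain c where c: "c \<in> carrier_vec m" "v = ?A *\<^sub>v c" using B.xi_kernel[OF v zero] .
      have "lin_form v = (\<Sum>j<m. MConst (c $ j) * row_form ?P j)"
        unfolding c(2) lin_form_mult_mat_vec[OF A c(1)] by (intro sum.cong) (auto simp: row_form_first_cols)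
      then show ?thesis unfolding lin_ideal_def by (auto intro!: exI[of _ "\<lambda>j. MConst (c $ j)"])
    qed
    show "\<beta> i \<bullet> (B.\<xi> *\<^sub>v col ?P m) = MVar i ^ (2 * N)" for i
    proof -
      let ?u = "\<eta>0 i *\<^sub>v (B.\<xi> *\<^sub>v ?a)"
      have u: "?u \<in> carrier_vec n" using \<eta>0(1)[of i] by (intro carrier_vecI) simp
      have \<rho>: "row (\<psi> i) m \<in> carrier_vec n" using psi(1)[of i] m by auto
      have "B.\<xi> *\<^sub>v ?u = (B.\<xi> * \<eta>0 i) *\<^sub>v (B.\<xi> *\<^sub>v ?a)"
        by (rule assoc_mult_mat_vec[OF B.xi_carrier \<eta>0(1) xia, symmetric])
      also have "\<dots> = MVar i ^ N \<cdot>\<^sub>v (B.\<xi> *\<^sub>v ?a)" unfolding \<eta>0(2) by (rule scalar_mat_mult_vec[OF xia])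
      also have "\<dots> = B.\<xi> *\<^sub>v (MVar i ^ N \<cdot>\<^sub>v ?a)" by (rule mult_mat_smult_vec[OF B.xi_carrier a, symmetric])
      finally have xiu: "B.\<xi> *\<^sub>v ?u = B.\<xi> *\<^sub>v (MVar i ^ N \<cdot>\<^sub>v ?a)" .
      have "B.\<xi> *\<^sub>v (MVar i ^ N \<cdot>\<^sub>v ?a - ?u) = B.\<xi> *\<^sub>v (MVar i ^ N \<cdot>\<^sub>v ?a) - B.\<xi> *\<^sub>v ?u"
        using a u by (intro mult_minus_distrib_mat_vec[OF B.xi_carrier]) auto
      also have "\<dots> = 0\<^sub>v s" unfolding xiu using B.xi_carrier by (intro minus_cancel_vec carrier_vecI) simp
      finally have "B.\<xi> *\<^sub>v (MVar i ^ N \<cdot>\<^sub>v ?a - ?u) = 0\<^sub>v s" .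
      then obtain c where c: "c \<in> carrier_vec m" "MVar i ^ N \<cdot>\<^sub>v ?a - ?u = ?A *\<^sub>v c"
        using B.xi_kernel[of "MVar i ^ N \<cdot>\<^sub>v ?a - ?u"] a u by (metis minus_carrier_vec smult_carrier_vec)
      have "row (\<psi> i) m \<bullet> (?A *\<^sub>v c) = (\<Sum>j<m. (row (\<psi> i) m \<bullet> col \<phi> j) * c $ j)"
      proof -
        have "row (\<psi> i) m \<bullet> (?A *\<^sub>v c) = (\<Sum>q<n. \<Sum>j<m. row (\<psi> i) m $ q * (\<phi> $$ (q, j) * c $ j))"
          using A c(1) phi by (simp add: scalar_prod_def lessThan_atLeast0 sum_distrib_left first_cols_def)
        also have "\<dots> = (\<Sum>j<m. \<Sum>q<n. row (\<psi> i) m $ q * (\<phi> $$ (q, j) * c $ j))" by (rule sum.swap)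
        also have "\<dots> = (\<Sum>j<m. (row (\<psi> i) m \<bullet> col \<phi> j) * c $ j)"
          using phi m by (simp add: scalar_prod_def lessThan_atLeast0 sum_distrib_right mult.assoc)
        finally show ?thesis .
      qed
      also have "\<dots> = 0" using m by (intro sum.neutral ballI) (simp add: prod)
      finally have "row (\<psi> i) m \<bullet> (MVar i ^ N \<cdot>\<^sub>v ?a - ?u) = 0" unfolding c(2) .
      then have "row (\<psi> i) m \<bullet> ?u = MVar i ^ N * (row (\<psi> i) m \<bullet> ?a)"
        using \<rho> a u by (simp add: scalar_prod_minus_distrib[of _ n] scalar_prod_smult_distrib[of _ n])
      also have "\<dots> = MVar i ^ (2 * N)" using m by (simp add: prod mult_2 power_add)
      finally have main: "row (\<psi> i) m \<bullet> ?u = MVar i ^ (2 * N)" .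
      have "\<beta> i \<bullet> w = row (\<psi> i) m \<bullet> (\<eta>0 i *\<^sub>v w)" if w: "w \<in> carrier_vec s" for w
      proof -
        have "\<beta> i \<bullet> w = (\<Sum>l<s. \<Sum>q<n. row (\<psi> i) m $ q * (\<eta>0 i $$ (q, l) * w $ l))"
          using w \<eta>0(1)[of i] by (simp add: \<beta>_def scalar_prod_def lessThan_atLeast0 sum_distrib_right mult.assoc)
        also have "\<dots> = (\<Sum>q<n. \<Sum>l<s. row (\<psi> i) m $ q * (\<eta>0 i $$ (q, l) * w $ l))" by (rule sum.swap)
        also have "\<dots> = row (\<psi> i) m \<bullet> (\<eta>0 i *\<^sub>v w)"
          using w \<eta>0(1)[of i] by (simp add: scalar_prod_def lessThan_atLeast0 sum_distrib_left)
        finally show ?thesis .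
      qed
      from this[OF xia] show ?thesis using main by (simp add: col_first_cols)
    qed
  qed (use mono r in auto)
  then show ?thesis by (rule that)
qed

theorem theorem3p9:
  fixes n m s r dg :: nat
    and f :: "'k::field plane_ring vec"
    and I :: "'k plane_ring set"
    and \<phi> \<phi>m \<xi> :: "'k plane_ring mat"
    and d \<sigma> :: "nat \<Rightarrow> nat"
    and \<Theta> :: "(('k plane_ring vec set \<Rightarrow> 'k plane_ring) \<Rightarrow> 'k plane_ring) \<Rightarrow> 'k plane_ring vec"
  assumes m: "1 \<le> m" "m \<le> n - 2"
    \<comment> \<open>\<open>I\<close> has height two and is minimally generated by the \<open>n\<close> forms \<open>f $ i\<close> of degree \<open>dg\<close>\<close>
    and f_carrier: "f \<in> carrier_vec n"
    and f_forms: "\<forall>i<n. f $ i \<in> forms (int dg)"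
    and f_inj: "inj_on (\<lambda>i. f $ i) {..<n}"
    and I_gens: "minimal_generating_set class_ring ((\<lambda>i. f $ i) ` {..<n}) I"
    and I_height: "ideal_height class_ring I = 2"
    \<comment> \<open>graded Hilbert-Burch resolution; column \<open>j\<close> of \<open>\<phi>\<close> (counted from 0) has degree \<open>d j\<close>\<close>
    and phi_carrier: "\<phi> \<in> carrier_mat n (n - 1)"
    and phi_forms: "\<forall>i<n. \<forall>j<n - 1. \<phi> $$ (i, j) \<in> forms (int (d j))"
    and phi_inj: "inj_on (\<lambda>c. \<phi> *\<^sub>v c) (carrier_vec (n - 1))"
    and phi_exact: "col_space \<phi> = {v \<in> carrier_vec n. v \<bullet> f = 0}"
    and d_pos: "1 \<le> d 0"
    and d_mono: "\<forall>i j. i \<le> j \<longrightarrow> j < n - 1 \<longrightarrow> d i \<le> d j"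
    \<comment> \<open>\<open>E = coker \<phi>m\<close> and \<open>\<Theta>\<close> is the fixed graded isomorphism from \<open>F\<close>, the bidual of \<open>E\<close>\<close>
    and phi_m: "\<phi>m = first_cols m \<phi>"
    and s: "s = n - m"
    and Theta: "graded_iso_to_free (bidual \<phi>m) (bidual_grading \<phi>m) s \<sigma> \<Theta>"
    and sigma_decr: "\<forall>i j. i \<le> j \<longrightarrow> j < s \<longrightarrow> \<sigma> j \<le> \<sigma> i"
    and r: "1 \<le> r" "r \<le> s" "\<forall>i<r. 0 < \<sigma> i" "\<forall>i. r \<le> i \<longrightarrow> i < s \<longrightarrow> \<sigma> i = 0"
    and xi: "\<xi> = xi_matrix \<phi>m s \<Theta>"
  shows "\<exists>G. minimal_generating_set (rees_subring \<xi>) G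
               (to_w \<xi> ` rees_kernel (first_cols (m + 1) \<phi>)) \<and>
             (\<forall>p\<in>G. \<exists>a b. p \<in> bigraded_part \<sigma> a b) \<and>
             {to_w \<xi> (row_form \<phi> m) * (\<Prod>i<s. MVar i ^ \<alpha> i) | \<alpha> :: nat \<Rightarrow> nat.
                (\<forall>i. r \<le> i \<longrightarrow> i < s \<longrightarrow> \<alpha> i = 0) \<and> (\<Sum>i<s. \<alpha> i * \<sigma> i) \<le> d m - d (m - 1)} =
             {p \<in> G. \<exists>a b. int (d (m - 1)) \<le> a \<and> p \<in> bigraded_part \<sigma> a b}"
proof -
  have mn: "m < n - 1" using m by simp
  have power: "\<exists>N c. MVar i ^ N = (\<Sum>l<n. c l * f $ l)" for i :: 2
  proof -
    have n: "0 < n" "1 < n" using m by linarith+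
    then have "f $ 0 \<noteq> f $ 1" using inj_onD[OF f_inj, of 0 1] by auto
    then have "f $ 0 \<noteq> 0 \<or> f $ 1 \<noteq> 0" by auto
    then have "\<exists>l<n. f $ l \<noteq> 0" using n by blast
    moreover have "I = Idl\<^bsub>class_ring\<^esub> ((\<lambda>i. f $ i) ` {..<n})" using I_gens by (simp add: minimal_generating_set_def)
    ultimately show ?thesis
      using variable_power_in_height_two_ideal[of n "\<lambda>l. f $ l" dg I i] f_forms I_height by metis
  qed
  obtain N0 c0 where N0: "MVar 0 ^ N0 = (\<Sum>l<n. c0 l * f $ l)" using power[of 0] by blast
  obtain N1 c1 where N1: "MVar 1 ^ N1 = (\<Sum>l<n. c1 l * f $ l)" using power[of 1] by blast
  \<comment> \<open>one exponent that serves both variables\<close>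
  define N where "N = N0 + N1"
  have "\<exists>c. MVar i ^ N = (\<Sum>l<n. c l * f $ l)" for i :: 2
  proof -
    have "MVar 0 ^ N = (\<Sum>l<n. (MVar 0 ^ N1 * c0 l) * f $ l)"
      by (simp add: N_def power_add N0 sum_distrib_left mult_ac)
    moreover have "MVar 1 ^ N = (\<Sum>l<n. (MVar 1 ^ N0 * c1 l) * f $ l)"
      by (simp add: N_def power_add N1 sum_distrib_left mult_ac)
    ultimately show ?thesis using two_cases[of i] by metis
  qed
  then obtain c where c: "\<And>i :: 2. MVar i ^ N = (\<Sum>l<n. c i l * f $ l)" by metis
  have "\<exists>\<psi>. \<psi> \<in> carrier_mat (n - 1) n \<and> \<psi> * \<phi> = MVar i ^ N \<cdot>\<^sub>m 1\<^sub>m (n - 1)" for i :: 2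
    by (rule hilbert_burch_left_inverse[OF f_carrier phi_carrier phi_inj phi_exact c[of i]]) blast
  then obtain \<psi> where \<psi>: "\<And>i :: 2. \<psi> i \<in> carrier_mat (n - 1) n" "\<And>i. \<psi> i * \<phi> = MVar i ^ N \<cdot>\<^sub>m 1\<^sub>m (n - 1)"
    by metis
  have mono: "d j \<le> d (m - 1)" if "j < m" for j
    using d_mono that mn by simp
  have mono': "d (m - 1) \<le> d m" using d_mono mn by simp
  obtain \<eta> \<beta> where "rees_extension n m s r (2 * N) \<sigma> d (xi_matrix (first_cols m \<phi>) s \<Theta>) (first_cols (Suc m) \<phi>) \<eta> \<beta>"
    using rees_extension_of_resolution[OF mn phi_carrier _ mono mono' \<psi> Theta[unfolded phi_m] r(2)] phi_forms r by blast
  then interpret X: rees_extension n m s r "2 * N" \<sigma> d \<xi> "first_cols (Suc m) \<phi>" \<eta> \<beta>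
    by (simp add: xi phi_m)
  have "rees_subring \<xi> = subring_record X.RE"
    using X.xi_carrier by (simp add: rees_subring_def mpoly_on_def X.RE_def mpolys_def)
  moreover have "to_w \<xi> ` rees_kernel (first_cols (m + 1) \<phi>) = X.K"
    using X.K_eq_image rees_kernel_eq[OF X.phi_carrier] by simp
  moreover have "to_w \<xi> (row_form \<phi> m) = X.g"
    by (simp add: X.g_def row_form_first_cols)
  ultimately show ?thesis using X.minimal_generators by simp
qed

end
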